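(* Under the setting and notation of the context, suppose Assumption $(\mathcal A^p_1)$ holds for every $p=1,\dots,m$. Then, as $x\to\infty$, $$\mathbb P[X^{(m)}\ge x]=\delta_1(\log x)^{\delta_2}x^{\delta_3}\exp\left\{-\frac{\log^2x}{2\delta_4}\right\}\left(1+O\left((\log x)^{-1/2}\right)\right).$$
   Context: Let $Y=(Y_1,\dots,Y_n)$ be a Gaussian vector with mean $\mu\in\mathbb R^n$ and covariance matrix $\mathfrak B=(b_{ij})$ with $\det\mathfrak B>0$. For $1\le m\le n$ let $X^{(m)}=\sum_{k=1}^me^{Y_k}-\sum_{k=m+1}^ne^{Y_k}$. For $p\in\{1,\dots,m\}$ let $\Delta^p_{m,n}$ be the set of $w\in\mathbb R^n$ with $w_i=0$ for $i\in\{1,\dots,m\}\setminus\{p\}$, $w_p\ge0$, $w_i\le0$ for $i=m+1,\dots,n$, and $\sum_iw_i=1$; let $\bar w_p$ be the unique minimizer of $w^\top\mathfrak Bw$ over $\Delta^p_{m,n}$. Let $\bar I^{(p)}=\{i:(\bar w_p)_i\ne0\}=\{\bar k^{(p)}(1)<\dots<\bar k^{(p)}(\bar n^{(p)})\}$, $\bar\mu^{(p)}_i=\mu_{\bar k^{(p)}(i)}$, $\bar{\mathfrak B}^{(p)}=(b_{\bar k^{(p)}(i),\bar k^{(p)}(j)})_{i,j=1}^{\bar n^{(p)}}$, $\bar a^{(p)}_{ij}$ the entries of its inverse, $\bar A^{(p)}_k=\sum_{j=1}^{\bar n^{(p)}}\bar a^{(p)}_{kj}$, and $\bar S^{(p)}=\sum_{j=1}^{\bar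 n^{(p)}}\bar A^{(p)}_j$. Assumption $(\mathcal A^p_1)$: for every $i\in\{m+1,\dots,n\}\setminus\bar I^{(p)}$, $(e^i-\bar w_p)^\top\mathfrak B\bar w_p\ne0$, where $e^i$ is the $i$-th standard basis vector. Define $C^{(p)}=\frac{1}{\sqrt{2\pi\det\bar{\mathfrak B}^{(p)}}}\sqrt{\frac{\bar S^{(p)}}{\prod_{i}|\bar A^{(p)}_i|}}\exp\{-\frac12\sum_{i,l=1}^{\bar n^{(p)}}\bar a^{(p)}_{il}(\log\frac{\bar S^{(p)}}{|\bar A^{(p)}_i|}+\bar\mu^{(p)}_i)(\log\frac{\bar S^{(p)}}{|\bar A^{(p)}_l|}+\bar\mu^{(p)}_l)\}$, $\delta_{1,p}=C^{(p)}/\bar S^{(p)}$, $\delta_{2,p}=-\frac{1+\bar n^{(p)}}{2}$, $\delta_{3,p}=\sum_{i=1}^{\bar n^{(p)}}\bar A^{(p)}_i(\log\frac{\bar S^{(p)}}{|\bar A^{(p)}_i|}+\bar\mu^{(p)}_i)$, $\delta_{4,p}=(\bar S^{(p)})^{-1}$. Then $\delta_4=\max_{1\le p\le m}\delta_{4,p}$, $\mathcal P_4=\{p:\delta_{4,p}=\delta_4\}$; $\delta_3=\max_{p\in\mathcal P_4}\delta_{3,p}$, $\mathcal P_3=\{p\in\mathcal P_4:\delta_{3,p}=\delta_3\}$; $\delta_2=\max_{p\in\mathcal P_3}\delta_{2,p}$, $\mathcal P_2=\{p\in\mathcal P_3:\delta_{2,p}=\delta_2\}$; $\delta_1=\sum_{p\in\mathcal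 P_2}\delta_{1,p}$. *)

theory Defs
  imports "HOL-Probability.Probability" "Jordan_Normal_Form.Gauss_Jordan_Elimination"
    "Jordan_Normal_Form.DL_Submatrix" "Jordan_Normal_Form.Determinant"
begin

text \<open>Conventions: indices are 0-based. The paper's index i in {1..n} corresponds to i-1 here;
  the "positive" indices {1..m} become {0..<m}, the "negative" ones {m+1..n} become {m..<n}.
  Vectors in R^n are JNF vectors (real vec of dimension n); sample points of Y are
  functions nat => real (extensional on {0..<n}) so that the product Lebesgue measure can be used.\<close>

definition gauss_density :: "nat \<Rightarrow> real vec \<Rightarrow> real mat \<Rightarrow> (nat \<Rightarrow> real) \<Rightarrow> ennreal" where
  "gauss_density n \<mu> B y =
     ennreal (exp (-(1/2) * ((vec n y - \<mu>) \<bullet> (the (mat_inverse B) *\<^sub>v (vec n y - \<mu>))))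
              / sqrt ((2*pi)^n * det B))"

definition Xm :: "nat \<Rightarrow> nat \<Rightarrow> (nat \<Rightarrow> real) \<Rightarrow> real" where
  "Xm m n y = (\<Sum>k<m. exp (y k)) - (\<Sum>k\<in>{m..<n}. exp (y k))"

definition Delta_mnp :: "nat \<Rightarrow> nat \<Rightarrow> nat \<Rightarrow> real vec set" where
  "Delta_mnp m n p = {w \<in> carrier_vec n. (\<forall>i<m. i \<noteq> p \<longrightarrow> w $ i = 0) \<and> w $ p \<ge> 0 \<and>
       (\<forall>i\<in>{m..<n}. w $ i \<le> 0) \<and> (\<Sum>i<n. w $ i) = 1}"

definition wbar :: "real mat \<Rightarrow> nat \<Rightarrow> nat \<Rightarrow> nat \<Rightarrow> real vec" where
  "wbar B m n p = (THE w. w \<in> Delta_mnp m n p \<and>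
       (\<forall>v\<in>Delta_mnp m n p. w \<bullet> (B *\<^sub>v w) \<le> v \<bullet> (B *\<^sub>v v)))"

definition Ibar :: "real mat \<Rightarrow> nat \<Rightarrow> nat \<Rightarrow> nat \<Rightarrow> nat set" where
  "Ibar B m n p = {i. i < n \<and> wbar B m n p $ i \<noteq> 0}"

definition nbar :: "real mat \<Rightarrow> nat \<Rightarrow> nat \<Rightarrow> nat \<Rightarrow> nat" where
  "nbar B m n p = card (Ibar B m n p)"

text \<open>kbar(i) = pick (Ibar) i enumerates Ibar increasingly.\<close>
definition mubar :: "real vec \<Rightarrow> real mat \<Rightarrow> nat \<Rightarrow> nat \<Rightarrow> nat \<Rightarrow> real vec" where
  "mubar \<mu> B m n p = vec (nbar B m n p) (\<lambda>i. \<mu> $ pick (Ibar B m n p) i)"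

definition Bbar :: "real mat \<Rightarrow> nat \<Rightarrow> nat \<Rightarrow> nat \<Rightarrow> real mat" where
  "Bbar B m n p = submatrix B (Ibar B m n p) (Ibar B m n p)"

definition abar :: "real mat \<Rightarrow> nat \<Rightarrow> nat \<Rightarrow> nat \<Rightarrow> real mat" where
  "abar B m n p = the (mat_inverse (Bbar B m n p))"

definition Abar :: "real mat \<Rightarrow> nat \<Rightarrow> nat \<Rightarrow> nat \<Rightarrow> nat \<Rightarrow> real" where
  "Abar B m n p k = (\<Sum>j<nbar B m n p. abar B m n p $$ (k, j))"

definition Sbar :: "real mat \<Rightarrow> nat \<Rightarrow> nat \<Rightarrow> nat \<Rightarrow> real" where
  "Sbar B m n p = (\<Sum>j<nbar B m n p. Abar B m n p j)"

definition Lbar :: "real vec \<Rightarrow> real mat \<Rightarrow> nat \<Rightarrow> nat \<Rightarrow> nat \<Rightarrow> nat \<Rightarrow> real" where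
  "Lbar \<mu> B m n p i = ln (Sbar B m n p / \<bar>Abar B m n p i\<bar>) + mubar \<mu> B m n p $ i"

definition Cp :: "real vec \<Rightarrow> real mat \<Rightarrow> nat \<Rightarrow> nat \<Rightarrow> nat \<Rightarrow> real" where
  "Cp \<mu> B m n p =
     1 / sqrt (2 * pi * det (Bbar B m n p))
     * sqrt (Sbar B m n p / (\<Prod>i<nbar B m n p. \<bar>Abar B m n p i\<bar>))
     * exp (-(1/2) * (\<Sum>i<nbar B m n p. \<Sum>l<nbar B m n p.
              abar B m n p $$ (i, l) * Lbar \<mu> B m n p i * Lbar \<mu> B m n p l))"

definition delta1p :: "real vec \<Rightarrow> real mat \<Rightarrow> nat \<Rightarrow> nat \<Rightarrow> nat \<Rightarrow> real" where
  "delta1p \<mu> B m n p = Cp \<mu> B m n p / Sbar B m n p"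

definition delta2p :: "real mat \<Rightarrow> nat \<Rightarrow> nat \<Rightarrow> nat \<Rightarrow> real" where
  "delta2p B m n p = - (1 + real (nbar B m n p)) / 2"

definition delta3p :: "real vec \<Rightarrow> real mat \<Rightarrow> nat \<Rightarrow> nat \<Rightarrow> nat \<Rightarrow> real" where
  "delta3p \<mu> B m n p = (\<Sum>i<nbar B m n p. Abar B m n p i * Lbar \<mu> B m n p i)"

definition delta4p :: "real mat \<Rightarrow> nat \<Rightarrow> nat \<Rightarrow> nat \<Rightarrow> real" where
  "delta4p B m n p = 1 / Sbar B m n p"

definition delta4 :: "real mat \<Rightarrow> nat \<Rightarrow> nat \<Rightarrow> real" where
  "delta4 B m n = Max ((\<lambda>p. delta4p B m n p) ` {..<m})"

definition P4 :: "real mat \<Rightarrow> nat \<Rightarrow> nat \<Rightarrow> nat set" where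
  "P4 B m n = {p \<in> {..<m}. delta4p B m n p = delta4 B m n}"

definition delta3 :: "real vec \<Rightarrow> real mat \<Rightarrow> nat \<Rightarrow> nat \<Rightarrow> real" where
  "delta3 \<mu> B m n = Max ((\<lambda>p. delta3p \<mu> B m n p) ` P4 B m n)"

definition P3 :: "real vec \<Rightarrow> real mat \<Rightarrow> nat \<Rightarrow> nat \<Rightarrow> nat set" where
  "P3 \<mu> B m n = {p \<in> P4 B m n. delta3p \<mu> B m n p = delta3 \<mu> B m n}"

definition delta2 :: "real vec \<Rightarrow> real mat \<Rightarrow> nat \<Rightarrow> nat \<Rightarrow> real" where
  "delta2 \<mu> B m n = Max ((\<lambda>p. delta2p B m n p) ` P3 \<mu> B m n)"

definition P2 :: "real vec \<Rightarrow> real mat \<Rightarrow> nat \<Rightarrow> nat \<Rightarrow> nat set" where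
  "P2 \<mu> B m n = {p \<in> P3 \<mu> B m n. delta2p B m n p = delta2 \<mu> B m n}"

definition delta1 :: "real vec \<Rightarrow> real mat \<Rightarrow> nat \<Rightarrow> nat \<Rightarrow> real" where
  "delta1 \<mu> B m n = (\<Sum>p\<in>P2 \<mu> B m n. delta1p \<mu> B m n p)"

definition assumption_A1 :: "real mat \<Rightarrow> nat \<Rightarrow> nat \<Rightarrow> nat \<Rightarrow> bool" where
  "assumption_A1 B m n p \<longleftrightarrow>
     (\<forall>i\<in>{m..<n} - Ibar B m n p.
        (unit_vec n i - wbar B m n p) \<bullet> (B *\<^sub>v wbar B m n p) \<noteq> 0)"

end

theory Submission
  imports Defs "HOL-Real_Asymp.Real_Asymp"
begin

text \<open>With \<open>t = ln x\<close>, the exceedance event sits near the points \<open>t * ys p\<close>, where \<open>ys p\<close> is \<open>B\<close> applied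
  to the normalised minimizer \<open>u p\<close> of the quadratic form over the \<open>p\<close>-th feasible set. Shifting the Gaussian
  law by \<open>t * ys p\<close> turns the density into \<open>exp (- t\<^sup>2 S / 2 - t * (u p \<bullet> z))\<close> times the unshifted one. On
  the half-space \<open>u p \<bullet> y \<ge> t S - C\<close>, which contains the event when coordinate \<open>p\<close> is the largest
  positive one, this bounds the probability by \<open>exp (C' t - t\<^sup>2 S / 2)\<close>, with a further factor
  \<open>exp (- c t\<^sup>2)\<close> away from the dominating point. So only the indices with the smallest \<open>S\<close> matter, and
  near their dominating points only the coordinates in the active set \<open>I\<close> contribute, since all others
  are of order at most \<open>x\<close> to a power below one.

  For the active coordinates no multivariate Laplace method is needed: the integral of \<open>exp (- t a \<bullet> z)\<close>
  over \<open>exp (z p) - (\<Sum>j. exp (z j)) > 1\<close> is an exact quotient of Gamma functions (an iterated Beta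
  integral), evaluated by Stirling's formula. The same quotient with \<open>a\<close> tilted by a unit vector gives the
  moments of \<open>exp (z i)\<close> and \<open>exp (- z i)\<close>, hence concentration of \<open>z\<close> at rate \<open>t powr (-1/2)\<close> around the
  point \<open>ln (\<bar>a i\<bar> / S)\<close>, at which the remaining Gaussian factor may be frozen.\<close>

section \<open>Stirling's formula for the real Gamma function\<close>

text \<open>At the minimizer w with value \<tau>, stationarity makes B w equal to \<tau> on the
  support of w and at most \<tau> at the remaining negative indices. Hence u = w / \<tau>, S = 1 /
  \<tau>, and the dominating point has coordinate 1 on the active set. The proof needs these
  coordinates strictly below 1 everywhere else. At inactive negative indices
  \<open>assumption_A1\<close> excludes equality; at the other positive indices strictness is
  automatic when S is minimal, by positive definiteness. The resulting gap makes the tubes around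
  the dominating points disjoint and keeps the inactive summands so small that they amount to moving
  the level t by 1 / t^2; this changes a Gaussian tail only by a factor 1 + O(1 / t). The rate t
  powr (-1/2) has two sources: a first-power deviation is bounded through second moments of order 1
  / t, and indices tied in S and in the linear exponent have powers of t that differ by multiples of
  1/2, because the sizes of active sets are integers.\<close>

definition stirling_rem :: "real \<Rightarrow> real" where
  "stirling_rem x = ln (Gamma x) - (x - 1/2) * ln x + x - ln (2 * pi) / 2"

text \<open>\<open>stirling_rem\<close> is Binet's function, the error in Stirling's formula. Its
  increment is governed by the integral of 1 / s over [x, x + 1], which lies between the midpoint
  and the trapezoid value. The trapezoid excess is exactly
  \<open>1 / (4 * x) - 1 / (4 * (x + 1))\<close>, which telescopes; this is the origin of the factor
  4 in the later error bounds.\<close>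

lemma stirling_rem_step:
  assumes x: "x > 0"
  shows "stirling_rem (x + 1) \<le> stirling_rem x"
    and "stirling_rem x - 1 / (4 * x) \<le> stirling_rem (x + 1) - 1 / (4 * (x + 1))"
proof -
  have "Gamma (x + 1) = x * Gamma x"
    using x by (intro Gamma_plus1) (auto elim!: nonpos_Ints_cases)
  hence "ln (Gamma (x + 1)) = ln x + ln (Gamma x)"
    using x Gamma_real_pos[OF x] by (metis ln_mult_pos)
  hence d: "stirling_rem x - stirling_rem (x + 1) = (x + 1/2) * (ln (x + 1) - ln x) - 1"
    by (simp add: stirling_rem_def algebra_simps)
  have lo: "ln (x + 1) - ln x \<ge> 2 / (2 * x + 1)"
    using ln_inverse_approx_ge[of x "x + 1"] x by (simp add: field_simps)
  have up: "ln (x + 1) - ln x \<le> (1 / x + 1 / (x + 1)) / 2"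
    using ln_inverse_approx_le[of x 1] x by (simp add: field_simps)
  have "(x + 1/2) * (2 / (2 * x + 1)) \<le> (x + 1/2) * (ln (x + 1) - ln x)"
    using x lo by (intro mult_left_mono) auto
  moreover have "(x + 1/2) * (2 / (2 * x + 1)) = 1" using x by (simp add: field_simps)
  ultimately show "stirling_rem (x + 1) \<le> stirling_rem x" using d by linarith
  have "(x + 1/2) * (ln (x + 1) - ln x) \<le> (x + 1/2) * ((1 / x + 1 / (x + 1)) / 2)"
    using x up by (intro mult_left_mono) auto
  moreover have "(x + 1/2) * ((1 / x + 1 / (x + 1)) / 2) - 1 = 1 / (4 * x) - 1 / (4 * (x + 1))"
    using x by (simp add: divide_simps) (simp add: algebra_simps power2_eq_square)
  ultimately show "stirling_rem x - 1 / (4 * x) \<le> stirling_rem (x + 1) - 1 / (4 * (x + 1))"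
    using d by linarith
qed

lemma stirling_rem_mono:
  assumes x: "x > 0"
  shows "stirling_rem (x + real n) \<le> stirling_rem x"
    and "stirling_rem x - 1 / (4 * x) \<le> stirling_rem (x + real n) - 1 / (4 * (x + real n))"
proof (induction n)
  case (Suc n)
  { case 1 show ?case using stirling_rem_step(1)[of "x + real n"] x Suc(1) by (simp add: add_ac) }
  { case 2 show ?case using stirling_rem_step(2)[of "x + real n"] x Suc(2) by (simp add: add_ac) }
qed auto

text \<open>Gauss's limit for Gamma compares the values at x + n + 1 and n + 1; its logarithm leaves
  an elementary expression that tends to 0. So the limit along x, x + 1, ... is the same for every
  starting point.\<close>

lemma stirling_rem_shift_tendsto:
  assumes x: "x > 0"
  shows "(\<lambda>n. stirling_rem (x + real n + 1) - stirling_rem (real n + 1)) \<longlonglongrightarrow> 0"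
proof -
  have np: "x \<notin> \<int>\<^sub>\<le>\<^sub>0" using x by (auto elim!: nonpos_Ints_cases)
  have G: "Gamma x > 0" using x by simp
  have "(\<lambda>n. ln (Gamma_series x n / Gamma x)) \<longlonglongrightarrow> ln (Gamma x / Gamma x)"
    using G by (intro tendsto_intros Gamma_series_LIMSEQ) auto
  hence lim: "(\<lambda>n. ln (Gamma_series x n / Gamma x)) \<longlonglongrightarrow> 0" using G by simp
  have ev: "eventually (\<lambda>n. stirling_rem (x + real n + 1) - stirling_rem (real n + 1) =
      (x * ln (real n) - (x + real n + 1/2) * ln (x + real n + 1) + (real n + 1/2) * ln (real n + 1) + x)
      - ln (Gamma_series x n / Gamma x)) sequentially"
    using eventually_gt_at_top[of 0]
  proof eventually_elim
    case (elim n)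
    have "pochhammer x (Suc n) = Gamma (x + real n + 1) / Gamma x"
      using pochhammer_Gamma[OF np, of "Suc n"] by (simp add: add_ac)
    hence "Gamma_series x n / Gamma x = Gamma (real n + 1) * exp (x * ln (real n)) / Gamma (x + real n + 1)"
      using elim G by (simp add: Gamma_series_def Gamma_fact add_ac)
    hence "ln (Gamma_series x n / Gamma x) = ln (Gamma (real n + 1)) + x * ln (real n) - ln (Gamma (x + real n + 1))"
      using Gamma_real_pos[of "real n + 1"] Gamma_real_pos[of "x + real n + 1"] x
      by (simp add: ln_div ln_mult_pos add_pos_nonneg del: Gamma_real_pos)
    thus ?case by (simp add: stirling_rem_def algebra_simps)
  qed
  have "(\<lambda>n. x * ln (real n) - (x + real n + 1/2) * ln (x + real n + 1) + (real n + 1/2) * ln (real n + 1) + x) \<longlonglongrightarrow> 0"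
    by real_asymp
  from tendsto_diff[OF this lim] show ?thesis
    using tendsto_cong[OF ev] by simp
qed

text \<open>Along unit steps the remainder decreases while the remainder minus 1 / (4x) increases,
  so it lies between the common limit \<open>c\<close> and \<open>c\<close> plus 1 / (4x). What
  remains is \<open>c = 0\<close>, that is, the value ln (2 pi) / 2 of Stirling's constant.\<close>

lemma stirling_rem_bounds:
  assumes x: "x > 0"
  shows "0 \<le> stirling_rem x" "stirling_rem x \<le> 1 / (4 * x)"
proof -
  define c where "c = lim (\<lambda>n. stirling_rem (1 + real n))"
  have dec: "decseq (\<lambda>n. stirling_rem (1 + real n))"
    unfolding decseq_Suc_iff
  proof
    fix n show "stirling_rem (1 + real (Suc n)) \<le> stirling_rem (1 + real n)"
      using stirling_rem_step(1)[of "1 + real n"] by (simp add: add_ac)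
  qed
  have "stirling_rem 1 - 1 / 4 \<le> stirling_rem (1 + real n)" for n
    using stirling_rem_mono(2)[of 1 n] by (smt (verit) divide_nonneg_nonneg of_nat_0_le_iff)
  then obtain l where "(\<lambda>n. stirling_rem (1 + real n)) \<longlonglongrightarrow> l"
    using decseq_convergent[OF dec] by blast
  hence c: "(\<lambda>n. stirling_rem (1 + real n)) \<longlonglongrightarrow> c"
    unfolding c_def by (simp add: limI)
  have lim: "(\<lambda>n. stirling_rem (y + real n)) \<longlonglongrightarrow> c" if y: "y > 0" for y
  proof -
    have "(\<lambda>n. stirling_rem (y + real (Suc n))) \<longlonglongrightarrow> c"
      using tendsto_add[OF stirling_rem_shift_tendsto[OF y] c] by (simp add: add_ac)
    thus ?thesis by (rule LIMSEQ_imp_Suc)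
  qed
  have bnd: "c \<le> stirling_rem y" "stirling_rem y \<le> c + 1 / (4 * y)" if y: "y > 0" for y
  proof -
    show "c \<le> stirling_rem y"
      using stirling_rem_mono(1)[OF y] by (intro LIMSEQ_le_const2[OF lim[OF y]]) auto
    have "(\<lambda>n. stirling_rem (y + real n) - 1 / (4 * (y + real n))) \<longlonglongrightarrow> c - 0"
      by (rule tendsto_diff[OF lim[OF y]]) real_asymp
    hence "stirling_rem y - 1 / (4 * y) \<le> c - 0"
      by (rule LIMSEQ_le_const) (use stirling_rem_mono(2)[OF y] in auto)
    thus "stirling_rem y \<le> c + 1 / (4 * y)" by simp
  qed
  have inv: "((\<lambda>y::real. 1 / (4 * y)) \<longlongrightarrow> 0) at_top" by real_asymp
  have limR: "(stirling_rem \<longlongrightarrow> c) at_top"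
  proof (rule tendsto_sandwich[of "\<lambda>_. c" _ _ "\<lambda>y. c + 1 / (4 * y)"])
    show "((\<lambda>y. c + 1 / (4 * y)) \<longlongrightarrow> c) at_top" by real_asymp
  qed (use bnd in \<open>auto intro!: eventually_mono[OF eventually_gt_at_top[of 0]]\<close>)
  \<comment> \<open>This combination tends to \<open>c + c - c\<close>, yet by Legendre's
    duplication formula it equals an elementary expression with limit 0.\<close>
  have "((\<lambda>y. stirling_rem y + stirling_rem (y + 1/2) - stirling_rem (2 * y)) \<longlongrightarrow> c + c - c) at_top"
    by (intro tendsto_intros limR filterlim_compose[OF limR]) real_asymp+
  moreover have "eventually (\<lambda>y. stirling_rem y + stirling_rem (y + 1/2) - stirling_rem (2 * y)
     = y * (ln y - ln (y + 1/2)) + 1/2) at_top"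
    using eventually_gt_at_top[of 0]
  proof eventually_elim
    case (elim y)
    have np: "complex_of_real r \<notin> \<int>\<^sub>\<le>\<^sub>0" if "r > 0" for r
      using that by (metis nonpos_Ints_nonpos not_less of_real_in_nonpos_Ints_iff)
    have "complex_of_real (Gamma y * Gamma (y + 1/2)) =
        complex_of_real (exp ((1 - 2 * y) * ln 2) * sqrt pi * Gamma (2 * y))"
      using Gamma_legendre_duplication[of "complex_of_real y"] np[of y] np[of "y + 1/2"] elim
      by (simp flip: Gamma_complex_of_real exp_of_real)
    hence "Gamma y * Gamma (y + 1/2) = exp ((1 - 2 * y) * ln 2) * sqrt pi * Gamma (2 * y)"
      by (simp only: of_real_eq_iff)
    hence "ln (Gamma y * Gamma (y + 1/2)) = ln (exp ((1 - 2 * y) * ln 2) * sqrt pi * Gamma (2 * y))" by simp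
    hence "ln (Gamma y) + ln (Gamma (y + 1/2)) = (1 - 2 * y) * ln 2 + ln pi / 2 + ln (Gamma (2 * y))"
      using elim Gamma_real_pos[of y] Gamma_real_pos[of "y + 1/2"] Gamma_real_pos[of "2 * y"]
      by (simp add: ln_mult_pos ln_sqrt del: Gamma_real_pos)
    thus ?case using elim by (simp add: stirling_rem_def ln_mult algebra_simps add_divide_distrib)
  qed
  ultimately have "((\<lambda>y. y * (ln y - ln (y + 1/2)) + 1/2) \<longlongrightarrow> c) at_top"
    using tendsto_cong by force
  moreover have "((\<lambda>y::real. y * (ln y - ln (y + 1/2)) + 1/2) \<longlongrightarrow> 0) at_top" by real_asymp
  ultimately have "c = 0" using tendsto_unique by (metis trivial_limit_at_top_linorder)
  thus "0 \<le> stirling_rem x" "stirling_rem x \<le> 1 / (4 * x)" using bnd[OF x] by auto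
qed

section \<open>Iterated Beta integrals\<close>

lemma nn_integral_lborel_shift:
  fixes f :: "real \<Rightarrow> ennreal"
  assumes "f \<in> borel_measurable borel"
  shows "(\<integral>\<^sup>+x. f (x + c) \<partial>lborel) = (\<integral>\<^sup>+x. f x \<partial>lborel)"
  using nn_integral_real_affine[OF assms, of 1 c] by (simp add: add.commute)

lemma nn_integral_lborel_uminus:
  fixes f :: "real \<Rightarrow> ennreal"
  assumes "f \<in> borel_measurable borel"
  shows "(\<integral>\<^sup>+x. f (- x) \<partial>lborel) = (\<integral>\<^sup>+x. f x \<partial>lborel)"
  using nn_integral_real_affine[OF assms, of "-1" 0] by simp

text \<open>Euler's Beta integral under the substitution s = exp z. Logarithmic coordinates are kept
  throughout because the Gaussian vector lives there.\<close>

lemma nn_integral_Beta_exp: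
  fixes b c :: real
  assumes b: "b > 0" and c: "c > 0"
  shows "(\<integral>\<^sup>+z. ennreal (exp (b * z) * (1 - exp z) powr (c - 1)) * indicator {..<0} z \<partial>lborel)
         = ennreal (Beta b c)"
proof -
  let ?f = "\<lambda>t::real. t powr (b - 1) * (1 - t) powr (c - 1)"
  have img: "exp ` {..<0::real} = {0<..<1::real}"
  proof (intro equalityI subsetI)
    fix y :: real assume "y \<in> {0<..<1}"
    thus "y \<in> exp ` {..<0}" by (intro image_eqI[of _ _ "ln y"]) auto
  qed auto
  have hi: "(?f has_integral Beta b c) {0<..<1}"
    using has_integral_Beta_real[OF b c] by (simp add: has_integral_Icc_iff_Ioo)
  hence ai: "?f absolutely_integrable_on {0<..<1}"
    by (intro nonnegative_absolutely_integrable_1) (auto simp: integrable_on_def)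
  have "(\<lambda>x. \<bar>exp x\<bar> * ?f (exp x)) absolutely_integrable_on {..<0} \<and>
      integral {..<0} (\<lambda>x. \<bar>exp x\<bar> * ?f (exp x)) = Beta b c"
    by (subst has_absolute_integral_change_of_variables_1'[of "{..<0}" exp exp ?f "Beta b c"])
       (use ai hi img in \<open>auto intro!: derivative_eq_intros inj_onI simp: integral_unique\<close>)
  hence "((\<lambda>x. \<bar>exp x\<bar> * ?f (exp x)) has_integral Beta b c) {..<0}"
    by (auto simp: set_lebesgue_integral_eq_integral(1) has_integral_integrable_integral)
  hence "((\<lambda>x. exp (b * x) * (1 - exp x) powr (c - 1)) has_integral Beta b c) {..<0}"
    by (rule has_integral_eq[rotated]) (simp add: powr_def flip: exp_add, simp add: algebra_simps)
  from nn_integral_has_integral_lebesgue'[OF _ this] show ?thesis by simp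
qed

lemma nn_integral_Beta_exp_scaled:
  fixes b c y :: real
  assumes b: "b > 0" and c: "c > 0" and y: "y > 0"
  shows "(\<integral>\<^sup>+z. ennreal (exp (b * z) * (y - exp z) powr (c - 1)) * indicator {z. exp z < y} z \<partial>lborel)
         = ennreal (y powr (b + c - 1) * Beta b c)"
proof -
  let ?g = "\<lambda>z. ennreal (exp (b * z) * (y - exp z) powr (c - 1)) * indicator {z. exp z < y} z"
  have "(\<integral>\<^sup>+z. ?g z \<partial>lborel) = (\<integral>\<^sup>+z. ?g (z + ln y) \<partial>lborel)"
    by (rule nn_integral_lborel_shift[symmetric]) measurable
  also have "\<dots> = (\<integral>\<^sup>+z. ennreal (y powr (b + c - 1)) * (ennreal (exp (b * z) * (1 - exp z) powr (c - 1)) * indicator {..<0} z) \<partial>lborel)"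
  proof (rule nn_integral_cong)
    fix z :: real
    have "y - exp (z + ln y) = y * (1 - exp z)" using y by (simp add: exp_add algebra_simps)
    moreover have "exp (b * (z + ln y)) = y powr b * exp (b * z)"
      using y by (simp add: powr_def algebra_simps exp_add)
    moreover have "exp (z + ln y) < y \<longleftrightarrow> z < 0" using y by (simp add: exp_add)
    moreover have "y powr b * y powr (c - 1) = y powr (b + c - 1)"
      by (simp flip: powr_add add: algebra_simps)
    ultimately show "?g (z + ln y) = ennreal (y powr (b + c - 1)) * (ennreal (exp (b * z) * (1 - exp z) powr (c - 1)) * indicator {..<0} z)"
      using y by (auto simp: indicator_def powr_mult simp flip: ennreal_mult)
  qed
  also have "\<dots> = ennreal (y powr (b + c - 1)) * ennreal (Beta b c)"
    by (subst nn_integral_cmult) (auto simp: nn_integral_Beta_exp[OF b c])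
  finally show ?thesis by (simp add: ennreal_mult')
qed

lemma nn_integral_Beta_exp_reflected:
  fixes a c :: real
  assumes c: "c > 0" and a: "a > c - 1"
  shows "(\<integral>\<^sup>+z. ennreal (exp (- (a * z)) * (exp z - 1) powr (c - 1)) * indicator {0<..} z \<partial>lborel)
         = ennreal (Beta (a - c + 1) c)"
proof -
  let ?g = "\<lambda>z. ennreal (exp (- (a * z)) * (exp z - 1) powr (c - 1)) * indicator {0<..} z"
  have "(\<integral>\<^sup>+z. ?g z \<partial>lborel) = (\<integral>\<^sup>+z. ?g (- z) \<partial>lborel)"
    by (rule nn_integral_lborel_uminus[symmetric]) measurable
  also have "\<dots> = (\<integral>\<^sup>+z. ennreal (exp ((a - c + 1) * z) * (1 - exp z) powr (c - 1)) * indicator {..<0} z \<partial>lborel)"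
  proof (rule nn_integral_cong)
    fix z :: real
    have "exp (a * z) * (exp (- z) - 1) powr (c - 1) = exp ((a - c + 1) * z) * (1 - exp z) powr (c - 1)" if "z < 0"
    proof -
      have "exp (- z) - 1 = exp (- z) * (1 - exp z)" by (simp add: algebra_simps flip: exp_add)
      hence "(exp (- z) - 1) powr (c - 1) = exp (- (z * (c - 1))) * (1 - exp z) powr (c - 1)"
        using that by (simp add: powr_mult) (simp add: powr_def algebra_simps)
      thus ?thesis by (simp flip: exp_add mult.assoc) (simp add: algebra_simps)
    qed
    thus "?g (- z) = ennreal (exp ((a - c + 1) * z) * (1 - exp z) powr (c - 1)) * indicator {..<0} z"
      by (auto simp: indicator_def)
  qed
  finally show ?thesis using nn_integral_Beta_exp[of "a - c + 1" c] a c by simp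
qed

interpretation lborel_product: product_sigma_finite "\<lambda>_::nat. lborel :: real measure"
  by standard

abbreviation lborel_PiM :: "nat set \<Rightarrow> (nat \<Rightarrow> real) measure" where
  "lborel_PiM I \<equiv> Pi\<^sub>M I (\<lambda>_. lborel)"

lemma component_measurable:
  "j \<in> I \<Longrightarrow> (\<lambda>z. z j) \<in> borel_measurable (lborel_PiM I)"
  using measurable_component_singleton[of j I "\<lambda>_. lborel :: real measure"] by simp

text \<open>The Dirichlet-Liouville integral over a simplex, in logarithmic coordinates. Fixing one
  coordinate at \<open>u\<close> leaves the same integral with bound \<open>y - exp u\<close>, whose
  value is a power of that bound, so the last integration is a Beta integral. The bound
  \<open>y\<close> must therefore vary in the induction.\<close>

lemma nn_integral_Liouville:
  fixes b :: "nat \<Rightarrow> real"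
  assumes "finite J" "\<And>j. j \<in> J \<Longrightarrow> b j > 0" "y > 0"
  shows "(\<integral>\<^sup>+z. ennreal (exp (\<Sum>j\<in>J. b j * z j)) * indicator {z. (\<Sum>j\<in>J. exp (z j)) < y} z \<partial>lborel_PiM J)
    = ennreal (y powr (\<Sum>j\<in>J. b j) * (\<Prod>j\<in>J. Gamma (b j)) / Gamma (1 + (\<Sum>j\<in>J. b j)))"
  using assms
proof (induction J arbitrary: y rule: finite_induct)
  case empty
  thus ?case by (simp add: PiM_empty nn_integral_count_space_finite)
next
  case (insert i J)
  define \<beta> where "\<beta> = (\<Sum>j\<in>J. b j)"
  define C where "C = (\<Prod>j\<in>J. Gamma (b j)) / Gamma (1 + \<beta>)"
  have \<beta>: "\<beta> \<ge> 0" unfolding \<beta>_def using insert.prems by (intro sum_nonneg) (auto intro: less_imp_le)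
  have bi: "b i > 0" using insert.prems by auto
  have G0: "Gamma (1 + \<beta>) \<noteq> 0"
    by (rule less_imp_neq[THEN not_sym], rule Gamma_real_pos) (use \<beta> in simp)
  have C: "C \<ge> 0" unfolding C_def using insert.prems \<beta>
    by (intro divide_nonneg_nonneg prod_nonneg) (auto intro!: less_imp_le Gamma_real_pos)
  let ?F = "\<lambda>z. ennreal (exp (\<Sum>j\<in>insert i J. b j * z j)) * indicator {z. (\<Sum>j\<in>insert i J. exp (z j)) < y} z"
  have "(\<integral>\<^sup>+z. ?F z \<partial>lborel_PiM (insert i J)) = (\<integral>\<^sup>+u. \<integral>\<^sup>+z. ?F (z(i := u)) \<partial>lborel_PiM J \<partial>lborel)"
    using insert.hyps by (intro lborel_product.product_nn_integral_insert_rev) (auto, measurable)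
  also have "\<dots> = (\<integral>\<^sup>+u. ennreal C * (ennreal (exp (b i * u) * (y - exp u) powr (\<beta> + 1 - 1)) * indicator {z. exp z < y} u) \<partial>lborel)"
  proof (rule nn_integral_cong)
    fix u :: real
    have s1: "(\<Sum>j\<in>J. b j * (z(i := u)) j) = (\<Sum>j\<in>J. b j * z j)" for z
      using insert.hyps by (intro sum.cong) auto
    have s2: "(\<Sum>j\<in>J. exp ((z(i := u)) j)) = (\<Sum>j\<in>J. exp (z j))" for z
      using insert.hyps by (intro sum.cong) auto
    have eq: "?F (z(i := u)) = ennreal (exp (b i * u)) * (ennreal (exp (\<Sum>j\<in>J. b j * z j)) * indicator {z. (\<Sum>j\<in>J. exp (z j)) < y - exp u} z)" for z
      unfolding indicator_def mem_Collect_eq sum.insert[OF insert.hyps(1,2)] s1 s2 fun_upd_same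
      by (simp add: exp_add ennreal_mult' mult.assoc indicator_def less_diff_eq add.commute)
    show "(\<integral>\<^sup>+z. ?F (z(i := u)) \<partial>lborel_PiM J) = ennreal C * (ennreal (exp (b i * u) * (y - exp u) powr (\<beta> + 1 - 1)) * indicator {z. exp z < y} u)"
    proof (cases "exp u < y")
      case True
      have "(\<integral>\<^sup>+z. ?F (z(i := u)) \<partial>lborel_PiM J) = ennreal (exp (b i * u)) *
          (\<integral>\<^sup>+z. ennreal (exp (\<Sum>j\<in>J. b j * z j)) * indicator {z. (\<Sum>j\<in>J. exp (z j)) < y - exp u} z \<partial>lborel_PiM J)"
        unfolding eq by (rule nn_integral_cmult) measurable
      also have "\<dots> = ennreal (exp (b i * u)) * ennreal ((y - exp u) powr \<beta> * C)"
        by (subst insert.IH) (use insert.prems True in \<open>simp_all add: C_def \<beta>_def\<close>)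
      finally have "(\<integral>\<^sup>+z. ?F (z(i := u)) \<partial>lborel_PiM J) = ennreal (exp (b i * u)) * ennreal ((y - exp u) powr \<beta> * C)" .
      thus ?thesis using True C by (simp add: mult_ac flip: ennreal_mult)
    next
      case False
      have "\<not> (\<Sum>j\<in>J. exp (z j)) < y - exp u" for z
        using False sum_nonneg[of J "\<lambda>j. exp (z j)"] by (auto simp: not_less intro: order_trans)
      thus ?thesis using False unfolding eq by simp
    qed
  qed
  also have "\<dots> = ennreal C * ennreal (y powr (b i + (\<beta> + 1) - 1) * Beta (b i) (\<beta> + 1))"
    using nn_integral_Beta_exp_scaled[of "b i" "\<beta> + 1" y] bi \<beta> insert.prems
    by (simp add: nn_integral_cmult)
  also have "\<dots> = ennreal (y powr (b i + \<beta>) * (C * Beta (b i) (\<beta> + 1)))"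
    using C \<beta> bi by (simp add: mult_ac Beta_def flip: ennreal_mult)
  also have "C * Beta (b i) (\<beta> + 1) = (\<Prod>j\<in>insert i J. Gamma (b j)) / Gamma (1 + (b i + \<beta>))"
    using G0 insert.hyps unfolding C_def Beta_def
    by (simp add: field_simps add_ac)
  finally show ?case using insert.hyps by (simp add: \<beta>_def)
qed

section \<open>Exponential integrals over the region where a signed sum of exponentials exceeds
  1\<close>

definition sgn_sum :: "nat \<Rightarrow> nat set \<Rightarrow> (nat \<Rightarrow> real) \<Rightarrow> real" where
  "sgn_sum p J z = exp (z p) - (\<Sum>j\<in>J. exp (z j))"

lemma sgn_sum_measurable [measurable]:
  assumes "p \<in> I" "J \<subseteq> I"
  shows "sgn_sum p J \<in> borel_measurable (lborel_PiM I)"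
proof -
  have [measurable]: "(\<lambda>z. z j) \<in> borel_measurable (lborel_PiM I)" if "j \<in> I" for j
    by (rule component_measurable[OF that])
  show ?thesis unfolding sgn_sum_def[abs_def] using assms by (intro borel_measurable_diff borel_measurable_sum) (auto, measurable)
qed

text \<open>Closed form of the total mass computed in \<open>nn_integral_gamma_quot\<close>; all
  later moments are expressed relative to it.\<close>

definition gamma_quot :: "nat \<Rightarrow> nat set \<Rightarrow> (nat \<Rightarrow> real) \<Rightarrow> real" where
  "gamma_quot p J a = Gamma (a p + (\<Sum>j\<in>J. a j)) * (\<Prod>j\<in>J. Gamma (- a j)) / Gamma (a p + 1)"

text \<open>With the positive coordinate fixed at \<open>u\<close>, the negative ones range over a
  simplex of size \<open>exp u - 1\<close>, a Liouville integral; the integral over \<open>u\<close>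
  is then a reflected Beta integral. Negative rates give integrability when the negative coordinates
  tend to minus infinity, the positive total when all coordinates grow together.\<close>

lemma nn_integral_gamma_quot:
  fixes a :: "nat \<Rightarrow> real"
  assumes J: "finite J" "p \<notin> J" and neg: "\<And>j. j \<in> J \<Longrightarrow> a j < 0" and pos: "a p + (\<Sum>j\<in>J. a j) > 0"
  shows "(\<integral>\<^sup>+z. ennreal (exp (- (\<Sum>j\<in>insert p J. a j * z j))) * indicator {z. sgn_sum p J z > 1} z \<partial>lborel_PiM (insert p J))
    = ennreal (gamma_quot p J a)"
proof -
  define \<beta> where "\<beta> = (\<Sum>j\<in>J. - a j)"
  define C where "C = (\<Prod>j\<in>J. Gamma (- a j)) / Gamma (1 + \<beta>)"
  have \<beta>: "\<beta> \<ge> 0" unfolding \<beta>_def using neg by (intro sum_nonneg) (auto intro: less_imp_le)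
  have G0: "Gamma (1 + \<beta>) \<noteq> 0"
    by (rule less_imp_neq[THEN not_sym], rule Gamma_real_pos) (use \<beta> in simp)
  have C: "C \<ge> 0" unfolding C_def using neg \<beta>
    by (intro divide_nonneg_nonneg prod_nonneg) (auto intro!: less_imp_le Gamma_real_pos)
  have ap: "a p > \<beta>" using pos by (simp add: \<beta>_def sum_negf)
  have m[measurable]: "(\<lambda>z. z j) \<in> borel_measurable (lborel_PiM I)" if "j \<in> I" for I j
    by (rule component_measurable[OF that])
  have sm[measurable]: "sgn_sum p J \<in> borel_measurable (lborel_PiM (insert p J))"
    by (rule sgn_sum_measurable) auto
  let ?F = "\<lambda>z. ennreal (exp (- (\<Sum>j\<in>insert p J. a j * z j))) * indicator {z. sgn_sum p J z > 1} z"
  have "(\<integral>\<^sup>+z. ?F z \<partial>lborel_PiM (insert p J)) = (\<integral>\<^sup>+u. \<integral>\<^sup>+z. ?F (z(p := u)) \<partial>lborel_PiM J \<partial>lborel)"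
    using J by (intro lborel_product.product_nn_integral_insert_rev) (auto, measurable)
  also have "\<dots> = (\<integral>\<^sup>+u. ennreal C * (ennreal (exp (- (a p * u)) * (exp u - 1) powr (\<beta> + 1 - 1)) * indicator {0<..} u) \<partial>lborel)"
  proof (rule nn_integral_cong)
    fix u :: real
    have s1: "(\<Sum>j\<in>J. a j * (z(p := u)) j) = (\<Sum>j\<in>J. a j * z j)" for z
      using J by (intro sum.cong) auto
    have s2: "(\<Sum>j\<in>J. exp ((z(p := u)) j)) = (\<Sum>j\<in>J. exp (z j))" for z
      using J by (intro sum.cong) auto
    have eq: "?F (z(p := u)) = ennreal (exp (- (a p * u))) * (ennreal (exp (\<Sum>j\<in>J. - a j * z j)) * indicator {z. (\<Sum>j\<in>J. exp (z j)) < exp u - 1} z)" for z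
    proof -
      have "1 < exp u - (\<Sum>j\<in>J. exp (z j)) \<longleftrightarrow> (\<Sum>j\<in>J. exp (z j)) < exp u - 1" by linarith
      moreover have e: "exp (- (a p * u + (\<Sum>j\<in>J. a j * z j))) = exp (- (a p * u)) * exp (\<Sum>j\<in>J. - a j * z j)"
        by (simp add: sum_negf flip: exp_add)
      ultimately show ?thesis
        unfolding indicator_def mem_Collect_eq sgn_sum_def sum.insert[OF J] s1 s2 fun_upd_same
        by (simp add: e ennreal_mult' mult.assoc)
    qed
    show "(\<integral>\<^sup>+z. ?F (z(p := u)) \<partial>lborel_PiM J) = ennreal C * (ennreal (exp (- (a p * u)) * (exp u - 1) powr (\<beta> + 1 - 1)) * indicator {0<..} u)"
    proof (cases "u > 0")
      case True
      have "(\<integral>\<^sup>+z. ?F (z(p := u)) \<partial>lborel_PiM J) = ennreal (exp (- (a p * u))) *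
          (\<integral>\<^sup>+z. ennreal (exp (\<Sum>j\<in>J. - a j * z j)) * indicator {z. (\<Sum>j\<in>J. exp (z j)) < exp u - 1} z \<partial>lborel_PiM J)"
        unfolding eq by (rule nn_integral_cmult) measurable
      also have "\<dots> = ennreal (exp (- (a p * u))) * ennreal ((exp u - 1) powr \<beta> * C)"
        by (subst nn_integral_Liouville) (use neg True J in \<open>simp_all add: C_def \<beta>_def\<close>)
      finally have "(\<integral>\<^sup>+z. ?F (z(p := u)) \<partial>lborel_PiM J) = ennreal (exp (- (a p * u))) * ennreal ((exp u - 1) powr \<beta> * C)" .
      thus ?thesis using True C by (simp add: mult_ac flip: ennreal_mult)
    next
      case False
      have "\<not> (\<Sum>j\<in>J. exp (z j)) < exp u - 1" for z
        using False sum_nonneg[of J "\<lambda>j. exp (z j)"] by (auto simp: not_less intro: order_trans[of _ 0])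
      thus ?thesis using False unfolding eq by simp
    qed
  qed
  also have "\<dots> = ennreal C * ennreal (Beta (a p - \<beta>) (\<beta> + 1))"
    using nn_integral_Beta_exp_reflected[of "\<beta> + 1" "a p"] ap \<beta>
    by (simp add: nn_integral_cmult)
  also have "\<dots> = ennreal (C * Beta (a p - \<beta>) (\<beta> + 1))"
    using C by (simp add: ennreal_mult')
  also have "C * Beta (a p - \<beta>) (\<beta> + 1) = gamma_quot p J a"
    using G0 unfolding C_def Beta_def gamma_quot_def
    by (simp add: field_simps \<beta>_def sum_negf)
  finally show ?thesis .
qed

lemma gamma_quot_pos:
  assumes "\<And>j. j \<in> J \<Longrightarrow> a j < 0" and "a p + (\<Sum>j\<in>J. a j) > 0"
  shows "gamma_quot p J a > 0"
proof -
  have "(\<Sum>j\<in>J. a j) \<le> 0" using assms(1) by (intro sum_nonpos) (auto intro: less_imp_le)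
  thus ?thesis unfolding gamma_quot_def using assms
    by (intro divide_pos_pos mult_pos_pos prod_pos) (auto intro!: Gamma_real_pos)
qed

lemma Gamma_plus1_real: "x > 0 \<Longrightarrow> Gamma (x + 1) = x * Gamma (x::real)"
  by (intro Gamma_plus1) (auto elim!: nonpos_Ints_cases)

text \<open>The functional equation of Gamma makes unit changes of a rate explicit. Raising the rate
  of coordinate i by 1 multiplies the weight by \<open>exp (- z i)\<close>, lowering it by
  \<open>exp (z i)\<close>, so this lemma and the next three are exponential moments relative to the
  total mass.\<close>

lemma gamma_quot_upd_pos:
  assumes J: "finite J" "p \<notin> J" and neg: "\<And>j. j \<in> J \<Longrightarrow> a j < 0"
    and pos: "s > 0" "s = a p + (\<Sum>j\<in>J. a j)"
  shows "gamma_quot p J (a(p := a p + 1)) = s / (a p + 1) * gamma_quot p J a"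
proof -
  have ap: "a p > 0" using pos sum_nonpos[of J a] neg by (force intro: less_imp_le)
  have "(\<Sum>j\<in>J. (a(p := a p + 1)) j) = (\<Sum>j\<in>J. a j)" "(\<Prod>j\<in>J. Gamma (- (a(p := a p + 1)) j)) = (\<Prod>j\<in>J. Gamma (- a j))"
    using J by (auto intro!: sum.cong prod.cong)
  moreover have "Gamma (s + 1) = s * Gamma s" "Gamma (a p + 1 + 1) = (a p + 1) * Gamma (a p + 1)"
    using Gamma_plus1_real[of s] Gamma_plus1_real[of "a p + 1"] pos ap by auto
  ultimately show ?thesis unfolding gamma_quot_def using pos(2) by (simp add: algebra_simps)
qed

lemma gamma_quot_upd_neg:
  assumes J: "finite J" "i \<in> J" "p \<notin> J" and neg: "\<And>j. j \<in> J \<Longrightarrow> a j < 0" and i: "a i < -1"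
    and pos: "s > 0" "s = a p + (\<Sum>j\<in>J. a j)"
  shows "gamma_quot p J (a(i := a i + 1)) = s / (- a i - 1) * gamma_quot p J a"
proof -
  have e1: "(\<Sum>j\<in>J. (a(i := a i + 1)) j) = (\<Sum>j\<in>J. a j) + 1"
    using J by (simp add: sum.remove[OF J(1,2)] cong: sum.cong_simp)
  have e2: "(\<Prod>j\<in>J. Gamma (- (a(i := a i + 1)) j)) = Gamma (- a i - 1) * (\<Prod>j\<in>J - {i}. Gamma (- a j))"
    using J by (simp add: prod.remove[OF J(1,2)] cong: prod.cong_simp)
  have e3: "(\<Prod>j\<in>J. Gamma (- a j)) = (- a i - 1) * Gamma (- a i - 1) * (\<Prod>j\<in>J - {i}. Gamma (- a j))"
    using Gamma_plus1_real[of "- a i - 1"] i by (simp add: prod.remove[OF J(1,2)])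
  have e4: "Gamma (s + 1) = s * Gamma s" using Gamma_plus1_real[of s] pos by auto
  have e5: "a p + ((\<Sum>j\<in>J. a j) + 1) = s + 1" "(a(i := a i + 1)) p = a p" using pos(2) J by auto
  have "gamma_quot p J (a(i := a i + 1)) =
      s * Gamma s * (Gamma (- a i - 1) * (\<Prod>j\<in>J - {i}. Gamma (- a j))) / Gamma (a p + 1)"
    by (simp only: gamma_quot_def e1 e2 e4 e5)
  moreover have "gamma_quot p J a =
      Gamma s * ((- a i - 1) * Gamma (- a i - 1) * (\<Prod>j\<in>J - {i}. Gamma (- a j))) / Gamma (a p + 1)"
    by (simp only: gamma_quot_def e3 pos(2)[symmetric])
  ultimately show ?thesis using i by simp
qed

text \<open>The raising identity at the lowered rates, solved for the lowered quotient;
  \<open>s > 1\<close> keeps the lowered total positive.\<close>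

lemma gamma_quot_upd_pos':
  assumes J: "finite J" "p \<notin> J" and neg: "\<And>j. j \<in> J \<Longrightarrow> a j < 0"
    and pos: "s > 1" "s = a p + (\<Sum>j\<in>J. a j)"
  shows "gamma_quot p J (a(p := a p - 1)) = a p / (s - 1) * gamma_quot p J a"
proof -
  have ap: "a p > 0" using pos sum_nonpos[of J a] neg by (force intro: less_imp_le)
  have "(\<Sum>j\<in>J. (a(p := a p - 1)) j) = (\<Sum>j\<in>J. a j)"
    using J by (auto intro!: sum.cong)
  hence "gamma_quot p J ((a(p := a p - 1))(p := (a(p := a p - 1)) p + 1)) =
      (s - 1) / ((a(p := a p - 1)) p + 1) * gamma_quot p J (a(p := a p - 1))"
    using pos J neg by (intro gamma_quot_upd_pos) auto
  thus ?thesis using ap pos by simp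
qed

lemma gamma_quot_upd_neg':
  assumes J: "finite J" "i \<in> J" "p \<notin> J" and neg: "\<And>j. j \<in> J \<Longrightarrow> a j < 0"
    and pos: "s > 1" "s = a p + (\<Sum>j\<in>J. a j)"
  shows "gamma_quot p J (a(i := a i - 1)) = - a i / (s - 1) * gamma_quot p J a"
proof -
  have "(\<Sum>j\<in>J. (a(i := a i - 1)) j) = (\<Sum>j\<in>J. a j) - 1"
    using J by (simp add: sum.remove[OF J(1,2)] cong: sum.cong_simp)
  hence "gamma_quot p J ((a(i := a i - 1))(i := (a(i := a i - 1)) i + 1)) =
      (s - 1) / (- (a(i := a i - 1)) i - 1) * gamma_quot p J (a(i := a i - 1))"
    using pos J neg neg[OF J(2)] by (intro gamma_quot_upd_neg) force+
  thus ?thesis using pos neg[OF J(2)] by simp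
qed

section \<open>Concentration of the weighted coordinates\<close>

text \<open>Trades a squared deviation for exponential moments, which are known explicitly. The
  subtracted 2 is essential: both moments are near 1 and only their excess over 1 is small.\<close>

lemma two_cosh_ge: "d\<^sup>2 \<le> exp d + exp (- d) - (2::real)"
proof -
  have *: "d\<^sup>2 \<le> exp d + exp (- d) - 2" if d: "d \<ge> 0" for d :: real
  proof -
    have "1 + u + u\<^sup>2 / 2 \<le> exp u" if "u \<ge> 0" for u :: real
      using exp_lower_Taylor_quadratic[OF that] .
    define h where "h = (\<lambda>d::real. exp d + exp (- d) - 2 - d\<^sup>2)"
    define h' where "h' = (\<lambda>d::real. exp d - exp (- d) - 2 * d)"
    have h'0: "h' 0 \<le> h' u" if "u \<ge> 0" for u
    proof (rule DERIV_nonneg_imp_nondecreasing[OF that])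
      fix x :: real
      have "exp x + exp (- x) - 2 \<ge> 0"
      proof -
        have "exp x * exp (- x) = 1" by (simp flip: exp_add)
        thus ?thesis using arith_geo_mean_sqrt[of "exp x" "exp (- x)"] by simp
      qed
      thus "\<exists>y. (h' has_real_derivative y) (at x) \<and> 0 \<le> y"
        unfolding h'_def by (intro exI[of _ "exp x + exp (- x) - 2"]) (auto intro!: derivative_eq_intros)
    qed
    have "h 0 \<le> h d"
    proof (rule DERIV_nonneg_imp_nondecreasing[OF d])
      fix x :: real assume x: "0 \<le> x"
      show "\<exists>y. (h has_real_derivative y) (at x) \<and> 0 \<le> y"
        unfolding h_def using h'0[OF x]
        by (intro exI[of _ "h' x"]) (auto intro!: derivative_eq_intros simp: h'_def)
    qed
    thus ?thesis by (simp add: h_def)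
  qed
  show ?thesis
    using *[of d] *[of "- d"] by (cases "d \<ge> 0") auto
qed

text \<open>The factor \<open>exp (e * z i)\<close> only lowers the rate of coordinate i by e, so
  exponential moments stay in the same family of integrals.\<close>

lemma nn_integral_gamma_quot_tilt:
  fixes a :: "nat \<Rightarrow> real"
  assumes J: "finite J" "p \<notin> J" and i: "i \<in> insert p J"
    and neg: "\<And>j. j \<in> J \<Longrightarrow> a j < 0" and neg': "i \<in> J \<Longrightarrow> a i < e"
    and pos: "a p + (\<Sum>j\<in>J. a j) - e > 0"
  shows "(\<integral>\<^sup>+z. ennreal (exp (- (\<Sum>j\<in>insert p J. a j * z j)) * exp (e * z i)) * indicator {z. sgn_sum p J z > 1} z \<partial>lborel_PiM (insert p J))
    = ennreal (gamma_quot p J (a(i := a i - e)))"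
proof -
  let ?a = "a(i := a i - e)"
  have "finite (insert p J)" using J by simp
  from sum.remove[OF this i] have eq: "(\<Sum>j\<in>insert p J. f j) = f i + (\<Sum>j\<in>insert p J - {i}. f j)" for f :: "nat \<Rightarrow> real" .
  have "(\<Sum>j\<in>insert p J. ?a j * z j) = (\<Sum>j\<in>insert p J. a j * z j) - e * z i" for z
    unfolding eq by (simp add: algebra_simps cong: sum.cong_simp)
  hence e: "exp (- (\<Sum>j\<in>insert p J. a j * z j)) * exp (e * z i) = exp (- (\<Sum>j\<in>insert p J. ?a j * z j))" for z
    by (simp flip: exp_add)
  have "?a p + (\<Sum>j\<in>J. ?a j) = (\<Sum>j\<in>insert p J. ?a j)" using J by simp
  also have "\<dots> = (\<Sum>j\<in>insert p J. a j) - e" unfolding eq by (simp cong: sum.cong_simp)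
  finally have "?a p + (\<Sum>j\<in>J. ?a j) > 0" using pos J by simp
  thus ?thesis unfolding e using assms by (intro nn_integral_gamma_quot) auto
qed

text \<open>Centred at \<open>ln (\<bar>A i\<bar> / S)\<close>, the moments of exp of the deviation
  and of its negative are each at most 1 plus a term of order 1 / t, relative to the mass. Inserted
  into \<open>two_cosh_ge\<close>, they leave a relative second moment of order 1 / t.\<close>

lemma nn_integral_square_dev:
  fixes A :: "nat \<Rightarrow> real"
  assumes J: "finite J" "p \<notin> J" and i: "i \<in> insert p J"
    and neg: "\<And>j. j \<in> J \<Longrightarrow> A j < 0" and S: "S > 0" "S = A p + (\<Sum>j\<in>J. A j)"
    and t: "t * S \<ge> 2" "t * \<bar>A i\<bar> \<ge> 2" "t > 0"
  shows "(\<integral>\<^sup>+z. ennreal (exp (- (\<Sum>j\<in>insert p J. t * A j * z j)) * (z i - ln (\<bar>A i\<bar> / S))\<^sup>2) * indicator {z. sgn_sum p J z > 1} z \<partial>lborel_PiM (insert p J))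
    \<le> ennreal ((2 / S + 2 / \<bar>A i\<bar>) / t * gamma_quot p J (\<lambda>j. t * A j))"
proof -
  let ?M = "lborel_PiM (insert p J)"
  define a where "a = (\<lambda>j. t * A j)"
  define N where "N = gamma_quot p J a"
  define zs where "zs = ln (\<bar>A i\<bar> / S)"
  have m[measurable]: "(\<lambda>z. z j) \<in> borel_measurable (lborel_PiM I)" if "j \<in> I" for I j
    by (rule component_measurable[OF that])
  have [measurable]: "sgn_sum p J \<in> borel_measurable ?M"
    by (rule sgn_sum_measurable) auto
  have [measurable]: "(\<lambda>z. z i) \<in> borel_measurable ?M" using m i by blast
  have a: "\<And>j. j \<in> J \<Longrightarrow> a j < 0" "a p + (\<Sum>j\<in>J. a j) = t * S"
    using neg t S by (auto simp: a_def mult_pos_neg algebra_simps sum_distrib_left)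
  have N: "N > 0" unfolding N_def using a t by (intro gamma_quot_pos) auto
  have Ai: "\<bar>A i\<bar> > 0" using t by (metis abs_ge_zero le_numeral_extra(3) mult_zero_right not_numeral_le_zero order_le_less)
  have Ap: "A p > 0" using S neg sum_nonpos[of J A] by (force intro: less_imp_le)
  have ezs: "exp zs = \<bar>A i\<bar> / S" "exp (- zs) = S / \<bar>A i\<bar>" using Ai S by (simp_all add: zs_def exp_minus)
  define w where "w = (\<lambda>z::nat\<Rightarrow>real. exp (- (\<Sum>j\<in>insert p J. a j * z j)))"
  define D where "D = {z. sgn_sum p J z > (1::real)}"
  have sgnD: "(\<lambda>z. indicator D z :: ennreal) \<in> borel_measurable ?M"
    unfolding D_def by measurable
  have wm[measurable]: "w \<in> borel_measurable ?M" unfolding w_def by measurable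
  note [measurable] = sgnD
  have I0: "(\<integral>\<^sup>+z. ennreal (w z) * indicator D z \<partial>?M) = ennreal N"
    unfolding w_def D_def N_def using a t S J by (intro nn_integral_gamma_quot) auto
  have I1: "(\<integral>\<^sup>+z. ennreal (w z * exp (1 * z i)) * indicator D z \<partial>?M) = ennreal (\<bar>a i\<bar> / (t * S - 1) * N)"
  proof -
    have "i \<in> J \<Longrightarrow> a i < 1" using a(1)[of i] by simp
    hence "(\<integral>\<^sup>+z. ennreal (w z * exp (1 * z i)) * indicator D z \<partial>?M) = ennreal (gamma_quot p J (a(i := a i - 1)))"
      unfolding w_def D_def using a t i J by (intro nn_integral_gamma_quot_tilt) auto
    also have "gamma_quot p J (a(i := a i - 1)) = \<bar>a i\<bar> / (t * S - 1) * N"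
    proof (cases "i = p")
      case True
      thus ?thesis using gamma_quot_upd_pos'[of J p a "t * S"] J a t Ap by (simp add: N_def a_def)
    next
      case False
      hence "i \<in> J" using i by simp
      moreover from this have "\<bar>a i\<bar> = - a i" using a(1) by fastforce
      ultimately show ?thesis
        using gamma_quot_upd_neg'[OF J(1) \<open>i \<in> J\<close> J(2) a(1) _ a(2)[symmetric]] t by (simp add: N_def)
    qed
    finally show ?thesis .
  qed
  \<comment> \<open>Only an upper bound, so that one formula serves every i: the exact denominator
    is \<open>t * A p + 1\<close> at the positive coordinate and
    \<open>t * \<bar>A i\<bar> - 1\<close> at a negative one.\<close>
  have I2: "(\<integral>\<^sup>+z. ennreal (w z * exp (-1 * z i)) * indicator D z \<partial>?M) \<le> ennreal (t * S / (t * \<bar>A i\<bar> - 1) * N)"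
  proof -
    have "i \<in> J \<Longrightarrow> a i < -1" using t neg[of i] by (simp add: a_def)
    hence "(\<integral>\<^sup>+z. ennreal (w z * exp (-1 * z i)) * indicator D z \<partial>?M) = ennreal (gamma_quot p J (a(i := a i - (-1))))"
      unfolding w_def D_def using a t i J by (intro nn_integral_gamma_quot_tilt) auto
    also have "gamma_quot p J (a(i := a i - (-1))) \<le> t * S / (t * \<bar>A i\<bar> - 1) * N"
    proof (cases "i = p")
      case True
      have "gamma_quot p J (a(i := a i - (-1))) = t * S / (t * A p + 1) * N"
        using gamma_quot_upd_pos[of J p a "t * S"] J a t S True by (simp add: N_def a_def)
      also have "\<dots> \<le> t * S / (t * \<bar>A i\<bar> - 1) * N"
        using True t Ap S N by (intro mult_right_mono divide_left_mono) auto
      finally show ?thesis .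
    next
      case False
      hence "i \<in> J" using i by simp
      thus ?thesis using gamma_quot_upd_neg[of J i p a "t * S"] J a t S neg[of i] by (simp add: N_def a_def)
    qed
    finally show ?thesis by (simp add: ennreal_leI)
  qed
  let ?sq = "\<lambda>z. w z * (z i - zs)\<^sup>2"
  \<comment> \<open>The 2 of \<open>two_cosh_ge\<close> is moved to the left as
    \<open>2 * ennreal N\<close>, since subtraction in \<open>ennreal\<close> truncates; it is
    cancelled at the end, where everything is finite.\<close>
  have "(\<integral>\<^sup>+z. ennreal (?sq z) * indicator D z \<partial>?M) + 2 * ennreal N
     = (\<integral>\<^sup>+z. ennreal (?sq z) * indicator D z + 2 * (ennreal (w z) * indicator D z) \<partial>?M)"
    unfolding I0[symmetric] by (subst nn_integral_add, measurable, subst nn_integral_cmult, measurable)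
  also have "\<dots> \<le> (\<integral>\<^sup>+z. ennreal (exp (- zs)) * (ennreal (w z * exp (1 * z i)) * indicator D z)
      + ennreal (exp zs) * (ennreal (w z * exp (-1 * z i)) * indicator D z) \<partial>?M)"
  proof (rule nn_integral_mono)
    fix z
    have "?sq z + 2 * w z \<le> exp (- zs) * (w z * exp (1 * z i)) + exp zs * (w z * exp (-1 * z i))"
      using mult_left_mono[OF two_cosh_ge[of "z i - zs"], of "w z"]
      by (simp add: w_def algebra_simps exp_diff exp_minus divide_inverse)
    hence "ennreal (?sq z + 2 * w z) \<le> ennreal (exp (- zs) * (w z * exp (1 * z i)) + exp zs * (w z * exp (-1 * z i)))"
      by (rule ennreal_leI)
    moreover have "w z \<ge> 0" by (simp add: w_def)
    ultimately show "ennreal (?sq z) * indicator D z + 2 * (ennreal (w z) * indicator D z) \<le>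
      ennreal (exp (- zs)) * (ennreal (w z * exp (1 * z i)) * indicator D z)
      + ennreal (exp zs) * (ennreal (w z * exp (-1 * z i)) * indicator D z)"
      by (auto simp: indicator_def ennreal_mult' ennreal_plus)
  qed
  also have "\<dots> = ennreal (exp (- zs)) * (\<integral>\<^sup>+z. ennreal (w z * exp (1 * z i)) * indicator D z \<partial>?M)
     + ennreal (exp zs) * (\<integral>\<^sup>+z. ennreal (w z * exp (-1 * z i)) * indicator D z \<partial>?M)"
    by (subst nn_integral_add, measurable, subst nn_integral_cmult, measurable, subst nn_integral_cmult, measurable)
  also have "\<dots> \<le> ennreal (exp (- zs)) * ennreal (\<bar>a i\<bar> / (t * S - 1) * N) + ennreal (exp zs) * ennreal (t * S / (t * \<bar>A i\<bar> - 1) * N)"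
    unfolding I1 using I2 by (intro add_mono mult_mono) auto
  also have "\<dots> = ennreal (exp (- zs) * (\<bar>a i\<bar> / (t * S - 1) * N) + exp zs * (t * S / (t * \<bar>A i\<bar> - 1) * N))"
  proof -
    have "\<bar>a i\<bar> / (t * S - 1) * N \<ge> 0" "t * S / (t * \<bar>A i\<bar> - 1) * N \<ge> 0"
      using N t S(1) by (auto intro!: mult_nonneg_nonneg divide_nonneg_nonneg)
    thus ?thesis by (subst ennreal_plus) (auto simp only: ennreal_mult'[OF exp_ge_zero] intro: mult_nonneg_nonneg[OF exp_ge_zero])
  qed
  also have "exp (- zs) * (\<bar>a i\<bar> / (t * S - 1) * N) + exp zs * (t * S / (t * \<bar>A i\<bar> - 1) * N)
     = (2 + 1 / (t * S - 1) + 1 / (t * \<bar>A i\<bar> - 1)) * N"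
  proof -
    have "S / \<bar>A i\<bar> * (\<bar>a i\<bar> / (t * S - 1)) = 1 + 1 / (t * S - 1)"
    proof -
      have "S / \<bar>A i\<bar> * (\<bar>a i\<bar> / (t * S - 1)) = t * S / (t * S - 1)"
        using Ai t by (simp add: a_def abs_mult)
      thus ?thesis using t by (simp add: diff_divide_distrib[symmetric] add_divide_eq_iff)
    qed
    moreover have "\<bar>A i\<bar> / S * (t * S / (t * \<bar>A i\<bar> - 1)) = 1 + 1 / (t * \<bar>A i\<bar> - 1)"
    proof -
      have "\<bar>A i\<bar> / S * (t * S / (t * \<bar>A i\<bar> - 1)) = t * \<bar>A i\<bar> / (t * \<bar>A i\<bar> - 1)"
        using S(1) t by simp
      thus ?thesis using t by (simp add: add_divide_eq_iff)
    qed
    ultimately have "exp (- zs) * (\<bar>a i\<bar> / (t * S - 1) * N) + exp zs * (t * S / (t * \<bar>A i\<bar> - 1) * N)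
      = (1 + 1 / (t * S - 1)) * N + (1 + 1 / (t * \<bar>A i\<bar> - 1)) * N"
      unfolding ezs by (simp only: mult.assoc[symmetric])
    thus ?thesis by (simp only: distrib_right)
  qed
  also have "\<dots> \<le> (2 + (2 / S + 2 / \<bar>A i\<bar>) / t) * N"
  proof (rule mult_right_mono)
    \<comment> \<open>From \<open>t * x \<ge> 2\<close> one has t x - 1 \<ge> t x / 2; this is the
      factor 2 in the stated bound.\<close>
    have *: "1 / (t * x - 1) \<le> 2 / x / t" if "t * x \<ge> 2" "x > 0" for x
      using that t by (simp add: field_simps)
    show "2 + 1 / (t * S - 1) + 1 / (t * \<bar>A i\<bar> - 1) \<le> 2 + (2 / S + 2 / \<bar>A i\<bar>) / t"
      using *[OF t(1) S(1)] *[OF t(2) Ai] unfolding add_divide_distrib by linarith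
  qed (use N in simp)
  finally have fin: "(\<integral>\<^sup>+z. ennreal (?sq z) * indicator D z \<partial>?M) + 2 * ennreal N \<le> ennreal ((2 + (2 / S + 2 / \<bar>A i\<bar>) / t) * N)"
    by (simp add: ennreal_leI)
  have "ennreal ((2 + (2 / S + 2 / \<bar>A i\<bar>) / t) * N) = ennreal ((2 / S + 2 / \<bar>A i\<bar>) / t * N) + 2 * ennreal N"
  proof -
    have "(2 / S + 2 / \<bar>A i\<bar>) / t * N \<ge> 0" using N t(3) S(1) Ai by simp
    moreover have "2 * ennreal N = ennreal (2 * N)" using N by (simp add: ennreal_mult)
    ultimately show ?thesis using N by (simp add: algebra_simps flip: ennreal_plus)
  qed
  with fin have "(\<integral>\<^sup>+z. ennreal (?sq z) * indicator D z \<partial>?M) \<le> ennreal ((2 / S + 2 / \<bar>A i\<bar>) / t * N)"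
    by (simp add: add.commute[of _ "2 * ennreal N"] ennreal_add_left_cancel_le ennreal_mult_eq_top_iff)
  thus ?thesis unfolding w_def D_def N_def a_def zs_def .
qed

section \<open>Stirling asymptotics of the Gamma quotient\<close>

lemma Gamma_eq_exp_stirling_rem:
  "x > 0 \<Longrightarrow> Gamma x = exp (stirling_rem x + (x - 1/2) * ln x - x + ln (2 * pi) / 2)"
  by (simp add: stirling_rem_def Gamma_real_pos)

text \<open>Stirling's formula for each Gamma factor, with \<open>\<rho>\<close> collecting the
  remainders. The terms of order t ln t and the plain linear ones cancel because the rates sum to S.
  Each negative index contributes a half power of t; the half powers of the Gammas at
  \<open>t * S\<close> and \<open>t * A p\<close> cancel, and the argument shift by 1 in the
  denominator costs one more factor t.\<close>

lemma gamma_quot_stirling: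
  fixes A :: "nat \<Rightarrow> real"
  assumes J: "finite J" "p \<notin> J" and neg: "\<And>j. j \<in> J \<Longrightarrow> A j < 0" and S: "S > 0" "S = A p + (\<Sum>j\<in>J. A j)"
    and t: "t > 0"
  defines "K \<equiv> 1 / (4 * S) + (\<Sum>i\<in>insert p J. 1 / (4 * \<bar>A i\<bar>))"
  obtains \<rho> where "\<bar>\<rho>\<bar> \<le> K / t"
    "gamma_quot p J (\<lambda>j. t * A j) = (2 * pi) powr (card J / 2) * t powr (- (real (card J) + 2) / 2)
       / sqrt (S * (\<Prod>i\<in>insert p J. \<bar>A i\<bar>)) * exp (- t * (\<Sum>i\<in>insert p J. A i * ln (\<bar>A i\<bar> / S))) * exp \<rho>"
proof
  let ?\<kappa> = "ln (2 * pi) / 2"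
  have Ap: "A p > 0" using S neg sum_nonpos[of J A] by (force intro: less_imp_le)
  define \<rho> where "\<rho> = stirling_rem (t * S) + (\<Sum>j\<in>J. stirling_rem (t * - A j)) - stirling_rem (t * A p)"
  define \<sigma> where "\<sigma> = (\<Sum>j\<in>J. A j)"
  define L0 where "L0 = (\<Sum>j\<in>J. ln \<bar>A j\<bar>)"
  define L1 where "L1 = (\<Sum>j\<in>J. A j * ln \<bar>A j\<bar>)"
  have r: "0 \<le> stirling_rem (t * x)" "stirling_rem (t * x) \<le> 1 / (4 * x) / t" if "x > 0" for x
    using stirling_rem_bounds[of "t * x"] that t by (simp_all add: mult_ac)
  have "0 \<le> (\<Sum>j\<in>J. stirling_rem (t * - A j))" using neg by (intro sum_nonneg r(1)) auto
  moreover have "(\<Sum>j\<in>J. stirling_rem (t * - A j)) \<le> (\<Sum>j\<in>J. 1 / (4 * \<bar>A j\<bar>)) / t"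
    unfolding sum_divide_distrib
  proof (rule sum_mono)
    fix j assume "j \<in> J"
    with neg have "A j < 0" by auto
    thus "stirling_rem (t * - A j) \<le> 1 / (4 * \<bar>A j\<bar>) / t" using r(2)[of "- A j"] by simp
  qed
  moreover have "(\<Sum>j\<in>J. 1 / (4 * \<bar>A j\<bar>)) \<ge> 0" by (intro sum_nonneg) auto
  moreover have "K / t = 1 / (4 * S) / t + 1 / (4 * A p) / t + (\<Sum>j\<in>J. 1 / (4 * \<bar>A j\<bar>)) / t"
    unfolding K_def using J Ap by (simp add: add_divide_distrib)
  moreover have "1 / (4 * S) / t \<ge> 0" "1 / (4 * A p) / t \<ge> 0" using S Ap t by auto
  ultimately show "\<bar>\<rho>\<bar> \<le> K / t"
    unfolding \<rho>_def using r[OF Ap] r[OF S(1)] by linarith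
  have G: "Gamma (t * x) = exp (stirling_rem (t * x) + (t * x - 1/2) * (ln t + ln x) - t * x + ?\<kappa>)" if "x > 0" for x
    using Gamma_eq_exp_stirling_rem[of "t * x"] that t by (simp add: ln_mult_pos)
  have GJ: "(\<Prod>j\<in>J. Gamma (t * - A j)) = exp ((\<Sum>j\<in>J. stirling_rem (t * - A j)) - t * ln t * \<sigma>
      - card J * ln t / 2 - t * L1 - L0 / 2 + t * \<sigma> + card J * ?\<kappa>)"
  proof -
    have "(\<Prod>j\<in>J. Gamma (t * - A j)) = (\<Prod>j\<in>J. exp (stirling_rem (t * - A j) - t * ln t * A j - ln t / 2
        - t * (A j * ln \<bar>A j\<bar>) - ln \<bar>A j\<bar> / 2 + t * A j + ?\<kappa>))"
    proof (rule prod.cong[OF refl])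
      fix j assume "j \<in> J"
      with neg have "A j < 0" by auto
      thus "Gamma (t * - A j) = exp (stirling_rem (t * - A j) - t * ln t * A j - ln t / 2
        - t * (A j * ln \<bar>A j\<bar>) - ln \<bar>A j\<bar> / 2 + t * A j + ?\<kappa>)"
        using G[of "- A j"] by (simp add: algebra_simps)
    qed
    also have "\<dots> = exp (\<Sum>j\<in>J. stirling_rem (t * - A j) - t * ln t * A j - ln t / 2
        - t * (A j * ln \<bar>A j\<bar>) - ln \<bar>A j\<bar> / 2 + t * A j + ?\<kappa>)"
      using J by (simp add: exp_sum)
    finally show ?thesis
      by (simp add: sum.distrib sum_subtractf \<sigma>_def L0_def L1_def sum_distrib_left sum_divide_distrib)
  qed
  have tS: "t * A p + (\<Sum>j\<in>J. t * A j) = t * S" by (simp add: S algebra_simps sum_distrib_left)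
  have tp: "Gamma (t * A p + 1) = exp (ln t + ln (A p)) * Gamma (t * A p)"
    using Gamma_plus1_real[of "t * A p"] t Ap by (simp add: exp_add)
  have lhs: "gamma_quot p J (\<lambda>j. t * A j) =
     exp (stirling_rem (t * S) + (t * S - 1/2) * (ln t + ln S) - t * S + ?\<kappa>
      + ((\<Sum>j\<in>J. stirling_rem (t * - A j)) - t * ln t * \<sigma>
      - card J * ln t / 2 - t * L1 - L0 / 2 + t * \<sigma> + card J * ?\<kappa>)
      - (ln t + ln (A p) + (stirling_rem (t * A p) + (t * A p - 1/2) * (ln t + ln (A p)) - t * A p + ?\<kappa>)))"
    unfolding gamma_quot_def tS tp using G[OF S(1)] G[OF Ap] GJ
    by (simp only: exp_add exp_diff minus_mult_right)
  have "(\<Sum>i\<in>insert p J. A i * ln (\<bar>A i\<bar> / S)) = A p * (ln (A p) - ln S) + (\<Sum>j\<in>J. A j * (ln \<bar>A j\<bar> - ln S))"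
    using J Ap S neg by (auto simp: ln_div intro!: sum.cong)
  also have "\<dots> = A p * ln (A p) + L1 - (A p + \<sigma>) * ln S"
    by (simp add: L1_def \<sigma>_def algebra_simps sum_subtractf sum_distrib_left)
  also have "A p + \<sigma> = S" by (simp add: S \<sigma>_def)
  finally have e1: "(\<Sum>i\<in>insert p J. A i * ln (\<bar>A i\<bar> / S)) = A p * ln (A p) + L1 - S * ln S" .
  have pr: "(\<Prod>i\<in>insert p J. \<bar>A i\<bar>) = exp (ln (A p) + L0)"
  proof -
    have "(\<Prod>j\<in>J. \<bar>A j\<bar>) = (\<Prod>j\<in>J. exp (ln \<bar>A j\<bar>))" 
    proof (rule prod.cong[OF refl])
      fix j assume "j \<in> J"
      with neg have "A j < 0" by auto
      thus "\<bar>A j\<bar> = exp (ln \<bar>A j\<bar>)" by simp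
    qed
    thus ?thesis using J Ap by (simp add: exp_add L0_def exp_sum)
  qed
  have sq: "sqrt (S * (\<Prod>i\<in>insert p J. \<bar>A i\<bar>)) = exp ((ln S + ln (A p) + L0) / 2)"
  proof -
    have "S * (\<Prod>i\<in>insert p J. \<bar>A i\<bar>) = (exp ((ln S + ln (A p) + L0) / 2))\<^sup>2"
    proof -
      have "(exp (x / 2))\<^sup>2 = exp x" for x :: real by (simp add: power2_eq_square flip: exp_add)
      thus ?thesis unfolding pr using S(1) by (simp add: exp_add)
    qed
    thus ?thesis by (simp only: real_sqrt_abs abs_exp_cancel)
  qed
  have rhs: "(2 * pi) powr (card J / 2) * t powr (- (real (card J) + 2) / 2)
       / sqrt (S * (\<Prod>i\<in>insert p J. \<bar>A i\<bar>)) * exp (- t * (\<Sum>i\<in>insert p J. A i * ln (\<bar>A i\<bar> / S))) * exp \<rho>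
     = exp (card J * ?\<kappa> + (- (real (card J) + 2) / 2) * ln t - (ln S + ln (A p) + L0) / 2
       - t * (A p * ln (A p) + L1 - S * ln S) + \<rho>)"
  proof -
    have "(2 * pi) powr (card J / 2) = exp (card J * ?\<kappa>)" "t powr (- (real (card J) + 2) / 2) = exp ((- (real (card J) + 2) / 2) * ln t)"
      using t by (simp_all add: powr_def)
    thus ?thesis unfolding sq e1 by (simp only: exp_add[symmetric] exp_diff[symmetric]) simp
  qed
  have Seq: "A p = S - \<sigma>" by (simp add: S \<sigma>_def)
  show "gamma_quot p J (\<lambda>j. t * A j) = (2 * pi) powr (card J / 2) * t powr (- (real (card J) + 2) / 2)
       / sqrt (S * (\<Prod>i\<in>insert p J. \<bar>A i\<bar>)) * exp (- t * (\<Sum>i\<in>insert p J. A i * ln (\<bar>A i\<bar> / S))) * exp \<rho>"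
  proof -
    \<comment> \<open>With logarithms and remainders replaced by variables, the comparison of
      exponents is a polynomial identity modulo \<open>A p = S - \<sigma>\<close>.\<close>
    have "r + (t * S - 1/2) * (u + v) - t * S + k + (r' - t * u * \<sigma> - c * u / 2 - t * L1 - L0 / 2 + t * \<sigma> + c * k)
        - (u + l + (r'' + (t * A p - 1/2) * (u + l) - t * A p + k))
      = c * k + (- (c + 2) / 2) * u - (v + l + L0) / 2 - t * (A p * l + L1 - S * v) + (r + r' - r'')"
      for r r' r'' u v l k c :: real
      unfolding Seq by (simp add: field_simps)
    thus ?thesis unfolding lhs rhs unfolding \<rho>_def exp_inj_iff .
  qed
qed

text \<open>The quadratic part of the variation of \<open>E\<close> costs only order 1 / t by
  \<open>nn_integral_square_dev\<close>. The linear part is controlled through the same second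
  moments and costs t powr (-1/2).\<close>

lemma gamma_quot_concentration:
  fixes A :: "nat \<Rightarrow> real" and E :: "(nat \<Rightarrow> real) \<Rightarrow> real"
  assumes J: "finite J" "p \<notin> J" and neg: "\<And>j. j \<in> J \<Longrightarrow> A j < 0" and S: "S > 0" "S = A p + (\<Sum>j\<in>J. A j)"
    and Em: "E \<in> borel_measurable (lborel_PiM (insert p J))"
    and E: "\<And>z. \<bar>E z - E0\<bar> \<le> K * (\<Sum>i\<in>insert p J. \<bar>z i - ln (\<bar>A i\<bar> / S)\<bar> + (z i - ln (\<bar>A i\<bar> / S))\<^sup>2)"
    and K: "K \<ge> 0"
  obtains C where "C \<ge> 0" "eventually (\<lambda>t.
      integrable (lborel_PiM (insert p J)) (\<lambda>z. E z * exp (- (\<Sum>j\<in>insert p J. t * A j * z j)) * indicator {z. sgn_sum p J z > 1} z) \<and>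
      \<bar>(\<integral>z. E z * exp (- (\<Sum>j\<in>insert p J. t * A j * z j)) * indicator {z. sgn_sum p J z > 1} z \<partial>lborel_PiM (insert p J))
        - E0 * gamma_quot p J (\<lambda>j. t * A j)\<bar> \<le> C * t powr (-1/2) * gamma_quot p J (\<lambda>j. t * A j)) at_top"
proof
  let ?I = "insert p J" and ?M = "lborel_PiM (insert p J)"
  define c where "c = (\<lambda>i. 2 / S + 2 / \<bar>A i\<bar>)"
  define C where "C = K * (2 * (\<Sum>i\<in>?I. c i) + card ?I)"
  have Ap: "A p > 0" using S neg sum_nonpos[of J A] by (force intro: less_imp_le)
  have Ai: "\<bar>A i\<bar> > 0" if "i \<in> ?I" for i using that Ap neg by fastforce
  have cpos: "c i \<ge> 0" if "i \<in> ?I" for i using Ai[OF that] S by (simp add: c_def)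
  show "C \<ge> 0" unfolding C_def using K cpos by (intro mult_nonneg_nonneg add_nonneg_nonneg sum_nonneg) auto
  have ev: "eventually (\<lambda>t. \<forall>i\<in>?I. t * \<bar>A i\<bar> \<ge> 2) at_top"
  proof (rule eventually_ball_finite)
    show "\<forall>i\<in>?I. eventually (\<lambda>t. t * \<bar>A i\<bar> \<ge> 2) at_top"
    proof
      fix i assume "i \<in> ?I"
      with Ai show "eventually (\<lambda>t. t * \<bar>A i\<bar> \<ge> 2) at_top"
        by (intro eventually_mono[OF eventually_ge_at_top[of "2 / \<bar>A i\<bar>"]]) (simp add: field_simps)
    qed
  qed (use J in auto)
  show "eventually (\<lambda>t.
      integrable ?M (\<lambda>z. E z * exp (- (\<Sum>j\<in>?I. t * A j * z j)) * indicator {z. sgn_sum p J z > 1} z) \<and>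
      \<bar>(\<integral>z. E z * exp (- (\<Sum>j\<in>?I. t * A j * z j)) * indicator {z. sgn_sum p J z > 1} z \<partial>?M)
        - E0 * gamma_quot p J (\<lambda>j. t * A j)\<bar> \<le> C * t powr (-1/2) * gamma_quot p J (\<lambda>j. t * A j)) at_top"
    using ev eventually_ge_at_top[of "2 / S"] eventually_ge_at_top[of 1]
  proof eventually_elim
    case (elim t)
    hence t: "t \<ge> 1" "t * S \<ge> 2" using S by (auto simp: field_simps)
    define N where "N = gamma_quot p J (\<lambda>j. t * A j)"
    define W where "W = (\<lambda>z::nat\<Rightarrow>real. exp (- (\<Sum>j\<in>?I. t * A j * z j)) * indicator {z. sgn_sum p J z > 1} z)"
    define d where "d = (\<lambda>i (z::nat\<Rightarrow>real). z i - ln (\<bar>A i\<bar> / S))"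
    have m[measurable]: "(\<lambda>z. z j) \<in> borel_measurable (lborel_PiM I)" if "j \<in> I" for I j
      by (rule component_measurable[OF that])
    have [measurable]: "sgn_sum p J \<in> borel_measurable ?M" by (rule sgn_sum_measurable) auto
    have Wm[measurable]: "W \<in> borel_measurable ?M" unfolding W_def by measurable
    have dm: "d i \<in> borel_measurable ?M" if "i \<in> ?I" for i
      unfolding d_def using m[OF that] by measurable
    have W0: "W z \<ge> 0" for z by (simp add: W_def)
    have tA: "t * A p + (\<Sum>j\<in>J. t * A j) = t * S" by (simp add: S algebra_simps sum_distrib_left)
    have N: "N > 0" unfolding N_def using neg S t tA by (intro gamma_quot_pos) (auto simp: mult_pos_neg)
    have "(\<integral>\<^sup>+z. ennreal (W z) \<partial>?M) = ennreal N"
      using nn_integral_gamma_quot[of J p "\<lambda>j. t * A j"] J neg S t tA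
      by (simp add: W_def N_def mult_pos_neg ennreal_mult' ennreal_indicator)
    hence W: "has_bochner_integral ?M W N"
      using W0 N by (intro has_bochner_integral_nn_integral) auto
    have sq: "integrable ?M (\<lambda>z. W z * (d i z)\<^sup>2) \<and> (\<integral>z. W z * (d i z)\<^sup>2 \<partial>?M) \<le> c i / t * N" if i: "i \<in> ?I" for i
    proof -
      note [measurable] = dm[OF i]
      have "(\<integral>\<^sup>+z. ennreal (W z * (d i z)\<^sup>2) \<partial>?M) \<le> ennreal (c i / t * N)"
        using nn_integral_square_dev[of J p i A S t] J neg S t elim i
        by (simp add: W_def N_def c_def d_def ennreal_mult' ennreal_indicator mult_ac)
      moreover from this have "integrable ?M (\<lambda>z. W z * (d i z)\<^sup>2)"
        by (intro integrableI_nonneg) (use W0 in \<open>auto simp: less_top[symmetric] top_unique\<close>)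
      moreover have "c i / t * N \<ge> 0" using cpos[OF i] t N by simp
      ultimately show ?thesis by (auto intro!: integral_real_bounded)
    qed
    define R where "R = (\<lambda>z. K * (2 * sqrt t * (\<Sum>i\<in>?I. W z * (d i z)\<^sup>2) + card ?I / sqrt t * W z))"
    have bnd: "\<bar>W z * (E z - E0)\<bar> \<le> R z" for z
    proof -
      \<comment> \<open>Splitting at deviation 1 / sqrt t turns the first power into a second
        moment; with second moments of order 1 / t both terms contribute order t powr
        (-1/2).\<close>
      have "\<bar>d i z\<bar> + (d i z)\<^sup>2 \<le> 2 * sqrt t * (d i z)\<^sup>2 + 1 / sqrt t" for i
      proof -
        have s: "sqrt t \<ge> 1" using t by simp
        have "\<bar>d i z\<bar> \<le> sqrt t * (d i z)\<^sup>2 + 1 / sqrt t"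
        proof (cases "\<bar>d i z\<bar> \<le> 1 / sqrt t")
          case True
          thus ?thesis using s by (smt (verit) mult_nonneg_nonneg zero_le_power2)
        next
          case False
          hence "1 \<le> sqrt t * \<bar>d i z\<bar>" using s by (simp add: field_simps)
          hence "\<bar>d i z\<bar> * 1 \<le> \<bar>d i z\<bar> * (sqrt t * \<bar>d i z\<bar>)" by (intro mult_left_mono) auto
          also have "\<dots> = sqrt t * (d i z)\<^sup>2" by (simp add: power2_eq_square abs_mult_self_eq)
          finally show ?thesis using s by (smt (verit) divide_nonneg_nonneg)
        qed
        moreover have "(d i z)\<^sup>2 \<le> sqrt t * (d i z)\<^sup>2" using s by (simp add: mult_le_cancel_right1)
        ultimately show ?thesis by linarith
      qed
      hence "(\<Sum>i\<in>?I. \<bar>d i z\<bar> + (d i z)\<^sup>2) \<le> (\<Sum>i\<in>?I. 2 * sqrt t * (d i z)\<^sup>2 + 1 / sqrt t)" by (intro sum_mono)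
      also have "\<dots> = 2 * sqrt t * (\<Sum>i\<in>?I. (d i z)\<^sup>2) + card ?I / sqrt t"
        by (simp add: sum.distrib sum_distrib_left)
      finally have "\<bar>E z - E0\<bar> \<le> K * (2 * sqrt t * (\<Sum>i\<in>?I. (d i z)\<^sup>2) + card ?I / sqrt t)"
        using E[of z] K unfolding d_def by (meson mult_left_mono order_trans)
      hence "W z * \<bar>E z - E0\<bar> \<le> W z * (K * (2 * sqrt t * (\<Sum>i\<in>?I. (d i z)\<^sup>2) + card ?I / sqrt t))"
        using W0 by (intro mult_left_mono)
      also have "\<dots> = R z" by (simp add: R_def sum_distrib_left algebra_simps)
      finally show ?thesis using W0[of z] by (simp add: abs_mult)
    qed
    have s1: "integrable ?M (\<lambda>z. \<Sum>i\<in>?I. W z * (d i z)\<^sup>2)"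
      using sq by (intro Bochner_Integration.integrable_sum) auto
    have Rint: "integrable ?M R"
      unfolding R_def using s1 W
      by (intro integrable_mult_right Bochner_Integration.integrable_add) (auto simp: has_bochner_integral_iff)
    have s2: "(\<integral>z. (\<Sum>i\<in>?I. W z * (d i z)\<^sup>2) \<partial>?M) = (\<Sum>i\<in>?I. \<integral>z. W z * (d i z)\<^sup>2 \<partial>?M)"
      using sq by (intro Bochner_Integration.integral_sum) auto
    have "(\<integral>z. R z \<partial>?M) = K * (2 * sqrt t * (\<Sum>i\<in>?I. \<integral>z. W z * (d i z)\<^sup>2 \<partial>?M) + card ?I / sqrt t * N)"
      unfolding R_def s2[symmetric] using s1 W
      by (subst integral_mult_right_zero, subst Bochner_Integration.integral_add) (auto simp: has_bochner_integral_iff)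
    also have "\<dots> \<le> K * (2 * sqrt t * (\<Sum>i\<in>?I. c i / t * N) + card ?I / sqrt t * N)"
      using K sq t by (intro mult_left_mono add_right_mono sum_mono) auto
    also have "\<dots> = C * (1 / sqrt t) * N"
    proof -
      have "sqrt t / t = 1 / sqrt t" using t by (simp add: real_div_sqrt field_simps)
      hence "sqrt t * (\<Sum>i\<in>?I. c i / t * N) = (\<Sum>i\<in>?I. c i) * (1 / sqrt t) * N"
      proof -
        have "(\<Sum>i\<in>?I. c i / t * N) = (\<Sum>i\<in>?I. c i) / t * N"
          by (simp only: sum_divide_distrib sum_distrib_right)
        hence "sqrt t * (\<Sum>i\<in>?I. c i / t * N) = (\<Sum>i\<in>?I. c i) * (sqrt t / t) * N" by simp
        thus ?thesis unfolding \<open>sqrt t / t = 1 / sqrt t\<close> .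
      qed
      hence "2 * sqrt t * (\<Sum>i\<in>?I. c i / t * N) = 2 * ((\<Sum>i\<in>?I. c i) * (1 / sqrt t) * N)"
        by (simp only: mult.assoc)
      moreover have "K * (2 * (x * u * N) + y / sqrt t * N) = K * (2 * x + y) * u * N" if "u = 1 / sqrt t" for x y u
        unfolding that by (simp add: distrib_left distrib_right add_divide_distrib)
      ultimately show ?thesis unfolding C_def by simp
    qed
    also have "1 / sqrt t = t powr (-1/2)" 
      using powr_minus_divide[of t "1/2"] powr_half_sqrt[of t] t by simp
    finally have Rbd: "(\<integral>z. R z \<partial>?M) \<le> C * t powr (-1/2) * N" .
    have dint: "integrable ?M (\<lambda>z. W z * (E z - E0))"
      by (rule Bochner_Integration.integrable_bound[OF Rint])
         (use bnd Em in \<open>auto intro: order_trans[OF _ abs_ge_self]\<close>)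
    have eq: "E z * exp (- (\<Sum>j\<in>?I. t * A j * z j)) * indicator {z. sgn_sum p J z > 1} z = W z * (E z - E0) + E0 * W z" for z
      by (simp add: W_def algebra_simps)
    have "\<bar>\<integral>z. W z * (E z - E0) \<partial>?M\<bar> \<le> (\<integral>z. \<bar>W z * (E z - E0)\<bar> \<partial>?M)"
      by (rule integral_abs_bound)
    also have "\<dots> \<le> (\<integral>z. R z \<partial>?M)"
      by (rule integral_mono[OF integrable_abs[OF dint] Rint bnd])
    finally have "\<bar>\<integral>z. W z * (E z - E0) \<partial>?M\<bar> \<le> C * t powr (-1/2) * N" using Rbd by linarith
    moreover have WI: "integrable ?M (\<lambda>z. E0 * W z)" "(\<integral>z. E0 * W z \<partial>?M) = E0 * N"
      using W by (auto simp: has_bochner_integral_iff)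
    ultimately show ?case
      unfolding eq N_def[symmetric] Bochner_Integration.integral_add[OF dint WI(1)] WI(2)
      using Bochner_Integration.integrable_add[OF dint WI(1)] by simp
  qed
qed

section \<open>Gaussian integrals\<close>

text \<open>Translation and renumbering are treated together. With \<open>h\<close> the identity the
  lemma shifts the Gaussian variables; with \<open>h\<close> an enumeration of the active set it
  moves integrals to \<open>{..<N}\<close>, where determinants live.\<close>

lemma nn_integral_PiM_affine_reindex:
  fixes f :: "(nat \<Rightarrow> real) \<Rightarrow> ennreal" and c :: "nat \<Rightarrow> real"
  assumes I: "finite I" and h: "bij_betw h K I" and f: "f \<in> borel_measurable (lborel_PiM K)"
  shows "(\<integral>\<^sup>+z. f (\<lambda>k\<in>K. z (h k) + c k) \<partial>lborel_PiM I) = (\<integral>\<^sup>+z. f z \<partial>lborel_PiM K)"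
proof -
  have K: "finite K" using I h bij_betw_finite by blast
  have hI: "h k \<in> I" if "k \<in> K" for k using h that by (auto simp: bij_betw_def)
  define g where "g = (\<lambda>z. \<lambda>k\<in>K. z (h k) + c k :: real)"
  have gm: "g \<in> lborel_PiM I \<rightarrow>\<^sub>M lborel_PiM K"
    unfolding g_def
  proof (rule measurable_restrict)
    fix k assume "k \<in> K"
    from measurable_component_singleton[OF hI[OF this], of "\<lambda>_. lborel :: real measure"]
    have "(\<lambda>z. z (h k)) \<in> borel_measurable (lborel_PiM I)" by simp
    thus "(\<lambda>z. z (h k) + c k) \<in> lborel_PiM I \<rightarrow>\<^sub>M lborel" by simp
  qed
  have "distr (lborel_PiM I) (lborel_PiM K) g = lborel_PiM K"
  proof (rule lborel_product.PiM_eqI)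
    fix A :: "nat \<Rightarrow> real set" assume A: "\<And>i. i \<in> K \<Longrightarrow> A i \<in> sets lborel"
    define A' where "A' = (\<lambda>i. (\<lambda>x. x + c (the_inv_into K h i)) -` A (the_inv_into K h i))"
    have A'h: "A' (h k) = (\<lambda>x. x + c k) -` A k" if "k \<in> K" for k
      using that h by (simp add: A'_def the_inv_into_f_f bij_betw_def)
    have vm: "(\<lambda>x. x + c k) -` A k \<in> sets borel" if "k \<in> K" for k
      using measurable_sets[of "\<lambda>x. x + c k" borel borel "A k"] A[OF that] by simp
    have A's: "A' i \<in> sets lborel" if "i \<in> I" for i
    proof -
      from that h obtain k where "k \<in> K" "i = h k" by (auto simp: bij_betw_def)
      thus ?thesis using A'h vm by simp
    qed
    have vim: "g -` Pi\<^sub>E K A \<inter> space (lborel_PiM I) = Pi\<^sub>E I A'"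
    proof (intro equalityI subsetI)
      fix z assume z: "z \<in> g -` Pi\<^sub>E K A \<inter> space (lborel_PiM I)"
      have "z i \<in> A' i" if "i \<in> I" for i
      proof -
        from that h obtain k where k: "k \<in> K" "i = h k" by (auto simp: bij_betw_def)
        with z have "g z k \<in> A k" by auto
        thus ?thesis using k A'h by (simp add: g_def)
      qed
      thus "z \<in> Pi\<^sub>E I A'" using z by (auto simp: space_PiM PiE_def)
    next
      fix z assume z: "z \<in> Pi\<^sub>E I A'"
      have "z (h k) + c k \<in> A k" if "k \<in> K" for k
        using z hI[OF that] A'h[OF that] by (auto simp: PiE_def Pi_def)
      thus "z \<in> g -` Pi\<^sub>E K A \<inter> space (lborel_PiM I)"
        using z by (auto simp: space_PiM g_def PiE_def)
    qed
    have "Pi\<^sub>E K A \<in> sets (lborel_PiM K)" using A K by (intro sets_PiM_I_finite) auto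
    hence "emeasure (distr (lborel_PiM I) (lborel_PiM K) g) (Pi\<^sub>E K A) = emeasure (lborel_PiM I) (Pi\<^sub>E I A')"
      using gm by (simp add: emeasure_distr vim)
    also have "\<dots> = (\<Prod>i\<in>I. emeasure lborel (A' i))"
    proof -
      interpret finite_product_sigma_finite "\<lambda>_. lborel :: real measure" I by standard (rule I)
      show ?thesis using A's by (intro measure_times) auto
    qed
    also have "\<dots> = (\<Prod>k\<in>K. emeasure lborel (A' (h k)))"
      using h by (intro prod.reindex_bij_betw[symmetric])
    also have "\<dots> = (\<Prod>k\<in>K. emeasure lborel (A k))"
    proof (rule prod.cong[OF refl])
      fix k assume k: "k \<in> K"
      have "emeasure lborel (A k) = emeasure (distr lborel borel ((+) (c k))) (A k)"
        by (simp add: lborel_distr_plus)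
      also have "\<dots> = emeasure lborel ((+) (c k) -` A k)"
        using A[OF k] by (subst emeasure_distr) auto
      also have "(+) (c k) -` A k = A' (h k)" using A'h[OF k] by (auto simp: add.commute)
      finally show "emeasure lborel (A' (h k)) = emeasure lborel (A k)" ..
    qed
    finally show "emeasure (distr (lborel_PiM I) (lborel_PiM K) g) (Pi\<^sub>E K A) = (\<Prod>k\<in>K. emeasure lborel (A k))" .
  qed (use K in auto)
  hence "(\<integral>\<^sup>+z. f z \<partial>lborel_PiM K) = (\<integral>\<^sup>+z. f z \<partial>distr (lborel_PiM I) (lborel_PiM K) g)" by simp
  also have "\<dots> = (\<integral>\<^sup>+z. f (g z) \<partial>lborel_PiM I)" using gm f by (intro nn_integral_distr) auto
  finally show ?thesis by (simp add: g_def)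
qed

text \<open>Forms are indexed by a set and a coefficient function, so that passing to a principal
  submatrix means shrinking \<open>I\<close>; matrices appear only where a determinant or an inverse
  is taken.\<close>

definition qform :: "nat set \<Rightarrow> (nat \<Rightarrow> nat \<Rightarrow> real) \<Rightarrow> (nat \<Rightarrow> real) \<Rightarrow> real" where
  "qform I g y = (\<Sum>i\<in>I. \<Sum>j\<in>I. g i j * y i * y j)"

definition pos_def_on :: "nat set \<Rightarrow> (nat \<Rightarrow> nat \<Rightarrow> real) \<Rightarrow> bool" where
  "pos_def_on I g \<longleftrightarrow> (\<forall>v. (\<exists>i\<in>I. v i \<noteq> 0) \<longrightarrow> qform I g v > 0)"

lemma qform_cong: "(\<And>i. i \<in> I \<Longrightarrow> y i = y' i) \<Longrightarrow> qform I g y = qform I g y'"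
  unfolding qform_def by (intro sum.cong) auto

lemma qform_measurable:
  assumes "\<And>i. i \<in> I \<Longrightarrow> (\<lambda>x. f x i) \<in> borel_measurable M"
  shows "(\<lambda>x. qform I g (f x)) \<in> borel_measurable M"
  unfolding qform_def using assms by (intro borel_measurable_sum borel_measurable_times) auto

lemma nn_integral_gaussian_1d:
  fixes \<gamma> m :: real
  assumes "\<gamma> > 0"
  shows "(\<integral>\<^sup>+x. ennreal (exp (- (\<gamma> * (x + m)\<^sup>2) / 2)) \<partial>lborel) = ennreal (sqrt (2 * pi / \<gamma>))"
proof -
  define \<sigma> where "\<sigma> = 1 / sqrt \<gamma>"
  have \<sigma>: "\<sigma> > 0" "\<sigma>\<^sup>2 = 1 / \<gamma>" using assms by (auto simp: \<sigma>_def power_divide)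
  have "(\<integral>\<^sup>+x. ennreal (normal_density (- m) \<sigma> x) \<partial>lborel) = 1"
    using prob_space.emeasure_space_1[OF prob_space_normal_density[OF \<sigma>(1), of "- m"]]
    by (simp add: emeasure_density)
  moreover have "exp (- (\<gamma> * (x + m)\<^sup>2) / 2) = sqrt (2 * pi / \<gamma>) * normal_density (- m) \<sigma> x" for x
    using assms by (simp add: normal_density_def \<sigma>(2))
  ultimately show ?thesis
    using assms by (simp add: ennreal_mult nn_integral_cmult)
qed

text \<open>One elimination step: left multiplication by a unit triangular block matrix clears the
  column above the pivot \<open>g k k\<close>.\<close>

lemma det_schur_complement:
  fixes g :: "nat \<Rightarrow> nat \<Rightarrow> real"
  assumes "g k k \<noteq> 0"
  shows "det (mat (Suc k) (Suc k) (\<lambda>(i, j). g i j)) =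
    g k k * det (mat k k (\<lambda>(i, j). g i j - g i k * g k j / g k k))"
proof -
  define U where "U = four_block_mat (1\<^sub>m k) (mat k 1 (\<lambda>(i, _). - g i k / g k k)) (0\<^sub>m 1 k) (1\<^sub>m 1 :: real mat)"
  define G11 where "G11 = mat k k (\<lambda>(i, j). g i j)"
  define G12 where "G12 = mat k 1 (\<lambda>(i, j). g i k)"
  define G21 where "G21 = mat 1 k (\<lambda>(i, j). g k j)"
  define G22 where "G22 = mat 1 1 (\<lambda>(i :: nat, j :: nat). g k k)"
  define H where "H = mat k k (\<lambda>(i, j). g i j - g i k * g k j / g k k)"
  note defs = G11_def G12_def G21_def G22_def
  have G: "mat (Suc k) (Suc k) (\<lambda>(i, j). g i j) = four_block_mat G11 G12 G21 G22"
    by (rule eq_matI) (auto simp: defs not_less less_Suc_eq)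
  have "U * four_block_mat G11 G12 G21 G22 = four_block_mat
      (1\<^sub>m k * G11 + mat k 1 (\<lambda>(i, _). - g i k / g k k) * G21) (1\<^sub>m k * G12 + mat k 1 (\<lambda>(i, _). - g i k / g k k) * G22)
      (0\<^sub>m 1 k * G11 + 1\<^sub>m 1 * G21) (0\<^sub>m 1 k * G12 + 1\<^sub>m 1 * G22)"
    unfolding U_def by (rule mult_four_block_mat) (auto simp: defs)
  also have "\<dots> = four_block_mat H (0\<^sub>m k 1) G21 G22"
    using assms by (intro cong_four_block_mat eq_matI) (auto simp: defs H_def scalar_prod_def)
  finally have UG: "U * mat (Suc k) (Suc k) (\<lambda>(i, j). g i j) = four_block_mat H (0\<^sub>m k 1) G21 G22"
    unfolding G .
  have Uc: "U \<in> carrier_mat (Suc k) (Suc k)" unfolding U_def by auto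
  have "det U = 1"
    unfolding U_def by (subst det_four_block_mat_lower_left_zero[of _ k _ 1]) auto
  hence "det (mat (Suc k) (Suc k) (\<lambda>(i, j). g i j)) = det (U * mat (Suc k) (Suc k) (\<lambda>(i, j). g i j))"
    using det_mult[OF Uc, of "mat (Suc k) (Suc k) (\<lambda>(i, j). g i j)"] by simp
  also have "\<dots> = det H * det G22"
    unfolding UG by (rule det_four_block_mat_upper_right_zero) (auto simp: defs H_def)
  also have "det G22 = g k k"
    by (subst det_single) (auto simp: defs)
  finally show ?thesis by (simp add: H_def)
qed

lemma qform_complete_square:
  fixes g :: "nat \<Rightarrow> nat \<Rightarrow> real"
  assumes sym: "\<And>i. i < k \<Longrightarrow> g i k = g k i" and "g k k \<noteq> 0"
  shows "qform {..<Suc k} g y = qform {..<k} (\<lambda>i j. g i j - g i k * g k j / g k k) y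
     + g k k * (y k + (\<Sum>i<k. g k i * y i) / g k k)\<^sup>2"
proof -
  define l where "l = (\<Sum>i<k. g k i * y i)"
  have l1: "(\<Sum>i<k. g i k * y i * y k) = l * y k"
    using sym by (simp add: l_def sum_distrib_right)
  have l2: "(\<Sum>j<k. g k j * y k * y j) = l * y k"
    by (simp add: l_def sum_distrib_left sum_distrib_right mult_ac)
  have "(\<Sum>i<k. \<Sum>j<k. (g i k * g k j / g k k) * y i * y j) = (\<Sum>i<k. \<Sum>j<k. (g k i * y i) * (g k j * y j) / g k k)"
    using sym by (intro sum.cong) auto
  also have "\<dots> = l * l / g k k"
    by (simp add: l_def sum_product sum_divide_distrib)
  finally have l3: "(\<Sum>i<k. \<Sum>j<k. (g i k * g k j / g k k) * y i * y j) = l * l / g k k" .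
  have q1: "qform {..<k} (\<lambda>i j. g i j - g i k * g k j / g k k) y = qform {..<k} g y - l * l / g k k"
    unfolding l3[symmetric] by (simp add: qform_def left_diff_distrib sum_subtractf)
  have q2: "qform {..<Suc k} g y = qform {..<k} g y + 2 * (l * y k) + g k k * y k * y k"
    unfolding qform_def by (simp add: sum.distrib l1 l2)
  have "g k k * (y k + l / g k k)\<^sup>2 = g k k * y k * y k + 2 * (l * y k) + l * l / g k k"
    using assms(2) by (simp add: power2_eq_square field_simps)
  thus ?thesis unfolding q1 q2 l_def[symmetric] by linarith
qed

text \<open>Completing the square in the last variable splits off a one-dimensional Gaussian with
  precision \<open>g k k\<close>; what is left is the form of the Schur complement, whose
  determinant times the pivot is the original determinant. Positivity of the determinant comes
  along, each pivot being a value of a positive form.\<close>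

lemma nn_integral_gaussian_det:
  fixes g :: "nat \<Rightarrow> nat \<Rightarrow> real"
  assumes "\<And>i j. i < k \<Longrightarrow> j < k \<Longrightarrow> g i j = g j i" and "pos_def_on {..<k} g"
  shows "det (mat k k (\<lambda>(i, j). g i j)) > 0 \<and>
    (\<integral>\<^sup>+y. ennreal (exp (- qform {..<k} g y / 2)) \<partial>lborel_PiM {..<k})
      = ennreal (sqrt ((2 * pi) ^ k / det (mat k k (\<lambda>(i, j). g i j))))"
  using assms
proof (induction k arbitrary: g)
  case 0
  show ?case by (simp add: PiM_empty nn_integral_count_space_finite qform_def)
next
  case (Suc k)
  define \<gamma> where "\<gamma> = g k k"
  define h where "h = (\<lambda>i j. g i j - g i k * g k j / g k k)"
  have "qform {..<Suc k} g (\<lambda>i. if i = k then 1 else 0) > 0"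
  proof -
    have "\<exists>i\<in>{..<Suc k}. (if i = k then 1 else 0 :: real) \<noteq> 0" by (intro bexI[of _ k]) auto
    from Suc.prems(2)[unfolded pos_def_on_def, rule_format, OF this] show ?thesis .
  qed
  also have "qform {..<Suc k} g (\<lambda>i. if i = k then 1 else 0) = \<gamma>"
    by (simp add: qform_def \<gamma>_def cong: sum.cong_simp)
  finally have \<gamma>: "\<gamma> > 0" .
  have sq: "qform {..<Suc k} g y = qform {..<k} h y + \<gamma> * (y k + (\<Sum>i<k. g k i * y i) / \<gamma>)\<^sup>2" for y
    unfolding h_def \<gamma>_def using Suc.prems(1) \<gamma> by (intro qform_complete_square) (auto simp: \<gamma>_def)
  have hs: "h i j = h j i" if "i < k" "j < k" for i j
  proof -
    have e: "g i k = g k i" "g k j = g j k" "g i j = g j i"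
      by (rule Suc.prems(1); use that in simp)+
    have "g i k * g k j = g j k * g k i" unfolding e(1,2) by (rule mult.commute)
    thus ?thesis by (simp only: h_def e(3))
  qed
  have "pos_def_on {..<k} h"
    unfolding pos_def_on_def
  proof (intro allI impI)
    fix v :: "nat \<Rightarrow> real" assume v: "\<exists>i\<in>{..<k}. v i \<noteq> 0"
    \<comment> \<open>The last coordinate is chosen to make the completed square vanish, so that the
      full form at \<open>u\<close> equals the Schur complement at \<open>v\<close>.\<close>
    define u where "u = v(k := - (\<Sum>i<k. g k i * v i) / \<gamma>)"
    have "\<exists>i\<in>{..<Suc k}. u i \<noteq> 0" using v by (fastforce simp: u_def)
    hence "qform {..<Suc k} g u > 0" using Suc.prems(2) by (auto simp: pos_def_on_def)
    moreover have "(\<Sum>i<k. g k i * u i) = (\<Sum>i<k. g k i * v i)" by (simp add: u_def)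
    moreover have "qform {..<k} h u = qform {..<k} h v" by (intro qform_cong) (simp add: u_def)
    ultimately show "qform {..<k} h v > 0" unfolding sq by (simp add: u_def)
  qed
  note IH = Suc.IH[OF hs this]
  have d: "det (mat (Suc k) (Suc k) (\<lambda>(i, j). g i j)) = \<gamma> * det (mat k k (\<lambda>(i, j). h i j))"
    unfolding \<gamma>_def h_def using \<gamma> by (intro det_schur_complement) (simp add: \<gamma>_def)
  note cm = component_measurable
  have "(\<integral>\<^sup>+y. ennreal (exp (- qform {..<Suc k} g y / 2)) \<partial>lborel_PiM (insert k {..<k}))
     = (\<integral>\<^sup>+y. \<integral>\<^sup>+x. ennreal (exp (- qform {..<Suc k} g (y(k := x)) / 2)) \<partial>lborel \<partial>lborel_PiM {..<k})"
  proof (rule lborel_product.product_nn_integral_insert)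
    have "(\<lambda>y. qform {..<Suc k} g y) \<in> borel_measurable (lborel_PiM (insert k {..<k}))"
      by (intro qform_measurable cm) auto
    thus "(\<lambda>y. ennreal (exp (- qform {..<Suc k} g y / 2))) \<in> borel_measurable (lborel_PiM (insert k {..<k}))"
      by measurable
  qed auto
  also have "\<dots> = (\<integral>\<^sup>+y. ennreal (exp (- qform {..<k} h y / 2)) * ennreal (sqrt (2 * pi / \<gamma>)) \<partial>lborel_PiM {..<k})"
  proof (rule nn_integral_cong)
    fix y :: "nat \<Rightarrow> real"
    have "qform {..<Suc k} g (y(k := x)) = qform {..<k} h y + \<gamma> * (x + (\<Sum>i<k. g k i * y i) / \<gamma>)\<^sup>2" for x
    proof -
      have "qform {..<k} h (y(k := x)) = qform {..<k} h y" by (intro qform_cong) simp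
      thus ?thesis unfolding sq by simp
    qed
    hence "(\<integral>\<^sup>+x. ennreal (exp (- qform {..<Suc k} g (y(k := x)) / 2)) \<partial>lborel)
      = (\<integral>\<^sup>+x. ennreal (exp (- qform {..<k} h y / 2)) * ennreal (exp (- (\<gamma> * (x + (\<Sum>i<k. g k i * y i) / \<gamma>)\<^sup>2) / 2)) \<partial>lborel)"
      by (intro nn_integral_cong) (simp add: diff_divide_distrib flip: ennreal_mult exp_add)
    also have "\<dots> = ennreal (exp (- qform {..<k} h y / 2)) * ennreal (sqrt (2 * pi / \<gamma>))"
      by (subst nn_integral_cmult) (use nn_integral_gaussian_1d[OF \<gamma>] in auto)
    finally show "(\<integral>\<^sup>+x. ennreal (exp (- qform {..<Suc k} g (y(k := x)) / 2)) \<partial>lborel)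
      = ennreal (exp (- qform {..<k} h y / 2)) * ennreal (sqrt (2 * pi / \<gamma>))" .
  qed
  also have "\<dots> = ennreal (sqrt ((2 * pi) ^ k / det (mat k k (\<lambda>(i, j). h i j)))) * ennreal (sqrt (2 * pi / \<gamma>))"
  proof -
    have [measurable]: "(\<lambda>y. qform {..<k} h y) \<in> borel_measurable (lborel_PiM {..<k})"
      by (intro qform_measurable cm) auto
    show ?thesis using IH by (subst nn_integral_multc) auto
  qed
  also have "\<dots> = ennreal (sqrt ((2 * pi) ^ Suc k / det (mat (Suc k) (Suc k) (\<lambda>(i, j). g i j))))"
    unfolding d using IH \<gamma> by (simp add: mult_ac flip: ennreal_mult real_sqrt_mult)
  finally show ?case using IH \<gamma> d by (simp add: lessThan_Suc)
qed

section \<open>Bilinear forms and coercivity of the inverse form\<close>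

definition bform :: "nat set \<Rightarrow> (nat \<Rightarrow> nat \<Rightarrow> real) \<Rightarrow> (nat \<Rightarrow> real) \<Rightarrow> (nat \<Rightarrow> real) \<Rightarrow> real" where
  "bform I g x y = (\<Sum>i\<in>I. \<Sum>j\<in>I. g i j * x i * y j)"

lemma bform_commute:
  assumes "\<And>i j. i \<in> I \<Longrightarrow> j \<in> I \<Longrightarrow> g i j = g j i"
  shows "bform I g x y = bform I g y x"
proof -
  have "bform I g x y = (\<Sum>j\<in>I. \<Sum>i\<in>I. g i j * x i * y j)"
    unfolding bform_def by (rule sum.swap)
  also have "\<dots> = bform I g y x"
    unfolding bform_def using assms by (intro sum.cong refl) (metis mult.assoc mult.commute)
  finally show ?thesis .
qed

lemma qform_add:
  assumes "\<And>i j. i \<in> I \<Longrightarrow> j \<in> I \<Longrightarrow> g i j = g j i"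
  shows "qform I g (\<lambda>i. s * x i + y i) = s\<^sup>2 * qform I g x + 2 * s * bform I g x y + qform I g y"
proof -
  have "qform I g (\<lambda>i. s * x i + y i) = s\<^sup>2 * qform I g x + s * bform I g x y + s * bform I g y x + qform I g y"
    unfolding qform_def bform_def
    by (simp add: algebra_simps power2_eq_square sum.distrib sum_distrib_left)
  thus ?thesis using bform_commute[of I g x y] assms by simp
qed

text \<open>Evaluates the cross terms of shifts: for g the inverse of b and x = b u, pairing with x
  is the plain inner product with u.\<close>

lemma bform_eq_inner:
  assumes "\<And>i j. i \<in> I \<Longrightarrow> j \<in> I \<Longrightarrow> g i j = g j i" and "\<And>i. i \<in> I \<Longrightarrow> (\<Sum>j\<in>I. g i j * x j) = u i"
  shows "bform I g x y = (\<Sum>i\<in>I. u i * y i)"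
proof -
  have "bform I g x y = bform I g y x" by (rule bform_commute[OF assms(1)])
  also have "\<dots> = (\<Sum>i\<in>I. y i * (\<Sum>j\<in>I. g i j * x j))"
    unfolding bform_def by (simp add: sum_distrib_left mult_ac)
  also have "\<dots> = (\<Sum>i\<in>I. u i * y i)" using assms(2) by (simp add: mult.commute)
  finally show ?thesis .
qed

lemma qform_le_sum_abs:
  assumes "finite I"
  shows "qform I g v \<le> (\<Sum>i\<in>I. \<Sum>j\<in>I. \<bar>g i j\<bar>) * (\<Sum>i\<in>I. (v i)\<^sup>2)"
proof -
  let ?s = "\<Sum>i\<in>I. (v i)\<^sup>2"
  have "g i j * v i * v j \<le> \<bar>g i j\<bar> * ?s" if "i \<in> I" "j \<in> I" for i j
  proof -
    have vi: "(v k)\<^sup>2 \<le> ?s" if "k \<in> I" for k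
      using that assms by (intro member_le_sum) auto
    have "\<bar>v i * v j\<bar> \<le> ((v i)\<^sup>2 + (v j)\<^sup>2) / 2"
      using sum_squares_bound[of "\<bar>v i\<bar>" "\<bar>v j\<bar>"] by (simp add: abs_mult)
    also have "\<dots> \<le> ?s" using add_mono[OF vi[OF that(1)] vi[OF that(2)]] by simp
    finally have "\<bar>g i j\<bar> * \<bar>v i * v j\<bar> \<le> \<bar>g i j\<bar> * ?s" by (intro mult_left_mono) auto
    with abs_ge_self[of "g i j * (v i * v j)"] show ?thesis
      unfolding abs_mult[of "g i j"] mult.assoc by (rule order_trans)
  qed
  hence "qform I g v \<le> (\<Sum>i\<in>I. \<Sum>j\<in>I. \<bar>g i j\<bar> * ?s)"
    unfolding qform_def by (intro sum_mono) auto
  thus ?thesis by (simp add: sum_distrib_right)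
qed

text \<open>Duality: the form of the inverse matrix dominates the squared norm because the form of the
  matrix itself is bounded.\<close>

lemma qform_inverse_coercive:
  fixes b P :: "nat \<Rightarrow> nat \<Rightarrow> real"
  assumes I: "finite I" and bs: "\<And>i j. i \<in> I \<Longrightarrow> j \<in> I \<Longrightarrow> b i j = b j i"
    and Ps: "\<And>i j. i \<in> I \<Longrightarrow> j \<in> I \<Longrightarrow> P i j = P j i"
    and inv: "\<And>i k. i \<in> I \<Longrightarrow> k \<in> I \<Longrightarrow> (\<Sum>j\<in>I. b i j * P j k) = (if i = k then 1 else 0)"
    and pd: "pos_def_on I b"
  obtains d where "d > 0" "\<And>v. qform I P v \<ge> d * (\<Sum>i\<in>I. (v i)\<^sup>2)"
proof -
  have Pb: "(\<Sum>j\<in>I. P i j * (\<Sum>k\<in>I. b j k * u k)) = u i" if "i \<in> I" for i u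
  proof -
    have "(\<Sum>j\<in>I. P i j * (\<Sum>k\<in>I. b j k * u k)) = (\<Sum>k\<in>I. (\<Sum>j\<in>I. b k j * P j i) * u k)"
      unfolding sum_distrib_left sum_distrib_right
      by (subst sum.swap, intro sum.cong refl) (use that bs Ps in \<open>metis mult.assoc mult.commute\<close>)
    also have "\<dots> = (\<Sum>k\<in>I. (if k = i then u k else 0))" using inv that by (intro sum.cong) auto
    also have "\<dots> = u i" using that I by simp
    finally show ?thesis .
  qed
  have bP: "(\<Sum>j\<in>I. b i j * (\<Sum>k\<in>I. P j k * u k)) = u i" if "i \<in> I" for i u
  proof -
    have "(\<Sum>j\<in>I. b i j * (\<Sum>k\<in>I. P j k * u k)) = (\<Sum>k\<in>I. (\<Sum>j\<in>I. b i j * P j k) * u k)"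
      unfolding sum_distrib_left sum_distrib_right
      by (subst sum.swap, intro sum.cong refl) (simp add: mult.assoc)
    also have "\<dots> = (\<Sum>k\<in>I. (if k = i then u k else 0))" using inv that by (intro sum.cong) auto
    also have "\<dots> = u i" using that I by simp
    finally show ?thesis .
  qed
  have q: "qform I g x = (\<Sum>i\<in>I. x i * (\<Sum>j\<in>I. g i j * x j))" for g x
    unfolding qform_def sum_distrib_left by (intro sum.cong refl) simp
  have b0: "qform I b v \<ge> 0" for v
  proof (cases "\<exists>i\<in>I. v i \<noteq> 0")
    case True thus ?thesis using pd unfolding pos_def_on_def by (metis less_imp_le)
  next
    case False thus ?thesis by (simp add: qform_def)
  qed
  have P0: "qform I P v \<ge> 0" for v
  proof -
    have "qform I b (\<lambda>j. \<Sum>k\<in>I. P j k * v k) = (\<Sum>i\<in>I. (\<Sum>k\<in>I. P i k * v k) * v i)"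
      unfolding q using bP by (intro sum.cong) auto
    also have "\<dots> = qform I P v" unfolding q by (simp add: mult.commute)
    finally show ?thesis using b0[of "\<lambda>j. \<Sum>k\<in>I. P j k * v k"] by simp
  qed
  define \<beta> where "\<beta> = (\<Sum>i\<in>I. \<Sum>j\<in>I. \<bar>b i j\<bar>) + 1"
  have \<beta>: "\<beta> > 0" unfolding \<beta>_def by (intro add_nonneg_pos sum_nonneg) auto
  have "qform I P v \<ge> 1 / \<beta> * (\<Sum>i\<in>I. (v i)\<^sup>2)" for v
  proof -
    let ?s = "\<Sum>i\<in>I. (v i)\<^sup>2"
    define y where "y = (\<lambda>j. \<Sum>k\<in>I. b j k * v k)"
    have "qform I P y = (\<Sum>i\<in>I. y i * v i)" unfolding q y_def using Pb by (intro sum.cong) auto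
    also have "\<dots> = qform I b v" unfolding q y_def by (simp add: mult.commute)
    finally have yy: "qform I P y = qform I b v" .
    have yv: "bform I P y v = ?s"
      unfolding power2_eq_square by (rule bform_eq_inner[OF Ps]) (auto simp: y_def Pb)
    \<comment> \<open>Nonnegativity is tested at v - y / \<beta> with y = b v: the cross term is the
      squared norm of v, and the form of P at y is the form of b at v, hence at most \<beta> times
      that squared norm.\<close>
    have "0 \<le> qform I P (\<lambda>i. (- 1 / \<beta>) * y i + v i)" by (rule P0)
    also have "\<dots> = (- 1 / \<beta>)\<^sup>2 * qform I b v + 2 * (- 1 / \<beta>) * ?s + qform I P v"
      by (subst qform_add, rule Ps, assumption, assumption) (simp add: yy yv)
    finally have 1: "2 / \<beta> * ?s - qform I b v / \<beta>\<^sup>2 \<le> qform I P v"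
      by (simp add: power_divide)
    have "qform I b v \<le> \<beta> * ?s"
      using qform_le_sum_abs[OF I, of b v] sum_nonneg[of I "\<lambda>i. (v i)\<^sup>2"] by (simp add: \<beta>_def algebra_simps)
    hence "qform I b v / \<beta>\<^sup>2 \<le> \<beta> * ?s / \<beta>\<^sup>2" using \<beta> by (intro divide_right_mono) auto
    also have "\<beta> * ?s / \<beta>\<^sup>2 = 1 / \<beta> * ?s" using \<beta> by (simp add: power2_eq_square)
    finally show ?thesis using 1 by (simp add: field_simps)
  qed
  thus ?thesis using that[of "1 / \<beta>"] \<beta> by simp
qed

section \<open>Gaussian laws: shifts, tails and marginals\<close>

text \<open>\<open>b\<close> is the covariance and \<open>P\<close> its inverse. The normalising
  constant \<open>c\<close> stays abstract, tied down by total mass 1; the constants of marginals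
  are likewise found by comparing masses.\<close>

locale gaussian_law =
  fixes n :: nat and b P :: "nat \<Rightarrow> nat \<Rightarrow> real" and \<mu> :: "nat \<Rightarrow> real" and c :: real
  assumes b_sym: "i < n \<Longrightarrow> j < n \<Longrightarrow> b i j = b j i"
    and P_sym: "i < n \<Longrightarrow> j < n \<Longrightarrow> P i j = P j i"
    and inv: "i < n \<Longrightarrow> k < n \<Longrightarrow> (\<Sum>j<n. b i j * P j k) = (if i = k then 1 else 0)"
    and b_pd: "pos_def_on {..<n} b"
    and c_pos: "c > 0"
    and total: "(\<integral>\<^sup>+y. ennreal (c * exp (- qform {..<n} P (\<lambda>i. y i - \<mu> i) / 2)) \<partial>lborel_PiM {..<n}) = 1"
begin

definition law_density :: "(nat \<Rightarrow> real) \<Rightarrow> real" where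
  "law_density y = c * exp (- qform {..<n} P (\<lambda>i. y i - \<mu> i) / 2)"

definition law :: "(nat \<Rightarrow> real) measure" where
  "law = density (lborel_PiM {..<n}) (\<lambda>y. ennreal (law_density y))"

lemma law_density_measurable [measurable]: "law_density \<in> borel_measurable (lborel_PiM {..<n})"
proof -
  have [measurable]: "(\<lambda>y. qform {..<n} P (\<lambda>i. y i - \<mu> i)) \<in> borel_measurable (lborel_PiM {..<n})"
    by (intro qform_measurable borel_measurable_diff component_measurable) auto
  show ?thesis unfolding law_density_def[abs_def] by measurable
qed

lemma law_density_pos: "law_density y > 0"
  using c_pos by (simp add: law_density_def)

lemma sets_law [simp, measurable_cong]: "sets law = sets (lborel_PiM {..<n})"
  and space_law [simp]: "space law = space (lborel_PiM {..<n})"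
  by (simp_all add: law_def)

lemma prob_space_law: "prob_space law"
proof
  show "emeasure law (space law) = 1"
    using total[folded law_density_def] by (simp add: law_def emeasure_density)
qed

lemma inverse_apply: "i < n \<Longrightarrow> (\<Sum>j<n. P i j * (\<Sum>k<n. b j k * u k)) = u i"
proof -
  assume i: "i < n"
  have "(\<Sum>j<n. P i j * (\<Sum>k<n. b j k * u k)) = (\<Sum>k<n. (\<Sum>j<n. b k j * P j i) * u k)"
    unfolding sum_distrib_left sum_distrib_right
    by (subst sum.swap, intro sum.cong refl) (use i b_sym P_sym in \<open>metis lessThan_iff mult.assoc mult.commute\<close>)
  also have "\<dots> = (\<Sum>k<n. (if k = i then u k else 0))" using inv i by (intro sum.cong) auto
  also have "\<dots> = u i" using i by simp
  finally show ?thesis .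
qed

text \<open>Applying \<open>P\<close> to b u gives back u, so the cross term of a shift along b u is
  the linear functional u itself.\<close>

lemma qform_shift:
  assumes ys: "\<And>i. i < n \<Longrightarrow> ys i = (\<Sum>j<n. b i j * u j)"
  shows "qform {..<n} P (\<lambda>i. t * ys i + v i) = t\<^sup>2 * (\<Sum>i<n. u i * ys i) + 2 * t * (\<Sum>i<n. u i * v i) + qform {..<n} P v"
proof -
  have u: "(\<Sum>j\<in>{..<n}. P i j * ys j) = u i" if "i \<in> {..<n}" for i
    using inverse_apply[of i u] ys that by simp
  have "bform {..<n} P ys x = (\<Sum>i<n. u i * x i)" for x
    by (rule bform_eq_inner) (use P_sym u in auto)
  moreover have "qform {..<n} P ys = bform {..<n} P ys ys" by (simp add: qform_def bform_def)
  moreover have "qform {..<n} P (\<lambda>i. t * ys i + v i) = t\<^sup>2 * qform {..<n} P ys + 2 * t * bform {..<n} P ys v + qform {..<n} P v"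
    by (rule qform_add) (use P_sym in auto)
  ultimately show ?thesis by simp
qed

text \<open>The Cameron-Martin formula for the direction b u.\<close>

lemma law_density_shift:
  assumes ys: "\<And>i. i < n \<Longrightarrow> ys i = (\<Sum>j<n. b i j * u j)"
  shows "law_density (\<lambda>i\<in>{..<n}. z i + t * ys i) =
    exp (- t\<^sup>2 * (\<Sum>i<n. u i * ys i) / 2 - t * (\<Sum>i<n. u i * (z i - \<mu> i))) * law_density z"
proof -
  have "qform {..<n} P (\<lambda>i. (\<lambda>i\<in>{..<n}. z i + t * ys i) i - \<mu> i) = qform {..<n} P (\<lambda>i. t * ys i + (z i - \<mu> i))"
    by (intro qform_cong) simp
  also have "\<dots> = t\<^sup>2 * (\<Sum>i<n. u i * ys i) + 2 * t * (\<Sum>i<n. u i * (z i - \<mu> i)) + qform {..<n} P (\<lambda>i. z i - \<mu> i)"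
    by (rule qform_shift[OF ys])
  finally show ?thesis unfolding law_density_def by (simp add: add_divide_distrib flip: exp_add)
qed

text \<open>On the half-space the exponential factor of the shifted density is at most its value on
  the bounding hyperplane. The probability of the shifted-back set is kept as a factor: it is
  bounded by 1 in \<open>half_space_bound\<close>, but decays in
  \<open>half_space_far\<close>.\<close>

lemma law_shift_bound:
  assumes ys: "\<And>i. i < n \<Longrightarrow> ys i = (\<Sum>j<n. b i j * u j)" and S: "S = (\<Sum>i<n. u i * ys i)"
    and F: "F \<in> sets law" and t: "t \<ge> 0" and half: "\<And>y. y \<in> F \<Longrightarrow> (\<Sum>i<n. u i * y i) \<ge> t * S - C"
  shows "measure law F \<le> exp (- t\<^sup>2 * S / 2 + t * (C + (\<Sum>i<n. u i * \<mu> i)))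
    * measure law {z \<in> space law. (\<lambda>i\<in>{..<n}. z i + t * ys i) \<in> F}"
proof -
  interpret prob_space law by (rule prob_space_law)
  define sh where "sh = (\<lambda>z. \<lambda>i\<in>{..<n}. z i + t * ys i)"
  define e where "e = exp (- t\<^sup>2 * S / 2 + t * (C + (\<Sum>i<n. u i * \<mu> i)))"
  have shm [measurable]: "sh \<in> lborel_PiM {..<n} \<rightarrow>\<^sub>M lborel_PiM {..<n}"
    unfolding sh_def
  proof (rule measurable_restrict)
    fix i assume "i \<in> {..<n}"
    from component_measurable[OF this]
    show "(\<lambda>z. z i + t * ys i) \<in> lborel_PiM {..<n} \<rightarrow>\<^sub>M lborel" by simp
  qed
  have [measurable]: "F \<in> sets (lborel_PiM {..<n})" using F by simp
  have F': "{z \<in> space law. sh z \<in> F} \<in> sets law" by simp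
  have "emeasure law F = (\<integral>\<^sup>+y. ennreal (law_density y) * indicator F y \<partial>lborel_PiM {..<n})"
    using F by (simp add: law_def emeasure_density)
  also have "\<dots> = (\<integral>\<^sup>+z. ennreal (law_density (sh z)) * indicator F (sh z) \<partial>lborel_PiM {..<n})"
    unfolding sh_def
    by (rule nn_integral_PiM_affine_reindex[symmetric, where h = "\<lambda>i. i"]) (auto simp: bij_betw_def)
  also have "\<dots> \<le> (\<integral>\<^sup>+z. ennreal e * (ennreal (law_density z) * indicator {z \<in> space law. sh z \<in> F} z) \<partial>lborel_PiM {..<n})"
  proof (rule nn_integral_mono)
    fix z assume z: "z \<in> space (lborel_PiM {..<n})"
    show "ennreal (law_density (sh z)) * indicator F (sh z) \<le> ennreal e * (ennreal (law_density z) * indicator {z \<in> space law. sh z \<in> F} z)"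
    proof (cases "sh z \<in> F")
      case True
      have "t * S - C \<le> (\<Sum>i<n. u i * sh z i)" by (rule half[OF True])
      also have "\<dots> = (\<Sum>i<n. u i * z i) + t * S"
        by (simp add: sh_def S algebra_simps sum.distrib sum_distrib_left)
      finally have "- C \<le> (\<Sum>i<n. u i * z i)" by simp
      hence "t * (- C - (\<Sum>i<n. u i * \<mu> i)) \<le> t * (\<Sum>i<n. u i * (z i - \<mu> i))"
        using t by (intro mult_left_mono) (auto simp: right_diff_distrib sum_subtractf)
      hence "exp (- t\<^sup>2 * S / 2 - t * (\<Sum>i<n. u i * (z i - \<mu> i))) \<le> e"
        unfolding e_def by (simp add: algebra_simps)
      hence "exp (- t\<^sup>2 * S / 2 - t * (\<Sum>i<n. u i * (z i - \<mu> i))) * law_density z \<le> e * law_density z"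
        using law_density_pos[of z] by (intro mult_right_mono) auto
      hence "law_density (sh z) \<le> e * law_density z"
        unfolding sh_def S using law_density_shift[of ys u z t] ys by simp
      hence "ennreal (law_density (sh z)) \<le> ennreal e * ennreal (law_density z)"
        by (subst ennreal_mult[symmetric]) (use law_density_pos[of z] in \<open>auto simp: e_def intro: ennreal_leI\<close>)
      thus ?thesis using True z by simp
    qed auto
  qed
  also have "\<dots> = ennreal e * emeasure law {z \<in> space law. sh z \<in> F}"
  proof -
    have "(\<lambda>z. ennreal (law_density z) * indicator {z \<in> space law. sh z \<in> F} z) \<in> borel_measurable (lborel_PiM {..<n})"
      using F' by simp
    thus ?thesis using F' by (simp add: nn_integral_cmult) (simp add: law_def emeasure_density)
  qed
  finally have "ennreal (measure law F) \<le> ennreal (e * measure law {z \<in> space law. sh z \<in> F})"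
    by (simp add: emeasure_eq_measure ennreal_mult' e_def)
  thus ?thesis by (simp add: e_def sh_def ennreal_le_iff)
qed

lemma law_tail:
  obtains K d where "K \<ge> 0" "d > 0"
    "\<And>r. r \<ge> 0 \<Longrightarrow> measure law {y \<in> space law. \<exists>i<n. \<bar>y i\<bar> \<ge> r} \<le> K * exp (- d * r\<^sup>2)"
proof -
  interpret prob_space law by (rule prob_space_law)
  obtain d0 where d0: "d0 > 0" "\<And>v. qform {..<n} P v \<ge> d0 * (\<Sum>i<n. (v i)\<^sup>2)"
    by (rule qform_inverse_coercive[of "{..<n}" b P]) (use b_sym P_sym inv b_pd in auto)
  \<comment> \<open>The coercivity constant is split: one half keeps a Gaussian integral finite, the
    other gives the decay. The rate \<open>d1 / 4\<close> results from removing the mean by y^2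
    \<le> 2 (y - \<mu>)^2 + 2 \<mu>^2.\<close>
  define d1 where "d1 = d0 / 2"
  define g where "g = (\<lambda>i j :: nat. if i = j then d1 else 0)"
  have gq: "qform {..<n} g v = d1 * (\<Sum>i<n. (v i)\<^sup>2)" for v
  proof -
    have "(\<Sum>j<n. g i j * v i * v j) = d1 * (v i)\<^sup>2" if "i \<in> {..<n}" for i
    proof -
      have "(\<Sum>j<n. g i j * v i * v j) = (\<Sum>j<n. if i = j then d1 * v i * v j else 0)"
        by (intro sum.cong) (auto simp: g_def)
      thus ?thesis using that by (simp add: power2_eq_square)
    qed
    thus ?thesis by (simp add: qform_def sum_distrib_left)
  qed
  have "pos_def_on {..<n} g"
    unfolding pos_def_on_def gq using d0(1)
    by (auto simp: d1_def intro!: mult_pos_pos sum_pos2)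
  hence "(\<integral>\<^sup>+y. ennreal (exp (- qform {..<n} g y / 2)) \<partial>lborel_PiM {..<n})
      = ennreal (sqrt ((2 * pi) ^ n / det (mat n n (\<lambda>(i, j). g i j))))"
    by (intro nn_integral_gaussian_det[THEN conjunct2]) (auto simp: g_def)
  then obtain X where X: "X \<ge> 0" "(\<integral>\<^sup>+y. ennreal (exp (- qform {..<n} g y / 2)) \<partial>lborel_PiM {..<n}) = ennreal X"
    by (metis ennreal_lt_0 ennreal_0 le_cases linorder_not_less)
  define K where "K = c * X * exp (d1 / 2 * (\<Sum>i<n. (\<mu> i)\<^sup>2))"
  define d where "d = d1 / 4"
  have d1: "d1 > 0" using d0 by (simp add: d1_def)
  have gm: "(\<lambda>y. qform {..<n} g y) \<in> borel_measurable (lborel_PiM {..<n})"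
    by (intro qform_measurable component_measurable)
  have bound: "measure law {y \<in> space law. \<exists>i<n. \<bar>y i\<bar> \<ge> r} \<le> K * exp (- d * r\<^sup>2)" if r: "r \<ge> 0" for r
  proof -
    let ?F = "{y \<in> space law. \<exists>i<n. \<bar>y i\<bar> \<ge> r}"
    have F: "?F \<in> sets law"
    proof -
      have "?F = (\<Union>i\<in>{..<n}. {y \<in> space (lborel_PiM {..<n}). \<bar>y i\<bar> \<ge> r})" by auto
      also have "\<dots> \<in> sets (lborel_PiM {..<n})"
      proof (intro sets.finite_UN)
        fix i assume "i \<in> {..<n}"
        note [measurable] = component_measurable[OF this]
        show "{y \<in> space (lborel_PiM {..<n}). \<bar>y i\<bar> \<ge> r} \<in> sets (lborel_PiM {..<n})" by measurable
      qed auto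
      finally show ?thesis by simp
    qed
    have "emeasure law ?F = (\<integral>\<^sup>+y. ennreal (law_density y) * indicator ?F y \<partial>lborel_PiM {..<n})"
      using F unfolding law_def by (subst emeasure_density) auto
    also have "\<dots> \<le> (\<integral>\<^sup>+y. ennreal (c * exp (d1 / 2 * (\<Sum>i<n. (\<mu> i)\<^sup>2)) * exp (- d * r\<^sup>2)) * ennreal (exp (- qform {..<n} g (\<lambda>i\<in>{..<n}. y i + - \<mu> i) / 2)) \<partial>lborel_PiM {..<n})"
    proof (rule nn_integral_mono)
      fix y
      show "ennreal (law_density y) * indicator ?F y \<le> ennreal (c * exp (d1 / 2 * (\<Sum>i<n. (\<mu> i)\<^sup>2)) * exp (- d * r\<^sup>2)) * ennreal (exp (- qform {..<n} g (\<lambda>i\<in>{..<n}. y i + - \<mu> i) / 2))"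
      proof (cases "y \<in> ?F")
        case True
        then obtain i where i: "i < n" "\<bar>y i\<bar> \<ge> r" by auto
        define s where "s = (\<Sum>i<n. (y i - \<mu> i)\<^sup>2)"
        have gs: "qform {..<n} g (\<lambda>i\<in>{..<n}. y i + - \<mu> i) = d1 * s"
          unfolding gq s_def by simp
        have "(y i - \<mu> i)\<^sup>2 \<le> s" unfolding s_def using i by (intro member_le_sum) auto
        moreover have "(\<mu> i)\<^sup>2 \<le> (\<Sum>i<n. (\<mu> i)\<^sup>2)" using i by (intro member_le_sum) auto
        moreover have "(y i)\<^sup>2 \<le> 2 * (y i - \<mu> i)\<^sup>2 + 2 * (\<mu> i)\<^sup>2"
          using zero_le_power2[of "y i - 2 * \<mu> i"] by (simp add: power2_eq_square algebra_simps)
        moreover have "r\<^sup>2 \<le> (y i)\<^sup>2" using i r by (metis abs_of_nonneg power2_abs power_mono)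
        ultimately have "r\<^sup>2 \<le> 2 * s + 2 * (\<Sum>i<n. (\<mu> i)\<^sup>2)" by linarith
        hence "d1 / 4 * r\<^sup>2 \<le> d1 / 4 * (2 * s + 2 * (\<Sum>i<n. (\<mu> i)\<^sup>2))"
          using d1 by (intro mult_left_mono) auto
        hence "d * r\<^sup>2 \<le> d1 * s / 2 + d1 / 2 * (\<Sum>i<n. (\<mu> i)\<^sup>2)" by (simp add: d_def algebra_simps)
        moreover have "2 * d1 * s \<le> qform {..<n} P (\<lambda>i. y i - \<mu> i)"
          using d0(2)[of "\<lambda>i. y i - \<mu> i"] by (simp add: d1_def s_def)
        ultimately have "- qform {..<n} P (\<lambda>i. y i - \<mu> i) / 2 \<le> d1 / 2 * (\<Sum>i<n. (\<mu> i)\<^sup>2) + - d * r\<^sup>2 + - (d1 * s) / 2"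
          by simp
        hence "exp (- qform {..<n} P (\<lambda>i. y i - \<mu> i) / 2) \<le> exp (d1 / 2 * (\<Sum>i<n. (\<mu> i)\<^sup>2) + - d * r\<^sup>2 + - (d1 * s) / 2)" by simp
        hence "law_density y \<le> c * exp (d1 / 2 * (\<Sum>i<n. (\<mu> i)\<^sup>2) + - d * r\<^sup>2 + - (d1 * s) / 2)"
          unfolding law_density_def using c_pos by (intro mult_left_mono) auto
        also have "\<dots> = c * exp (d1 / 2 * (\<Sum>i<n. (\<mu> i)\<^sup>2)) * exp (- d * r\<^sup>2) * exp (- (d1 * s) / 2)"
          by (simp only: exp_add mult.assoc)
        finally have "ennreal (law_density y) \<le> ennreal (c * exp (d1 / 2 * (\<Sum>i<n. (\<mu> i)\<^sup>2)) * exp (- d * r\<^sup>2) * exp (- (d1 * s) / 2))"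
          by (rule ennreal_leI)
        thus ?thesis using True c_pos unfolding gs by (subst ennreal_mult[symmetric]) auto
      qed auto
    qed
    also have "\<dots> = ennreal (c * exp (d1 / 2 * (\<Sum>i<n. (\<mu> i)\<^sup>2)) * exp (- d * r\<^sup>2)) *
        (\<integral>\<^sup>+y. ennreal (exp (- qform {..<n} g (\<lambda>i\<in>{..<n}. y i + - \<mu> i) / 2)) \<partial>lborel_PiM {..<n})"
    proof (rule nn_integral_cmult)
      have "(\<lambda>y. qform {..<n} g (\<lambda>i\<in>{..<n}. y i + - \<mu> i)) \<in> borel_measurable (lborel_PiM {..<n})"
        by (intro qform_measurable) (auto intro!: borel_measurable_diff component_measurable)
      thus "(\<lambda>y. ennreal (exp (- qform {..<n} g (\<lambda>i\<in>{..<n}. y i + - \<mu> i) / 2))) \<in> borel_measurable (lborel_PiM {..<n})"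
        by measurable
    qed
    also have "(\<integral>\<^sup>+y. ennreal (exp (- qform {..<n} g (\<lambda>i\<in>{..<n}. y i + - \<mu> i) / 2)) \<partial>lborel_PiM {..<n}) = ennreal X"
      unfolding X(2)[symmetric]
    proof (rule nn_integral_PiM_affine_reindex[where h = "\<lambda>i. i" and c = "\<lambda>i. - \<mu> i"])
      show "(\<lambda>y. ennreal (exp (- qform {..<n} g y / 2))) \<in> borel_measurable (lborel_PiM {..<n})"
        using gm by measurable
    qed (auto simp: bij_betw_def)
    also have "ennreal (c * exp (d1 / 2 * (\<Sum>i<n. (\<mu> i)\<^sup>2)) * exp (- d * r\<^sup>2)) * ennreal X = ennreal (K * exp (- d * r\<^sup>2))"
      using c_pos X(1) by (simp add: K_def mult_ac flip: ennreal_mult)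
    finally have "ennreal (measure law ?F) \<le> ennreal (K * exp (- d * r\<^sup>2))" by (simp add: emeasure_eq_measure)
    thus ?thesis using c_pos X(1) by (subst (asm) ennreal_le_iff) (auto simp: K_def)
  qed
  show ?thesis
    by (rule that[of K d]) (use bound d1 c_pos X(1) in \<open>auto simp: K_def d_def\<close>)
qed

end

section \<open>Inverse submatrices and marginal laws\<close>

text \<open>The product of the transpose of \<open>\<alpha>\<close>, \<open>b\<close> and
  \<open>\<alpha>\<close> is evaluated in both orders; by symmetry of \<open>b\<close> one order
  gives \<open>\<alpha>\<close> and the other its transpose.\<close>

lemma right_inverse_sym:
  fixes b \<alpha> :: "nat \<Rightarrow> nat \<Rightarrow> real"
  assumes I: "finite I" and bs: "\<And>i j. i \<in> I \<Longrightarrow> j \<in> I \<Longrightarrow> b i j = b j i"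
    and inv: "\<And>i k. i \<in> I \<Longrightarrow> k \<in> I \<Longrightarrow> (\<Sum>j\<in>I. b i j * \<alpha> j k) = (if i = k then 1 else 0)"
    and jk: "j \<in> I" "k \<in> I"
  shows "\<alpha> j k = \<alpha> k j"
proof -
  have "(\<Sum>i\<in>I. \<alpha> i j * (\<Sum>l\<in>I. b i l * \<alpha> l k)) = (\<Sum>i\<in>I. if i = k then \<alpha> i j else 0)"
    using inv jk by (intro sum.cong) auto
  hence 1: "(\<Sum>i\<in>I. \<alpha> i j * (\<Sum>l\<in>I. b i l * \<alpha> l k)) = \<alpha> k j" using I jk by simp
  have "(\<Sum>i\<in>I. \<alpha> i j * (\<Sum>l\<in>I. b i l * \<alpha> l k)) = (\<Sum>l\<in>I. (\<Sum>i\<in>I. b l i * \<alpha> i j) * \<alpha> l k)"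
    unfolding sum_distrib_left sum_distrib_right
    by (subst sum.swap, intro sum.cong refl) (use bs in \<open>metis mult.assoc mult.commute\<close>)
  also have "\<dots> = (\<Sum>l\<in>I. if l = j then \<alpha> l k else 0)"
    using inv jk by (intro sum.cong) auto
  also have "\<dots> = \<alpha> j k" using I jk by simp
  finally show ?thesis using 1 by simp
qed

lemma abs_exp_minus_diff_le:
  assumes "u \<ge> 0" "v \<ge> (0::real)"
  shows "\<bar>exp (- u) - exp (- v)\<bar> \<le> \<bar>u - v\<bar>"
proof -
  have *: "exp (- v) - exp (- u) \<le> u - v" if "v \<le> u" "v \<ge> 0" for u v :: real
  proof -
    have "1 - exp (- (u - v)) \<le> u - v" using exp_ge_add_one_self[of "- (u - v)"] by linarith
    hence "exp (- v) * (1 - exp (- (u - v))) \<le> 1 * (u - v)"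
      using that by (intro mult_mono) auto
    thus ?thesis by (simp add: right_diff_distrib flip: exp_add)
  qed
  show ?thesis using *[of u v] *[of v u] assms by (cases "u \<le> v") auto
qed

text \<open>The map u to exp (- u) is 1-Lipschitz on nonnegative reals, so the difference is bounded
  by that of the exponents, which is linear plus quadratic in z - w. This is the modulus that
  \<open>gamma_quot_concentration\<close> asks of \<open>E\<close>.\<close>

lemma exp_qform_lipschitz:
  fixes \<alpha> :: "nat \<Rightarrow> nat \<Rightarrow> real"
  assumes I: "finite I" and s: "\<And>i j. i \<in> I \<Longrightarrow> j \<in> I \<Longrightarrow> \<alpha> i j = \<alpha> j i"
    and pos: "\<And>v. qform I \<alpha> v \<ge> 0"
  obtains K where "K \<ge> 0" "\<And>z. \<bar>exp (- qform I \<alpha> (\<lambda>i. z i - m i) / 2) - exp (- qform I \<alpha> (\<lambda>i. w i - m i) / 2)\<bar>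
     \<le> K * (\<Sum>i\<in>I. \<bar>z i - w i\<bar> + (z i - w i)\<^sup>2)"
proof -
  define l where "l = (\<lambda>i. \<Sum>j\<in>I. \<alpha> i j * (w j - m j))"
  define K where "K = (\<Sum>i\<in>I. \<bar>l i\<bar>) + (\<Sum>i\<in>I. \<Sum>j\<in>I. \<bar>\<alpha> i j\<bar>)"
  have K1: "(\<Sum>i\<in>I. \<bar>l i\<bar>) \<ge> 0" "(\<Sum>i\<in>I. \<Sum>j\<in>I. \<bar>\<alpha> i j\<bar>) \<ge> 0" by (auto intro!: sum_nonneg)
  have "\<bar>exp (- qform I \<alpha> (\<lambda>i. z i - m i) / 2) - exp (- qform I \<alpha> (\<lambda>i. w i - m i) / 2)\<bar>
     \<le> K * (\<Sum>i\<in>I. \<bar>z i - w i\<bar> + (z i - w i)\<^sup>2)" for z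
  proof -
    define d where "d = (\<lambda>i. z i - w i)"
    have "qform I \<alpha> (\<lambda>i. z i - m i) = qform I \<alpha> (\<lambda>i. 1 * (w i - m i) + d i)"
      by (simp add: d_def)
    also have "\<dots> = qform I \<alpha> (\<lambda>i. w i - m i) + 2 * bform I \<alpha> (\<lambda>i. w i - m i) d + qform I \<alpha> d"
      by (subst qform_add, rule s, assumption, assumption) simp
    also have "bform I \<alpha> (\<lambda>i. w i - m i) d = (\<Sum>i\<in>I. l i * d i)"
      by (rule bform_eq_inner, rule s, assumption, assumption) (simp add: l_def)
    finally have q: "qform I \<alpha> (\<lambda>i. z i - m i) / 2 - qform I \<alpha> (\<lambda>i. w i - m i) / 2 = (\<Sum>i\<in>I. l i * d i) + qform I \<alpha> d / 2"
      by (simp add: add_divide_distrib)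
    have "\<bar>exp (- (qform I \<alpha> (\<lambda>i. z i - m i) / 2)) - exp (- (qform I \<alpha> (\<lambda>i. w i - m i) / 2))\<bar>
        \<le> \<bar>(\<Sum>i\<in>I. l i * d i) + qform I \<alpha> d / 2\<bar>"
      unfolding q[symmetric] using pos by (intro abs_exp_minus_diff_le) auto
    also have "\<dots> \<le> \<bar>\<Sum>i\<in>I. l i * d i\<bar> + qform I \<alpha> d" using pos[of d] by linarith
    also have "\<dots> \<le> (\<Sum>i\<in>I. \<bar>l i\<bar>) * (\<Sum>i\<in>I. \<bar>d i\<bar>) + (\<Sum>i\<in>I. \<Sum>j\<in>I. \<bar>\<alpha> i j\<bar>) * (\<Sum>i\<in>I. (d i)\<^sup>2)"
    proof (rule add_mono)
      have "\<bar>\<Sum>i\<in>I. l i * d i\<bar> \<le> (\<Sum>i\<in>I. \<bar>l i\<bar> * \<bar>d i\<bar>)"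
        using sum_abs[of "\<lambda>i. l i * d i" I] by (simp add: abs_mult)
      also have "\<dots> \<le> (\<Sum>i\<in>I. \<bar>l i\<bar> * (\<Sum>j\<in>I. \<bar>d j\<bar>))"
        using I by (intro sum_mono mult_left_mono member_le_sum) auto
      finally show "\<bar>\<Sum>i\<in>I. l i * d i\<bar> \<le> (\<Sum>i\<in>I. \<bar>l i\<bar>) * (\<Sum>i\<in>I. \<bar>d i\<bar>)" by (simp add: sum_distrib_right)
    qed (rule qform_le_sum_abs[OF I])
    also have "\<dots> \<le> K * (\<Sum>i\<in>I. \<bar>d i\<bar>) + K * (\<Sum>i\<in>I. (d i)\<^sup>2)"
      unfolding K_def using K1 by (intro add_mono mult_right_mono) (auto intro: sum_nonneg)
    finally show ?thesis by (simp add: d_def sum.distrib distrib_left)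
  qed
  thus ?thesis using that[of K] K1 by (simp add: K_def)
qed

context gaussian_law
begin

text \<open>The form of \<open>\<alpha>\<close> at \<open>v\<close> is the form of \<open>b\<close>
  at \<alpha> v extended by zero outside \<open>I\<close>, so positivity is inherited from the full
  matrix.\<close>

lemma pos_def_on_inverse:
  assumes I: "I \<subseteq> {..<n}"
    and inv\<alpha>: "\<And>i k. i \<in> I \<Longrightarrow> k \<in> I \<Longrightarrow> (\<Sum>j\<in>I. b i j * \<alpha> j k) = (if i = k then 1 else 0)"
  shows "pos_def_on I \<alpha>"
  unfolding pos_def_on_def
proof (intro allI impI)
  fix v :: "nat \<Rightarrow> real" assume v: "\<exists>i\<in>I. v i \<noteq> 0"
  have fin: "finite I" using I finite_subset by blast
  define \<beta> where "\<beta> = (\<lambda>j. if j \<in> I then \<Sum>k\<in>I. \<alpha> j k * v k else 0)"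
  have b\<beta>: "(\<Sum>j\<in>I. b i j * \<beta> j) = v i" if "i \<in> I" for i
  proof -
    have "(\<Sum>j\<in>I. b i j * \<beta> j) = (\<Sum>k\<in>I. (\<Sum>j\<in>I. b i j * \<alpha> j k) * v k)"
      unfolding sum_distrib_right by (subst sum.swap) (simp add: \<beta>_def sum_distrib_left mult.assoc)
    also have "\<dots> = (\<Sum>k\<in>I. if k = i then v k else 0)" using inv\<alpha> that by (intro sum.cong) auto
    finally show ?thesis using that fin by simp
  qed
  have "\<exists>i\<in>I. \<beta> i \<noteq> 0"
  proof (rule ccontr)
    assume "\<not> (\<exists>i\<in>I. \<beta> i \<noteq> 0)"
    hence "v i = 0" if "i \<in> I" for i using b\<beta>[OF that] by simp
    thus False using v by auto
  qed
  hence "qform {..<n} b \<beta> > 0" using b_pd I unfolding pos_def_on_def by blast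
  also have "qform {..<n} b \<beta> = qform I b \<beta>"
  proof -
    have "(\<Sum>j<n. b i j * \<beta> i * \<beta> j) = (\<Sum>j\<in>I. b i j * \<beta> i * \<beta> j)" for i
      using I by (intro sum.mono_neutral_right) (auto simp: \<beta>_def)
    moreover have "(\<Sum>i<n. \<Sum>j\<in>I. b i j * \<beta> i * \<beta> j) = (\<Sum>i\<in>I. \<Sum>j\<in>I. b i j * \<beta> i * \<beta> j)"
      using I by (intro sum.mono_neutral_right) (auto simp: \<beta>_def)
    ultimately show ?thesis by (simp add: qform_def)
  qed
  also have "\<dots> = (\<Sum>i\<in>I. \<beta> i * (\<Sum>j\<in>I. b i j * \<beta> j))"
    unfolding qform_def sum_distrib_left by (intro sum.cong refl) simp
  also have "\<dots> = (\<Sum>i\<in>I. \<beta> i * v i)" using b\<beta> by simp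
  also have "\<dots> = qform I \<alpha> v"
    unfolding qform_def \<beta>_def by (intro sum.cong refl) (simp add: sum_distrib_right sum_distrib_left mult_ac)
  finally show "qform I \<alpha> v > 0" .
qed

text \<open>Conditioning on the coordinates in \<open>I\<close>, with \<open>m\<close> the
  conditional mean of the others in the centred case. The vector b u with u = \<alpha> y supported
  on \<open>I\<close> agrees with \<open>y\<close> on \<open>I\<close>; hence the difference
  vanishes there and the cross term with u is zero.\<close>

lemma qform_block:
  assumes I: "I \<subseteq> {..<n}" "K = {..<n} - I"
    and inv\<alpha>: "\<And>i k. i \<in> I \<Longrightarrow> k \<in> I \<Longrightarrow> (\<Sum>j\<in>I. b i j * \<alpha> j k) = (if i = k then 1 else 0)"
    and m: "\<And>i. i \<in> K \<Longrightarrow> m i = (\<Sum>k\<in>I. b i k * (\<Sum>l\<in>I. \<alpha> k l * y l))"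
  shows "qform {..<n} P y = qform I \<alpha> y + qform K P (\<lambda>i. y i - m i)"
proof -
  have fin: "finite I" using I finite_subset by blast
  define u where "u = (\<lambda>k. if k \<in> I then \<Sum>l\<in>I. \<alpha> k l * y l else 0)"
  define ys where "ys = (\<lambda>i. \<Sum>j<n. b i j * u j)"
  define v where "v = (\<lambda>i. y i - ys i)"
  have ysI': "ys i = (\<Sum>k\<in>I. b i k * (\<Sum>l\<in>I. \<alpha> k l * y l))" for i
  proof -
    have "ys i = (\<Sum>j\<in>I. b i j * u j)"
      unfolding ys_def using I by (intro sum.mono_neutral_right) (auto simp: u_def)
    thus ?thesis by (simp add: u_def)
  qed
  have ysI: "ys i = y i" if "i \<in> I" for i
  proof -
    have "ys i = (\<Sum>l\<in>I. (\<Sum>k\<in>I. b i k * \<alpha> k l) * y l)"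
      unfolding ysI' sum_distrib_right by (subst sum.swap) (simp add: sum_distrib_left mult.assoc)
    also have "\<dots> = (\<Sum>l\<in>I. if l = i then y l else 0)" using inv\<alpha> that by (intro sum.cong) auto
    finally show ?thesis using that fin by simp
  qed
  have vI: "v i = 0" if "i \<in> I" for i using ysI[OF that] by (simp add: v_def)
  have "qform {..<n} P y = qform {..<n} P (\<lambda>i. 1 * ys i + v i)" by (simp add: v_def)
  also have "\<dots> = 1\<^sup>2 * (\<Sum>i<n. u i * ys i) + 2 * 1 * (\<Sum>i<n. u i * v i) + qform {..<n} P v"
    by (rule qform_shift) (simp add: ys_def)
  also have "(\<Sum>i<n. u i * v i) = 0" by (intro sum.neutral) (auto simp: u_def vI)
  also have "(\<Sum>i<n. u i * ys i) = (\<Sum>i\<in>I. u i * y i)"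
    using I ysI by (intro sum.mono_neutral_cong_right) (auto simp: u_def)
  also have "\<dots> = qform I \<alpha> y"
    unfolding qform_def u_def by (intro sum.cong refl) (simp add: sum_distrib_left sum_distrib_right mult_ac)
  also have "qform {..<n} P v = qform K P v"
  proof -
    have "(\<Sum>j<n. P i j * v i * v j) = (\<Sum>j\<in>K. P i j * v i * v j)" for i
      using I vI by (intro sum.mono_neutral_right) auto
    moreover have "(\<Sum>i<n. \<Sum>j\<in>K. P i j * v i * v j) = (\<Sum>i\<in>K. \<Sum>j\<in>K. P i j * v i * v j)"
      using I vI by (intro sum.mono_neutral_right) auto
    ultimately show ?thesis by (simp add: qform_def)
  qed
  also have "\<dots> = qform K P (\<lambda>i. y i - m i)"
    by (intro qform_cong) (simp add: v_def ysI' m)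
  finally show ?thesis by simp
qed

text \<open>By the block decomposition the inner integral over the complement is a translate of one
  fixed Gaussian integral, so it does not depend on the coordinates in \<open>I\<close>. The
  enumeration \<open>h\<close> is there to give the determinant a meaning.\<close>

lemma law_marginal:
  assumes I: "I \<subseteq> {..<n}"
    and inv\<alpha>: "\<And>i k. i \<in> I \<Longrightarrow> k \<in> I \<Longrightarrow> (\<Sum>j\<in>I. b i j * \<alpha> j k) = (if i = k then 1 else 0)"
    and h: "bij_betw h {..<N} I" and D: "D = det (mat N N (\<lambda>(i, j). \<alpha> (h i) (h j)))"
  shows "D > 0"
    and "F \<in> borel_measurable (lborel_PiM I) \<Longrightarrow> (\<integral>\<^sup>+y. F (restrict y I) \<partial>law) =
      (\<integral>\<^sup>+z. F z * ennreal (sqrt (D / (2 * pi) ^ N) * exp (- qform I \<alpha> (\<lambda>i. z i - \<mu> i) / 2)) \<partial>lborel_PiM I)"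
proof -
  have fin: "finite I" using I finite_subset by blast
  define K where "K = {..<n} - I"
  have K: "finite K" "I \<inter> K = {}" "I \<union> K = {..<n}" using I by (auto simp: K_def)
  have \<alpha>s: "\<alpha> i j = \<alpha> j i" if "i \<in> I" "j \<in> I" for i j
    by (rule right_inverse_sym[of I b]) (use fin b_sym I inv\<alpha> that in auto)
  have pd: "pos_def_on I \<alpha>" by (rule pos_def_on_inverse[OF I inv\<alpha>])
  have hI: "h i \<in> I" if "i < N" for i using h that by (auto simp: bij_betw_def)
  have qre: "qform {..<N} (\<lambda>i j. \<alpha> (h i) (h j)) (\<lambda>i. v (h i)) = qform I \<alpha> v" for v
    unfolding qform_def using h by (simp add: sum.reindex_bij_betw[OF h, symmetric])
  have "pos_def_on {..<N} (\<lambda>i j. \<alpha> (h i) (h j))"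
    unfolding pos_def_on_def
  proof (intro allI impI)
    fix v :: "nat \<Rightarrow> real" assume v: "\<exists>i\<in>{..<N}. v i \<noteq> 0"
    define w where "w = (\<lambda>i. v (the_inv_into {..<N} h i))"
    have wh: "w (h i) = v i" if "i < N" for i
      using that h by (simp add: w_def the_inv_into_f_f bij_betw_def)
    from v obtain i where "i < N" "v i \<noteq> 0" by auto
    hence "\<exists>i\<in>I. w i \<noteq> 0" using wh[of i] hI[of i] by (intro bexI[of _ "h i"]) auto
    hence "qform I \<alpha> w > 0" using pd by (simp add: pos_def_on_def)
    also have "qform I \<alpha> w = qform {..<N} (\<lambda>i j. \<alpha> (h i) (h j)) v"
      unfolding qre[symmetric] using wh by (intro qform_cong) auto
    finally show "qform {..<N} (\<lambda>i j. \<alpha> (h i) (h j)) v > 0" .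
  qed
  note gi = nn_integral_gaussian_det[of N "\<lambda>i j. \<alpha> (h i) (h j)", OF _ this, folded D]
  show Dpos: "D > 0" using gi \<alpha>s hI by blast
  have gI: "(\<integral>\<^sup>+z. ennreal (exp (- qform I \<alpha> (\<lambda>i. z i - \<mu> i) / 2)) \<partial>lborel_PiM I) = ennreal (sqrt ((2 * pi) ^ N / D))"
  proof -
    have "(\<integral>\<^sup>+z. ennreal (exp (- qform {..<N} (\<lambda>i j. \<alpha> (h i) (h j)) (\<lambda>k\<in>{..<N}. z (h k) + - \<mu> (h k)) / 2)) \<partial>lborel_PiM I)
      = (\<integral>\<^sup>+y. ennreal (exp (- qform {..<N} (\<lambda>i j. \<alpha> (h i) (h j)) y / 2)) \<partial>lborel_PiM {..<N})"
    proof (rule nn_integral_PiM_affine_reindex[OF fin h, where c = "\<lambda>k. - \<mu> (h k)"])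
      have [measurable]: "(\<lambda>y. qform {..<N} (\<lambda>i j. \<alpha> (h i) (h j)) y) \<in> borel_measurable (lborel_PiM {..<N})"
        by (intro qform_measurable component_measurable)
      show "(\<lambda>y. ennreal (exp (- qform {..<N} (\<lambda>i j. \<alpha> (h i) (h j)) y / 2))) \<in> borel_measurable (lborel_PiM {..<N})"
        by measurable
    qed
    also have "\<dots> = ennreal (sqrt ((2 * pi) ^ N / D))" using gi \<alpha>s hI by blast
    moreover have "qform {..<N} (\<lambda>i j. \<alpha> (h i) (h j)) (\<lambda>k\<in>{..<N}. z (h k) + - \<mu> (h k)) = qform I \<alpha> (\<lambda>i. z i - \<mu> i)" for z
      unfolding qre[symmetric] by (intro qform_cong) simp
    ultimately show ?thesis by simp
  qed
  \<comment> \<open>The common value of all inner integrals. It is not computed directly but found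
    from the total mass below.\<close>
  define \<kappa> where "\<kappa> = ennreal c * (\<integral>\<^sup>+w. ennreal (exp (- qform K P w / 2)) \<partial>lborel_PiM K)"
  have qKm: "(\<lambda>w. qform K P w) \<in> borel_measurable (lborel_PiM K)"
    by (intro qform_measurable component_measurable)
  have key: "(\<integral>\<^sup>+y. F (restrict y I) \<partial>law) =
      (\<integral>\<^sup>+z. F z * ennreal (exp (- qform I \<alpha> (\<lambda>i. z i - \<mu> i) / 2)) \<partial>lborel_PiM I) * \<kappa>"
    if F: "F \<in> borel_measurable (lborel_PiM I)" for F
  proof -
    have Fr: "(\<lambda>y. F (restrict y I)) \<in> borel_measurable (lborel_PiM {..<n})"
      using measurable_comp[OF measurable_restrict_subset[OF I] F] by (simp add: comp_def)
    have "(\<integral>\<^sup>+y. F (restrict y I) \<partial>law) = (\<integral>\<^sup>+y. F (restrict y I) * ennreal (law_density y) \<partial>lborel_PiM (I \<union> K))"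
      unfolding law_def K(3) using Fr by (subst nn_integral_density) (auto simp: mult.commute)
    also have "\<dots> = (\<integral>\<^sup>+z. \<integral>\<^sup>+w. F (restrict (merge I K (z, w)) I) * ennreal (law_density (merge I K (z, w))) \<partial>lborel_PiM K \<partial>lborel_PiM I)"
      using Fr K fin by (intro lborel_product.product_nn_integral_fold) auto
    also have "\<dots> = (\<integral>\<^sup>+z. F z * ennreal (exp (- qform I \<alpha> (\<lambda>i. z i - \<mu> i) / 2)) * \<kappa> \<partial>lborel_PiM I)"
    proof (rule nn_integral_cong)
      fix z assume z: "z \<in> space (lborel_PiM I)"
      define m where "m = (\<lambda>i. \<Sum>k\<in>I. b i k * (\<Sum>l\<in>I. \<alpha> k l * (z l - \<mu> l)))"
      have r: "restrict (merge I K (z, w)) I = z" for w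
        using z by (auto simp: restrict_def merge_def space_PiM PiE_def extensional_def)
      have g: "law_density (merge I K (z, w)) = exp (- qform I \<alpha> (\<lambda>i. z i - \<mu> i) / 2) *
          (c * exp (- qform K P (\<lambda>i\<in>K. w i + - (\<mu> i + m i)) / 2))" for w
      proof -
        let ?y = "\<lambda>i. merge I K (z, w) i - \<mu> i"
        have "(\<Sum>l\<in>I. \<alpha> k l * (z l - \<mu> l)) = (\<Sum>l\<in>I. \<alpha> k l * ?y l)" for k
          by (intro sum.cong) (auto simp: merge_def)
        hence "qform {..<n} P ?y = qform I \<alpha> ?y + qform K P (\<lambda>i. ?y i - m i)"
          using I by (intro qform_block inv\<alpha>) (auto simp: m_def K_def)
        also have "qform I \<alpha> ?y = qform I \<alpha> (\<lambda>i. z i - \<mu> i)" by (intro qform_cong) (simp add: merge_def)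
        also have "qform K P (\<lambda>i. ?y i - m i) = qform K P (\<lambda>i\<in>K. w i + - (\<mu> i + m i))"
          using K by (intro qform_cong) (auto simp: merge_def)
        finally have q: "qform {..<n} P ?y = qform I \<alpha> (\<lambda>i. z i - \<mu> i) + qform K P (\<lambda>i\<in>K. w i + - (\<mu> i + m i))" .
        have "exp (- (s + r) / 2) = exp (- s / 2) * exp (- r / 2)" for s r :: real
          by (simp add: diff_divide_distrib flip: exp_add)
        thus ?thesis unfolding law_density_def q by simp
      qed
      have "(\<integral>\<^sup>+w. F (restrict (merge I K (z, w)) I) * ennreal (law_density (merge I K (z, w))) \<partial>lborel_PiM K)
        = (\<integral>\<^sup>+w. (F z * ennreal (exp (- qform I \<alpha> (\<lambda>i. z i - \<mu> i) / 2)) * ennreal c) * ennreal (exp (- qform K P (\<lambda>i\<in>K. w i + - (\<mu> i + m i)) / 2)) \<partial>lborel_PiM K)"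
        unfolding r g using c_pos by (intro nn_integral_cong) (simp add: ennreal_mult mult_ac)
      also have "\<dots> = (F z * ennreal (exp (- qform I \<alpha> (\<lambda>i. z i - \<mu> i) / 2)) * ennreal c) *
          (\<integral>\<^sup>+w. ennreal (exp (- qform K P (\<lambda>i\<in>K. w i + - (\<mu> i + m i)) / 2)) \<partial>lborel_PiM K)"
      proof (rule nn_integral_cmult)
        have [measurable]: "(\<lambda>w. qform K P (\<lambda>i\<in>K. w i + - (\<mu> i + m i))) \<in> borel_measurable (lborel_PiM K)"
          by (intro qform_measurable) (auto intro!: borel_measurable_diff component_measurable)
        show "(\<lambda>w. ennreal (exp (- qform K P (\<lambda>i\<in>K. w i + - (\<mu> i + m i)) / 2))) \<in> borel_measurable (lborel_PiM K)"
          by measurable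
      qed
      also have "(\<integral>\<^sup>+w. ennreal (exp (- qform K P (\<lambda>i\<in>K. w i + - (\<mu> i + m i)) / 2)) \<partial>lborel_PiM K)
          = (\<integral>\<^sup>+w. ennreal (exp (- qform K P w / 2)) \<partial>lborel_PiM K)"
        by (rule nn_integral_PiM_affine_reindex[OF K(1), where h = "\<lambda>i. i" and c = "\<lambda>i. - (\<mu> i + m i)"])
           (use qKm in \<open>auto simp: bij_betw_def\<close>)
      finally show "(\<integral>\<^sup>+w. F (restrict (merge I K (z, w)) I) * ennreal (law_density (merge I K (z, w))) \<partial>lborel_PiM K)
        = F z * ennreal (exp (- qform I \<alpha> (\<lambda>i. z i - \<mu> i) / 2)) * \<kappa>" by (simp only: \<kappa>_def mult.assoc)
    qed
    also have "\<dots> = (\<integral>\<^sup>+z. F z * ennreal (exp (- qform I \<alpha> (\<lambda>i. z i - \<mu> i) / 2)) \<partial>lborel_PiM I) * \<kappa>"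
    proof (rule nn_integral_multc)
      have [measurable]: "(\<lambda>z. qform I \<alpha> (\<lambda>i. z i - \<mu> i)) \<in> borel_measurable (lborel_PiM I)"
        by (intro qform_measurable borel_measurable_diff component_measurable) auto
      show "(\<lambda>z. F z * ennreal (exp (- qform I \<alpha> (\<lambda>i. z i - \<mu> i) / 2))) \<in> borel_measurable (lborel_PiM I)"
        using F by measurable
    qed
    finally show ?thesis .
  qed
  \<comment> \<open>The constant function 1 is the test function that determines
    \<open>\<kappa>\<close>.\<close>
  have "1 = ennreal (sqrt ((2 * pi) ^ N / D)) * \<kappa>"
  proof -
    have "(\<integral>\<^sup>+y. 1 \<partial>law) = (\<integral>\<^sup>+z. 1 * ennreal (exp (- qform I \<alpha> (\<lambda>i. z i - \<mu> i) / 2)) \<partial>lborel_PiM I) * \<kappa>"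
      by (rule key) simp
    also have "(\<integral>\<^sup>+y. 1 \<partial>law) = 1"
      using prob_space.emeasure_space_1[OF prob_space_law] by simp
    finally show ?thesis unfolding mult_1 gI .
  qed
  moreover have "ennreal (sqrt (D / (2 * pi) ^ N)) * ennreal (sqrt ((2 * pi) ^ N / D)) = 1"
    using Dpos by (simp flip: ennreal_mult real_sqrt_mult)
  ultimately have \<kappa>: "\<kappa> = ennreal (sqrt (D / (2 * pi) ^ N))"
    by (metis mult.assoc mult.left_neutral mult.right_neutral)
  show "(\<integral>\<^sup>+y. F (restrict y I) \<partial>law) =
      (\<integral>\<^sup>+z. F z * ennreal (sqrt (D / (2 * pi) ^ N) * exp (- qform I \<alpha> (\<lambda>i. z i - \<mu> i) / 2)) \<partial>lborel_PiM I)"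
    if F: "F \<in> borel_measurable (lborel_PiM I)"
  proof -
    have [measurable]: "(\<lambda>z. qform I \<alpha> (\<lambda>i. z i - \<mu> i)) \<in> borel_measurable (lborel_PiM I)"
      by (intro qform_measurable borel_measurable_diff component_measurable) auto
    show ?thesis unfolding key[OF F] \<kappa> using F Dpos
      by (subst nn_integral_multc[symmetric]) (auto simp: ennreal_mult mult_ac intro!: nn_integral_cong)
  qed
qed

end

section \<open>The local asymptotics\<close>

lemma sgn_sum_shift: "sgn_sum p J (\<lambda>i. z i + t) = exp t * sgn_sum p J z"
  by (simp add: sgn_sum_def exp_add right_diff_distrib sum_distrib_left mult.commute)

lemma sgn_sum_cong: "z p = z' p \<Longrightarrow> (\<And>j. j \<in> J \<Longrightarrow> z j = z' j) \<Longrightarrow> sgn_sum p J z = sgn_sum p J z'"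
  unfolding sgn_sum_def by (metis (no_types, lifting) sum.cong)

lemma abs_exp_minus_one_le:
  assumes "\<bar>x\<bar> \<le> (1::real)" shows "\<bar>exp x - 1\<bar> \<le> 2 * \<bar>x\<bar>"
proof (cases "x \<ge> 0")
  case True
  hence "exp x \<le> 1 + x + x\<^sup>2" using assms by (intro exp_bound) auto
  moreover have "x\<^sup>2 \<le> x" using True assms by (simp add: power2_eq_square mult_left_le)
  ultimately show ?thesis using True by simp
next
  case False
  moreover from this have "exp x \<le> 1" by simp
  moreover have "1 + x \<le> exp x" by (rule exp_ge_add_one_self)
  ultimately show ?thesis by linarith
qed

context gaussian_law
begin

text \<open>On the active set the dominating direction is constantly 1, since
  \<open>\<alpha>\<close> applied to the all-ones vector is \<open>A\<close>. After marginalising to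
  \<open>I\<close> the level scales out exactly, leaving the Gamma-quotient weight times a Gaussian
  factor free of t.\<close>

lemma law_sgn_sum_asymp:
  fixes A :: "nat \<Rightarrow> real"
  assumes I: "I \<subseteq> {..<n}" "p \<in> I" and J: "J = I - {p}"
    and inv\<alpha>: "\<And>i k. i \<in> I \<Longrightarrow> k \<in> I \<Longrightarrow> (\<Sum>j\<in>I. b i j * \<alpha> j k) = (if i = k then 1 else 0)"
    and A: "\<And>k. k \<in> I \<Longrightarrow> A k = (\<Sum>j\<in>I. \<alpha> k j)"
    and neg: "\<And>j. j \<in> J \<Longrightarrow> A j < 0" and S: "S > 0" "S = (\<Sum>i\<in>I. A i)"
    and h: "bij_betw h {..<N} I" and D: "D = det (mat N N (\<lambda>(i, j). \<alpha> (h i) (h j)))"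
  defines "d1 \<equiv> sqrt D / sqrt (2 * pi) / sqrt (S * (\<Prod>i\<in>I. \<bar>A i\<bar>)) *
       exp (- qform I \<alpha> (\<lambda>i. ln (S / \<bar>A i\<bar>) + \<mu> i) / 2)"
    and "d3 \<equiv> (\<Sum>i\<in>I. A i * (ln (S / \<bar>A i\<bar>) + \<mu> i))"
  shows "(\<lambda>t. measure law {y \<in> space law. sgn_sum p J y > exp t}
      - d1 * t powr (- (1 + real N) / 2) * exp (d3 * t - S * t\<^sup>2 / 2))
    \<in> O(\<lambda>t. d1 * t powr (- (1 + real N) / 2) * exp (d3 * t - S * t\<^sup>2 / 2) * t powr (-1/2))"
proof -
  interpret prob_space law by (rule prob_space_law)
  have fin: "finite I" using I finite_subset by blast
  have IJ: "I = insert p J" "p \<notin> J" "finite J" using I J fin by auto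
  have Ssum: "S = A p + (\<Sum>j\<in>J. A j)" using S IJ by simp
  have Ap: "A p > 0" using S Ssum neg sum_nonpos[of J A] by (force intro: less_imp_le)
  have Ai: "\<bar>A i\<bar> > 0" if "i \<in> I" for i using that Ap neg IJ by fastforce
  have cardI: "card I = N" using h bij_betw_same_card by fastforce
  hence cardJ: "real (card J) = real N - 1" using IJ fin by simp
  have Dpos: "D > 0" by (rule law_marginal(1)[OF I(1) inv\<alpha> h D])
  have \<alpha>s: "\<alpha> i j = \<alpha> j i" if "i \<in> I" "j \<in> I" for i j
    by (rule right_inverse_sym[of I b]) (use fin b_sym I inv\<alpha> that in auto)
  have pd: "pos_def_on I \<alpha>" by (rule pos_def_on_inverse[OF I(1) inv\<alpha>])
  have q0: "qform I \<alpha> v \<ge> 0" for v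
  proof (cases "\<exists>i\<in>I. v i \<noteq> 0")
    case True thus ?thesis using pd unfolding pos_def_on_def by (metis less_imp_le)
  next
    case False thus ?thesis by (simp add: qform_def)
  qed
  define zs where "zs = (\<lambda>i. ln (\<bar>A i\<bar> / S))"
  define E where "E = (\<lambda>z. exp (- qform I \<alpha> (\<lambda>i. z i - \<mu> i) / 2))"
  define W where "W = (\<lambda>t z. exp (- (\<Sum>j\<in>I. t * A j * z j)) * indicator {z. sgn_sum p J z > 1} z)"
  define G where "G = (\<lambda>t. gamma_quot p J (\<lambda>j. t * A j))"
  define cI where "cI = sqrt (D / (2 * pi) ^ N)"
  have cI: "cI > 0" using Dpos by (simp add: cI_def)
  have [measurable]: "(\<lambda>z. qform I \<alpha> (\<lambda>i. z i - \<mu> i)) \<in> borel_measurable (lborel_PiM I)"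
    by (intro qform_measurable borel_measurable_diff component_measurable) auto
  have Em [measurable]: "E \<in> borel_measurable (lborel_PiM I)" unfolding E_def by measurable
  have sm [measurable]: "sgn_sum p J \<in> borel_measurable (lborel_PiM I)"
    unfolding IJ(1) by (rule sgn_sum_measurable) auto
  have smn [measurable]: "sgn_sum p J \<in> borel_measurable (lborel_PiM {..<n})"
    using I IJ by (intro sgn_sum_measurable) auto
  have H: "ennreal (measure law {y \<in> space law. sgn_sum p J y > exp t}) =
      ennreal (cI * exp (- t\<^sup>2 * S / 2 + t * (\<Sum>i\<in>I. A i * \<mu> i))) * (\<integral>\<^sup>+z. ennreal (E z * W t z) \<partial>lborel_PiM I)" for t
  proof -
    let ?F = "\<lambda>z. indicator {z. sgn_sum p J z > exp t} z :: ennreal"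
    have Fm: "?F \<in> borel_measurable (lborel_PiM I)" by measurable
    have "ennreal (measure law {y \<in> space law. sgn_sum p J y > exp t}) = (\<integral>\<^sup>+y. ?F (restrict y I) \<partial>law)"
    proof -
      have "sgn_sum p J (restrict y I) = sgn_sum p J y" for y
        using IJ by (intro sgn_sum_cong) auto
      hence "(\<integral>\<^sup>+y. ?F (restrict y I) \<partial>law) = (\<integral>\<^sup>+y. indicator {y \<in> space law. sgn_sum p J y > exp t} y \<partial>law)"
        by (intro nn_integral_cong) (auto simp: indicator_def)
      also have "\<dots> = emeasure law {y \<in> space law. sgn_sum p J y > exp t}"
        by (rule nn_integral_indicator) simp
      finally show ?thesis by (simp add: emeasure_eq_measure)
    qed
    also have "\<dots> = (\<integral>\<^sup>+z. ?F z * ennreal (cI * E z) \<partial>lborel_PiM I)"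
      unfolding cI_def E_def by (rule law_marginal(2)[OF I(1) inv\<alpha> h D Fm])
    \<comment> \<open>Shifting every active coordinate by t multiplies \<open>sgn_sum\<close> by exp
      t, which turns the level exp t into 1.\<close>
    also have "\<dots> = (\<integral>\<^sup>+z. ?F (\<lambda>i\<in>I. z i + t) * ennreal (cI * E (\<lambda>i\<in>I. z i + t)) \<partial>lborel_PiM I)"
      by (rule nn_integral_PiM_affine_reindex[OF fin, where h = "\<lambda>i. i" and c = "\<lambda>i. t", symmetric]) (auto simp: bij_betw_def)
    also have "\<dots> = (\<integral>\<^sup>+z. ennreal (cI * exp (- t\<^sup>2 * S / 2 + t * (\<Sum>i\<in>I. A i * \<mu> i))) * ennreal (E z * W t z) \<partial>lborel_PiM I)"
    proof (rule nn_integral_cong)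
      fix z
      have "sgn_sum p J (\<lambda>i\<in>I. z i + t) = sgn_sum p J (\<lambda>i. z i + t)"
        using IJ by (intro sgn_sum_cong) auto
      hence s: "sgn_sum p J (\<lambda>i\<in>I. z i + t) > exp t \<longleftrightarrow> sgn_sum p J z > 1"
        by (simp add: sgn_sum_shift)
      have "qform I \<alpha> (\<lambda>i. (\<lambda>i\<in>I. z i + t) i - \<mu> i) = qform I \<alpha> (\<lambda>i. t * 1 + (z i - \<mu> i))"
        by (intro qform_cong) simp
      also have "\<dots> = t\<^sup>2 * qform I \<alpha> (\<lambda>_. 1) + 2 * t * bform I \<alpha> (\<lambda>_. 1) (\<lambda>i. z i - \<mu> i) + qform I \<alpha> (\<lambda>i. z i - \<mu> i)"
        by (subst qform_add, rule \<alpha>s, assumption, assumption) simp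
      also have "bform I \<alpha> (\<lambda>_. 1) (\<lambda>i. z i - \<mu> i) = (\<Sum>i\<in>I. A i * (z i - \<mu> i))"
        by (rule bform_eq_inner, rule \<alpha>s, assumption, assumption) (simp add: A)
      also have "qform I \<alpha> (\<lambda>_. 1) = S" unfolding qform_def S using A by simp
      finally have "E (\<lambda>i\<in>I. z i + t) = exp (- t\<^sup>2 * S / 2 - t * (\<Sum>i\<in>I. A i * (z i - \<mu> i))) * E z"
        unfolding E_def by (simp add: add_divide_distrib flip: exp_add)
      also have "- t\<^sup>2 * S / 2 - t * (\<Sum>i\<in>I. A i * (z i - \<mu> i)) =
          - t\<^sup>2 * S / 2 + t * (\<Sum>i\<in>I. A i * \<mu> i) + - (\<Sum>j\<in>I. t * A j * z j)"
        by (simp add: right_diff_distrib sum_subtractf sum_distrib_left mult.assoc)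
      finally have "E (\<lambda>i\<in>I. z i + t) = exp (- t\<^sup>2 * S / 2 + t * (\<Sum>i\<in>I. A i * \<mu> i)) * (E z * exp (- (\<Sum>j\<in>I. t * A j * z j)))"
        by (simp only: exp_add mult_ac)
      moreover have "E z > 0" by (simp add: E_def)
      ultimately show "?F (\<lambda>i\<in>I. z i + t) * ennreal (cI * E (\<lambda>i\<in>I. z i + t)) =
        ennreal (cI * exp (- t\<^sup>2 * S / 2 + t * (\<Sum>i\<in>I. A i * \<mu> i))) * ennreal (E z * W t z)"
        using cI s by (auto simp: W_def indicator_def mult_ac simp flip: ennreal_mult)
    qed
    also have "\<dots> = ennreal (cI * exp (- t\<^sup>2 * S / 2 + t * (\<Sum>i\<in>I. A i * \<mu> i))) * (\<integral>\<^sup>+z. ennreal (E z * W t z) \<partial>lborel_PiM I)"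
    proof (rule nn_integral_cmult)
      have [measurable]: "(\<lambda>z. z j) \<in> borel_measurable (lborel_PiM I)" if "j \<in> I" for j
        using component_measurable[OF that] .
      show "(\<lambda>z. ennreal (E z * W t z)) \<in> borel_measurable (lborel_PiM I)"
        unfolding W_def by measurable
    qed
    finally show ?thesis .
  qed
  obtain K where K: "K \<ge> 0" "\<And>z. \<bar>E z - E zs\<bar> \<le> K * (\<Sum>i\<in>I. \<bar>z i - zs i\<bar> + (z i - zs i)\<^sup>2)"
    unfolding E_def by (rule exp_qform_lipschitz[of I \<alpha> \<mu> zs]) (use fin \<alpha>s q0 in auto)
  have Em': "E \<in> borel_measurable (lborel_PiM (insert p J))" using Em by (simp only: IJ(1))
  obtain C where C: "C \<ge> 0" and conc: "eventually (\<lambda>t. integrable (lborel_PiM I) (\<lambda>z. E z * W t z) \<and>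
      \<bar>(\<integral>z. E z * W t z \<partial>lborel_PiM I) - E zs * G t\<bar> \<le> C * t powr (-1/2) * G t) at_top"
  proof (rule gamma_quot_concentration[OF IJ(3,2) neg S(1) Ssum Em' _ K(1)])
    show "\<bar>E z - E zs\<bar> \<le> K * (\<Sum>i\<in>insert p J. \<bar>z i - ln (\<bar>A i\<bar> / S)\<bar> + (z i - ln (\<bar>A i\<bar> / S))\<^sup>2)" for z
      using K(2)[of z] by (simp only: zs_def IJ(1))
  qed (use that in \<open>auto simp: W_def G_def mult.assoc simp flip: IJ(1)\<close>)
  define Gh where "Gh = (\<lambda>t. (2 * pi) powr (card J / 2) * t powr (- (real (card J) + 2) / 2)
       / sqrt (S * (\<Prod>i\<in>I. \<bar>A i\<bar>)) * exp (- t * (\<Sum>i\<in>I. A i * ln (\<bar>A i\<bar> / S))))"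
  define K2 where "K2 = 1 / (4 * S) + (\<Sum>i\<in>I. 1 / (4 * \<bar>A i\<bar>))"
  have K2: "K2 \<ge> 0" unfolding K2_def using S by (intro add_nonneg_nonneg sum_nonneg) auto
  have Prpos: "(\<Prod>i\<in>I. \<bar>A i\<bar>) > 0" using Ai by (intro prod_pos)
  define T where "T = (\<lambda>t. d1 * t powr (- (1 + real N) / 2) * exp (d3 * t - S * t\<^sup>2 / 2))"
  \<comment> \<open>The leading term is matched exactly, for every positive t.
    \<open>ln (S / \<bar>A i\<bar>)\<close> is minus the centre \<open>zs i\<close>; the sign drops
    out of the quadratic form and is reversed in the logarithmic sum of \<open>d3\<close>.\<close>
  have TG: "T t = cI * exp (- t\<^sup>2 * S / 2 + t * (\<Sum>i\<in>I. A i * \<mu> i)) * (E zs * Gh t)" if "t > 0" for t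
  proof -
    have lnn: "ln (S / \<bar>A i\<bar>) = - ln (\<bar>A i\<bar> / S)" if "i \<in> I" for i
      using Ai[OF that] S by (simp add: ln_div)
    have "qform I \<alpha> (\<lambda>i. ln (S / \<bar>A i\<bar>) + \<mu> i) = qform I \<alpha> (\<lambda>i. - 1 * (zs i - \<mu> i) + 0)"
      using lnn by (intro qform_cong) (simp add: zs_def)
    also have "\<dots> = qform I \<alpha> (\<lambda>i. zs i - \<mu> i)"
      unfolding qform_def by (intro sum.cong refl) (simp add: algebra_simps)
    finally have e1: "exp (- qform I \<alpha> (\<lambda>i. ln (S / \<bar>A i\<bar>) + \<mu> i) / 2) = E zs" by (simp add: E_def)
    have e2: "d3 = (\<Sum>i\<in>I. A i * \<mu> i) - (\<Sum>i\<in>I. A i * ln (\<bar>A i\<bar> / S))"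
      unfolding d3_def sum_subtractf[symmetric] using lnn by (intro sum.cong) (auto simp: algebra_simps)
    have e3: "sqrt D / sqrt (2 * pi) = cI * (2 * pi) powr (card J / 2)"
    proof -
      have "(2 * pi) ^ N = (2 * pi) powr real N" by (simp add: powr_realpow)
      hence "sqrt ((2 * pi) ^ N) = (2 * pi) powr (real N / 2)"
        by (simp add: powr_half_sqrt[symmetric] powr_powr)
      also have "\<dots> = (2 * pi) powr (1/2) * (2 * pi) powr (card J / 2)"
        unfolding cardJ by (simp flip: powr_add add: diff_divide_distrib)
      also have "(2 * pi) powr (1/2) = sqrt (2 * pi)" by (simp add: powr_half_sqrt)
      finally have "cI = sqrt D / (sqrt (2 * pi) * (2 * pi) powr (card J / 2))"
        by (simp add: cI_def real_sqrt_divide)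
      thus ?thesis by simp
    qed
    have e4: "- (1 + real N) / 2 = - (real (card J) + 2) / 2" by (simp add: cardJ)
    have e5: "exp (d3 * t - S * t\<^sup>2 / 2) = exp (- t\<^sup>2 * S / 2 + t * (\<Sum>i\<in>I. A i * \<mu> i)) * exp (- t * (\<Sum>i\<in>I. A i * ln (\<bar>A i\<bar> / S)))"
      unfolding e2 by (simp add: algebra_simps flip: exp_add)
    show ?thesis unfolding T_def d1_def e1 e3 e4 e5 Gh_def by simp
  qed
  have "eventually (\<lambda>t. norm (measure law {y \<in> space law. sgn_sum p J y > exp t} - T t)
      \<le> (3 * C / E zs + 2 * K2) * norm (T t * t powr (-1/2))) at_top"
    using conc eventually_ge_at_top[of 1] eventually_ge_at_top[of "K2"]
  proof eventually_elim
    case (elim t)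
    define X where "X = (\<integral>z. E z * W t z \<partial>lborel_PiM I)"
    define e where "e = cI * exp (- t\<^sup>2 * S / 2 + t * (\<Sum>i\<in>I. A i * \<mu> i))"
    have e0: "e > 0" using cI by (simp add: e_def)
    have Ez: "E zs > 0" by (simp add: E_def)
    have EW: "E z * W t z \<ge> 0" for z by (simp add: E_def W_def)
    have X0: "X \<ge> 0" unfolding X_def using EW by (intro integral_nonneg_AE) auto
    have "(\<integral>\<^sup>+z. ennreal (E z * W t z) \<partial>lborel_PiM I) = ennreal X"
      unfolding X_def using elim EW by (intro nn_integral_eq_integral) auto
    hence "ennreal (measure law {y \<in> space law. sgn_sum p J y > exp t}) = ennreal (e * X)"
      using H[of t] e0 by (simp add: e_def ennreal_mult X0)
    hence Hx: "measure law {y \<in> space law. sgn_sum p J y > exp t} = e * X"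
      using e0 X0 by (subst (asm) ennreal_inj) auto
    obtain \<rho> where \<rho>: "\<bar>\<rho>\<bar> \<le> K2 / t" "G t = Gh t * exp \<rho>"
      unfolding K2_def G_def Gh_def IJ(1)
      by (rule gamma_quot_stirling[OF IJ(3,2) neg S(1) Ssum, of t]) (use elim in \<open>auto simp flip: IJ(1)\<close>)
    have Gh0: "Gh t > 0" unfolding Gh_def using S Prpos elim by (intro mult_pos_pos divide_pos_pos) auto
    \<comment> \<open>For t \<ge> \<open>K2\<close> the Stirling remainder has modulus at most 1,
      where \<open>abs_exp_minus_one_le\<close> applies; this yields the factors 2 and 3 in the
      error constant.\<close>
    have "K2 / t \<le> 1" using elim by simp
    hence \<rho>1: "\<bar>\<rho>\<bar> \<le> 1" using \<rho> by linarith
    have th: "1 / t \<le> t powr (-1/2)" using elim powr_mono[of "-1" "-1/2" t] by (simp add: powr_minus_divide)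
    have "G t - Gh t = Gh t * (exp \<rho> - 1)" by (simp add: \<rho>(2) right_diff_distrib)
    hence "\<bar>G t - Gh t\<bar> = Gh t * \<bar>exp \<rho> - 1\<bar>" using Gh0 by (simp add: abs_mult)
    also have "\<dots> \<le> Gh t * (2 * (K2 * t powr (-1/2)))"
    proof (rule mult_left_mono)
      have "K2 / t \<le> K2 * t powr (-1/2)" using mult_left_mono[OF th K2] by simp
      thus "\<bar>exp \<rho> - 1\<bar> \<le> 2 * (K2 * t powr (-1/2))"
        using abs_exp_minus_one_le[OF \<rho>1] \<rho>(1) by linarith
    qed (use Gh0 in simp)
    finally have GG: "\<bar>G t - Gh t\<bar> \<le> 2 * K2 * t powr (-1/2) * Gh t" by (simp add: mult_ac)
    have "exp \<rho> \<le> 3" using abs_exp_minus_one_le[OF \<rho>1] \<rho>1 by linarith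
    hence G2: "G t \<le> 3 * Gh t" unfolding \<rho>(2) using Gh0 by simp
    have "\<bar>X - E zs * Gh t\<bar> \<le> \<bar>X - E zs * G t\<bar> + E zs * \<bar>G t - Gh t\<bar>"
    proof -
      have "X - E zs * Gh t = (X - E zs * G t) + E zs * (G t - Gh t)" by (simp add: algebra_simps)
      thus ?thesis using abs_triangle_ineq[of "X - E zs * G t" "E zs * (G t - Gh t)"] Ez by (simp add: abs_mult)
    qed
    also have "\<dots> \<le> C * t powr (-1/2) * (3 * Gh t) + E zs * (2 * K2 * t powr (-1/2) * Gh t)"
    proof (rule add_mono)
      have "\<bar>X - E zs * G t\<bar> \<le> C * t powr (-1/2) * G t" using elim by (simp add: X_def)
      also have "\<dots> \<le> C * t powr (-1/2) * (3 * Gh t)" using G2 C by (intro mult_left_mono) auto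
      finally show "\<bar>X - E zs * G t\<bar> \<le> C * t powr (-1/2) * (3 * Gh t)" .
      show "E zs * \<bar>G t - Gh t\<bar> \<le> E zs * (2 * K2 * t powr (-1/2) * Gh t)" using GG Ez by (intro mult_left_mono) auto
    qed
    also have "\<dots> = (3 * C / E zs + 2 * K2) * (E zs * Gh t * t powr (-1/2))"
      using Ez by (simp add: field_simps)
    finally have "e * \<bar>X - E zs * Gh t\<bar> \<le> e * ((3 * C / E zs + 2 * K2) * (E zs * Gh t * t powr (-1/2)))"
      using e0 by (intro mult_left_mono) auto
    moreover have Tt: "T t = e * (E zs * Gh t)" using TG[of t] elim by (simp add: e_def)
    moreover have "e * X - T t = e * (X - E zs * Gh t)" unfolding Tt by (simp add: right_diff_distrib)
    hence "norm (e * X - T t) = e * \<bar>X - E zs * Gh t\<bar>" using e0 by (simp add: abs_mult)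
    moreover have "norm (T t * t powr (-1/2)) = e * (E zs * Gh t * t powr (-1/2))"
      unfolding Tt using e0 Ez Gh0 by (simp add: abs_mult mult.assoc)
    moreover have "e * (k * y) = k * (e * y)" for k y :: real by simp
    ultimately show ?case unfolding Hx by metis
  qed
  thus ?thesis unfolding T_def by (rule bigoI)
qed

end

section \<open>Localisation of the exceedance event\<close>

lemma exp_neg_square_bigo:
  fixes c C a b :: real
  assumes "c > 0"
  shows "(\<lambda>t. exp (C * t - c * t\<^sup>2)) \<in> O(\<lambda>t. t powr a * exp (b * t))"
proof -
  have "(\<lambda>t. exp ((C - b) * t - c * t\<^sup>2)) \<in> O(\<lambda>t. t powr a)"
    using assms by real_asymp
  from landau_o.big.mult_right[OF this, of "\<lambda>t. exp (b * t)"] show ?thesis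
    by (simp add: left_diff_distrib flip: exp_add)
qed

text \<open>The shape of the main term in t = ln x: \<open>S\<close> is the reciprocal of the paired
  variance parameter \<open>delta4\<close>, \<open>a\<close> the power of ln x and \<open>b\<close>
  the power of x.\<close>

definition gtail :: "real \<Rightarrow> real \<Rightarrow> real \<Rightarrow> real \<Rightarrow> real" where
  "gtail S a b t = t powr a * exp (b * t - S * t\<^sup>2 / 2)"

text \<open>Moving t by 1 / t^2 changes \<open>S * t\<^sup>2 / 2\<close> by about S / t and hence
  the tail by a factor 1 + O(1 / t), within the allowed relative error.\<close>

lemma gtail_perturb:
  assumes S: "S > 0" and f: "(\<lambda>t. f t - gtail S a b t) \<in> O(\<lambda>t. gtail S a b t * t powr (-1/2))"
  shows "(\<lambda>t. f (t + 1 / t\<^sup>2) - gtail S a b t) \<in> O(\<lambda>t. gtail S a b t * t powr (-1/2))"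
    and "(\<lambda>t. f (t - 1 / t\<^sup>2) - gtail S a b t) \<in> O(\<lambda>t. gtail S a b t * t powr (-1/2))"
proof -
  have *: "(\<lambda>t. f (g t) - gtail S a b t) \<in> O(\<lambda>t. gtail S a b t * t powr (-1/2))"
    if g: "filterlim g at_top at_top"
      and 1: "(\<lambda>t. gtail S a b (g t) - gtail S a b t) \<in> O(\<lambda>t. gtail S a b t * t powr (-1/2))"
      and 2: "(\<lambda>t. gtail S a b (g t) * g t powr (-1/2)) \<in> O(\<lambda>t. gtail S a b t * t powr (-1/2))" for g
  proof -
    have "(\<lambda>t. f (g t) - gtail S a b (g t)) \<in> O(\<lambda>t. gtail S a b (g t) * g t powr (-1/2))"
      by (rule landau_o.big.compose[OF f g])
    from sum_in_bigo(1)[OF landau_o.big_trans[OF this 2] 1] show ?thesis by simp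
  qed
  show "(\<lambda>t. f (t + 1 / t\<^sup>2) - gtail S a b t) \<in> O(\<lambda>t. gtail S a b t * t powr (-1/2))"
    unfolding gtail_def by (rule *[unfolded gtail_def]) (use S in real_asymp)+
  show "(\<lambda>t. f (t - 1 / t\<^sup>2) - gtail S a b t) \<in> O(\<lambda>t. gtail S a b t * t powr (-1/2))"
    unfolding gtail_def by (rule *[unfolded gtail_def]) (use S in real_asymp)+
qed

text \<open>A quadratic loss in the exponent beats every linear term and every power of t.\<close>

lemma gauss_tail_negligible:
  assumes "c > (0::real)"
  shows "(\<lambda>t. K * exp (C * t - S * t\<^sup>2 / 2 - c * t\<^sup>2)) \<in> O(\<lambda>t. gtail S a b t * t powr (-1/2))"
proof -
  have "(\<lambda>t. exp (C * t - c * t\<^sup>2)) \<in> O(\<lambda>t. t powr (a - 1/2) * exp (b * t))"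
    by (rule exp_neg_square_bigo[OF assms])
  hence "(\<lambda>t. exp (C * t - c * t\<^sup>2) * exp (- S * t\<^sup>2 / 2)) \<in> O(\<lambda>t. t powr (a - 1/2) * exp (b * t) * exp (- S * t\<^sup>2 / 2))"
    by (rule landau_o.big.mult_right)
  from landau_o.big.mult[OF _ this, of "\<lambda>_. K" "\<lambda>_. 1"]
  have "(\<lambda>t. K * (exp (C * t - c * t\<^sup>2) * exp (- S * t\<^sup>2 / 2))) \<in> O(\<lambda>t. 1 * (t powr (a - 1/2) * exp (b * t) * exp (- S * t\<^sup>2 / 2)))"
    by simp
  hence "(\<lambda>t. K * (exp (C * t - c * t\<^sup>2) * exp (- S * t\<^sup>2 / 2))) \<in> O(\<lambda>t. t powr (a - 1/2) * exp (b * t) * exp (- S * t\<^sup>2 / 2))"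
    by simp
  also have "(\<lambda>t. K * (exp (C * t - c * t\<^sup>2) * exp (- S * t\<^sup>2 / 2))) = (\<lambda>t. K * exp (C * t - S * t\<^sup>2 / 2 - c * t\<^sup>2))"
    by (simp add: algebra_simps flip: exp_add)
  also have "(\<lambda>t. t powr (a - 1/2) * exp (b * t) * exp (- S * t\<^sup>2 / 2)) = (\<lambda>t. gtail S a b t * t powr (-1/2))"
  proof
    fix t :: real
    have "t powr (a - 1/2) = t powr a * t powr (-1/2)" by (simp flip: powr_add)
    moreover have "exp (b * t - S * t\<^sup>2 / 2) = exp (b * t) * exp (- S * t\<^sup>2 / 2)" by (simp flip: exp_add)
    ultimately show "t powr (a - 1/2) * exp (b * t) * exp (- S * t\<^sup>2 / 2) = gtail S a b t * t powr (-1/2)"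
      by (simp add: gtail_def)
  qed
  finally show ?thesis .
qed

text \<open>exp t and exp (t - 1 / t^2) differ by about exp t / t^2, which outweighs any multiple of
  \<open>exp ((1 - \<epsilon>) * t)\<close>. Summands of the latter order can thus be absorbed by a
  level shift that \<open>gtail_perturb\<close> tolerates.\<close>

lemma exp_gap_eventually:
  fixes \<epsilon> k :: real
  assumes "\<epsilon> > 0"
  shows "eventually (\<lambda>t. exp t - k * exp ((1 - \<epsilon>) * t) > exp (t - 1 / t\<^sup>2)) at_top"
    and "eventually (\<lambda>t. exp (t + 1 / t\<^sup>2) - k * exp ((1 - \<epsilon>) * t) > exp t) at_top"
proof -
  have "eventually (\<lambda>t. 1 - k * exp (- (\<epsilon> * t)) > exp (- 1 / t\<^sup>2)) at_top"
    using assms by real_asymp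
  thus "eventually (\<lambda>t. exp t - k * exp ((1 - \<epsilon>) * t) > exp (t - 1 / t\<^sup>2)) at_top"
  proof eventually_elim
    case (elim t)
    from mult_strict_left_mono[OF this, of "exp t"] show ?case
      by (simp add: algebra_simps exp_diff exp_minus divide_inverse flip: exp_add)
  qed
  have "eventually (\<lambda>t. exp (1 / t\<^sup>2) - k * exp (- (\<epsilon> * t)) > 1) at_top"
    using assms by real_asymp
  thus "eventually (\<lambda>t. exp (t + 1 / t\<^sup>2) - k * exp ((1 - \<epsilon>) * t) > exp t) at_top"
  proof eventually_elim
    case (elim t)
    from mult_strict_left_mono[OF this, of "exp t"] show ?case
      by (simp add: algebra_simps exp_diff exp_minus divide_inverse flip: exp_add)
  qed
qed

lemma bigo_sandwich:
  fixes f g h r T B :: "real \<Rightarrow> real"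
  assumes "(\<lambda>t. h t - T t) \<in> O(B)" "(\<lambda>t. g t - T t) \<in> O(B)" "r \<in> O(B)"
    and "eventually (\<lambda>t. f t \<le> h t) at_top" "eventually (\<lambda>t. g t - r t \<le> f t) at_top"
  shows "(\<lambda>t. f t - T t) \<in> O(B)"
proof (rule landau_o.big_trans)
  show "(\<lambda>t. f t - T t) \<in> O(\<lambda>t. \<bar>h t - T t\<bar> + \<bar>g t - T t\<bar> + \<bar>r t\<bar>)"
    by (rule bigoI[of _ 1], use assms(4,5) in eventually_elim) auto
  show "(\<lambda>t. \<bar>h t - T t\<bar> + \<bar>g t - T t\<bar> + \<bar>r t\<bar>) \<in> O(B)"
    using assms(1-3) by (intro sum_in_bigo) (simp_all add: landau_o.big.abs_in_iff)
qed

section \<open>Half-space bounds and the exceedance event\<close>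

context gaussian_law
begin

text \<open>The radius grows linearly in t, so that leaving the neighbourhood of
  \<open>t * ys\<close> costs a factor with a negative multiple of t^2 in the exponent.\<close>

definition tube :: "(nat \<Rightarrow> real) \<Rightarrow> real \<Rightarrow> real \<Rightarrow> (nat \<Rightarrow> real) set" where
  "tube ys \<epsilon> t = {y \<in> space law. \<forall>i<n. \<bar>y i - t * ys i\<bar> < \<epsilon> * t}"

definition exceed :: "nat \<Rightarrow> real \<Rightarrow> (nat \<Rightarrow> real) set" where
  "exceed m t = {y \<in> space law. Xm m n y \<ge> exp t}"

lemma component_measurable_law [measurable]: "i < n \<Longrightarrow> (\<lambda>y. y i) \<in> borel_measurable law"
  using component_measurable[of i "{..<n}"] measurable_cong_sets[OF sets_law refl] by blast

lemma tube_sets [measurable]: "tube ys \<epsilon> t \<in> sets law"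
proof -
  have "tube ys \<epsilon> t = space law \<inter> (\<Inter>i\<in>{..<n}. {y \<in> space law. \<bar>y i - t * ys i\<bar> < \<epsilon> * t})"
    by (auto simp: tube_def)
  moreover have "{y \<in> space law. \<bar>y i - t * ys i\<bar> < \<epsilon> * t} \<in> sets law" if "i < n" for i
    using component_measurable_law[OF that] by measurable
  ultimately show ?thesis
    by (cases "n = 0") (auto intro!: sets.Int sets.finite_INT)
qed

lemmas [simp] = tube_sets[simplified]

lemma exceed_sets [measurable]:
  assumes "m \<le> n" shows "exceed m t \<in> sets law"
proof -
  have "(\<lambda>y. Xm m n y) \<in> borel_measurable law"
  proof -
    have "(\<lambda>y. exp (y i)) \<in> borel_measurable law" if "i < n" for i
      using component_measurable_law[OF that] by measurable
    thus ?thesis unfolding Xm_def using assms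
      by (intro borel_measurable_diff borel_measurable_sum) auto
  qed
  thus ?thesis unfolding exceed_def by measurable
qed

text \<open>A point outside the tube is the shift of a point having some coordinate of modulus at
  least \<open>\<epsilon> * t\<close>, so the retained probability in \<open>law_shift_bound\<close>
  is a Gaussian tail; this gives \<open>q = d * \<epsilon>\<^sup>2\<close>.\<close>

lemma half_space_far:
  assumes ys: "\<And>i. i < n \<Longrightarrow> ys i = (\<Sum>j<n. b i j * u j)" and S: "S = (\<Sum>i<n. u i * ys i)"
    and \<epsilon>: "\<epsilon> > 0"
  obtains K C q where "q > 0"
    "\<And>F t. F \<in> sets law \<Longrightarrow> t \<ge> 0 \<Longrightarrow> (\<And>y. y \<in> F \<Longrightarrow> (\<Sum>i<n. u i * y i) \<ge> t * S - C0) \<Longrightarrow>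
        (\<And>y. y \<in> F \<Longrightarrow> y \<notin> tube ys \<epsilon> t) \<Longrightarrow> measure law F \<le> K * exp (C * t - S * t\<^sup>2 / 2 - q * t\<^sup>2)"
proof -
  interpret prob_space law by (rule prob_space_law)
  obtain K d where K: "K \<ge> 0" "d > 0"
    "\<And>r. r \<ge> 0 \<Longrightarrow> measure law {y \<in> space law. \<exists>i<n. \<bar>y i\<bar> \<ge> r} \<le> K * exp (- d * r\<^sup>2)"
    using law_tail by blast
  define C where "C = C0 + (\<Sum>i<n. u i * \<mu> i)"
  show ?thesis
  proof (rule that[of "d * \<epsilon>\<^sup>2" K C])
    show "d * \<epsilon>\<^sup>2 > 0" using K \<epsilon> by simp
    fix F and t :: real assume F: "F \<in> sets law" "t \<ge> 0" "\<And>y. y \<in> F \<Longrightarrow> (\<Sum>i<n. u i * y i) \<ge> t * S - C0" "\<And>y. y \<in> F \<Longrightarrow> y \<notin> tube ys \<epsilon> t"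
    have tailm: "{y \<in> space law. \<exists>i<n. \<bar>y i\<bar> \<ge> \<epsilon> * t} \<in> sets law"
    proof -
      have "{y \<in> space law. \<exists>i<n. \<bar>y i\<bar> \<ge> \<epsilon> * t} = (\<Union>i\<in>{..<n}. {y \<in> space law. \<bar>y i\<bar> \<ge> \<epsilon> * t})" by auto
      moreover have "{y \<in> space law. \<bar>y i\<bar> \<ge> \<epsilon> * t} \<in> sets law" if "i < n" for i
        using component_measurable_law[OF that] by measurable
      ultimately show ?thesis by (auto intro!: sets.finite_UN)
    qed
    have "measure law F \<le> exp (- t\<^sup>2 * S / 2 + t * C) * measure law {z \<in> space law. (\<lambda>i\<in>{..<n}. z i + t * ys i) \<in> F}"
      unfolding C_def by (rule law_shift_bound[OF ys S F(1-3)])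
    also have "\<dots> \<le> exp (- t\<^sup>2 * S / 2 + t * C) * (K * exp (- d * (\<epsilon> * t)\<^sup>2))"
    proof (rule mult_left_mono)
      have "measure law {z \<in> space law. (\<lambda>i\<in>{..<n}. z i + t * ys i) \<in> F} \<le> measure law {y \<in> space law. \<exists>i<n. \<bar>y i\<bar> \<ge> \<epsilon> * t}"
      proof (rule finite_measure_mono[OF _ tailm])
        show "{z \<in> space law. (\<lambda>i\<in>{..<n}. z i + t * ys i) \<in> F} \<subseteq> {y \<in> space law. \<exists>i<n. \<bar>y i\<bar> \<ge> \<epsilon> * t}"
        proof safe
          fix z assume z: "(\<lambda>i\<in>{..<n}. z i + t * ys i) \<in> F"
          hence "(\<lambda>i\<in>{..<n}. z i + t * ys i) \<in> space law" using F(1) sets.sets_into_space by blast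
          with F(4)[OF z] show "\<exists>i<n. \<epsilon> * t \<le> \<bar>z i\<bar>" by (auto simp: tube_def not_less)
        qed
      qed
      also have "\<dots> \<le> K * exp (- d * (\<epsilon> * t)\<^sup>2)" using K \<epsilon> F by simp
      finally show "measure law {z \<in> space law. (\<lambda>i\<in>{..<n}. z i + t * ys i) \<in> F} \<le> K * exp (- d * (\<epsilon> * t)\<^sup>2)" .
    qed simp
    also have "\<dots> = K * exp (C * t - S * t\<^sup>2 / 2 - d * \<epsilon>\<^sup>2 * t\<^sup>2)"
      by (simp add: power_mult_distrib mult_ac flip: exp_add)
    finally show "measure law F \<le> K * exp (C * t - S * t\<^sup>2 / 2 - d * \<epsilon>\<^sup>2 * t\<^sup>2)" .
  qed
qed

text \<open>The crude estimate, enough for indices whose S exceeds the minimum: there the larger S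
  itself provides the decay.\<close>

lemma half_space_bound:
  assumes ys: "\<And>i. i < n \<Longrightarrow> ys i = (\<Sum>j<n. b i j * u j)" and S: "S = (\<Sum>i<n. u i * ys i)"
    and F: "F \<in> sets law" and t: "t \<ge> 0" and half: "\<And>y. y \<in> F \<Longrightarrow> (\<Sum>i<n. u i * y i) \<ge> t * S - C"
  shows "measure law F \<le> exp ((C + (\<Sum>i<n. u i * \<mu> i)) * t - S * t\<^sup>2 / 2)"
proof -
  interpret prob_space law by (rule prob_space_law)
  have "measure law F \<le> exp (- t\<^sup>2 * S / 2 + t * (C + (\<Sum>i<n. u i * \<mu> i))) * 1"
    by (rule order_trans[OF law_shift_bound[OF ys S F t half]]) (auto intro!: mult_left_mono)
  thus ?thesis by (simp add: algebra_simps)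
qed

text \<open>If coordinate p is the largest positive one, m exp (y p) dominates exp t and every
  negative term. So y p is at least t - ln m and no negative coordinate exceeds y p + ln m; the
  signs of \<open>u\<close> turn this into a loss of a constant multiple of ln m.\<close>

lemma dominating_half_space:
  assumes m: "m \<le> n" "p < m" and y: "Xm m n y \<ge> exp t" and mx: "\<And>i. i < m \<Longrightarrow> y i \<le> y p"
    and u: "\<And>i. i < m \<Longrightarrow> i \<noteq> p \<Longrightarrow> u i = 0" "\<And>i. m \<le> i \<Longrightarrow> i < n \<Longrightarrow> u i \<le> 0" and S: "S = (\<Sum>i<n. u i)" "S > 0"
  shows "(\<Sum>i<n. u i * y i) \<ge> t * S - (S + (\<Sum>i<n. \<bar>u i\<bar>)) * ln (real m)"
proof -
  have m0: "real m > 0" using m by simp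
  have lm: "ln (real m) \<ge> 0" using m by simp
  have "(\<Sum>k<m. exp (y k)) \<le> (\<Sum>k<m. exp (y p))" using mx by (intro sum_mono) auto
  hence 1: "exp t + (\<Sum>k\<in>{m..<n}. exp (y k)) \<le> real m * exp (y p)" using y by (simp add: Xm_def)
  have 2: "t \<le> y p + ln (real m)"
  proof -
    have "exp t \<le> real m * exp (y p)" using 1 sum_nonneg[of "{m..<n}" "\<lambda>k. exp (y k)"] by simp
    also have "\<dots> = exp (y p + ln (real m))" using m0 by (simp add: exp_add)
    finally show ?thesis by simp
  qed
  have 3: "y j \<le> y p + ln (real m)" if "j \<in> {m..<n}" for j
  proof -
    have "exp (y j) \<le> (\<Sum>k\<in>{m..<n}. exp (y k))" using that by (intro member_le_sum) auto
    also have "\<dots> \<le> real m * exp (y p)" using 1 by (smt (verit) exp_gt_zero)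
    also have "\<dots> = exp (y p + ln (real m))" using m0 by (simp add: exp_add)
    finally show ?thesis by simp
  qed
  have "u i * y p - \<bar>u i\<bar> * ln (real m) \<le> u i * y i" if i: "i < n" for i
  proof -
    consider "i < m" "i \<noteq> p" | "i = p" | "m \<le> i" by linarith
    thus ?thesis
    proof cases
      case 1 thus ?thesis using u(1) by simp
    next
      case 2 thus ?thesis using lm by simp
    next
      case 3
      hence ui: "u i \<le> 0" using u(2) i by simp
      have "u i * (y p + ln (real m)) \<le> u i * y i"
        using \<open>\<And>j. j \<in> {m..<n} \<Longrightarrow> y j \<le> y p + ln (real m)\<close>[of i] 3 i ui by (intro mult_left_mono_neg) auto
      thus ?thesis using ui by (simp add: distrib_left)
    qed
  qed
  hence "(\<Sum>i<n. u i * y p - \<bar>u i\<bar> * ln (real m)) \<le> (\<Sum>i<n. u i * y i)" by (intro sum_mono) auto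
  also have "(\<Sum>i<n. u i * y p - \<bar>u i\<bar> * ln (real m)) = S * y p - (\<Sum>i<n. \<bar>u i\<bar>) * ln (real m)"
    by (simp add: S(1) sum_subtractf sum_distrib_right)
  finally have "S * y p - (\<Sum>i<n. \<bar>u i\<bar>) * ln (real m) \<le> (\<Sum>i<n. u i * y i)" .
  moreover have "S * (t - ln (real m)) \<le> S * y p" using 2 S by (intro mult_left_mono) auto
  ultimately show ?thesis by (simp add: algebra_simps)
qed

text \<open>The probability is enclosed between those of the one-term event at the levels t + 1 /
  t^2 and t - 1 / t^2. The upper side is an inclusion; the lower side discards points outside the
  tube, which are negligible because they lie in the half-space.\<close>

lemma tube_exceedance_asymp:
  fixes u ys :: "nat \<Rightarrow> real"
  assumes m: "m \<le> n" "p < m" and ys: "\<And>i. i < n \<Longrightarrow> ys i = (\<Sum>j<n. b i j * u j)" and S: "S = (\<Sum>i<n. u i * ys i)" "S > 0" "S = (\<Sum>i<n. u i)"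
    and J: "J \<subseteq> {m..<n}" and u: "\<And>j. j \<in> J \<Longrightarrow> u j \<le> 0" "\<And>i. i < n \<Longrightarrow> i \<notin> insert p J \<Longrightarrow> u i = 0"
    and \<epsilon>: "\<epsilon> > 0" "\<And>i. i < n \<Longrightarrow> i \<notin> insert p J \<Longrightarrow> ys i + 2 * \<epsilon> \<le> 1"
    and H: "(\<lambda>t. measure law {y \<in> space law. sgn_sum p J y > exp t} - d * gtail S a e t) \<in> O(\<lambda>t. d * gtail S a e t * t powr (-1/2))"
    and d: "d > 0"
  shows "(\<lambda>t. measure law (exceed m t \<inter> tube ys \<epsilon> t) - d * gtail S a e t) \<in> O(\<lambda>t. gtail S a e t * t powr (-1/2))"
proof -
  interpret prob_space law by (rule prob_space_law)
  define h where "h = (\<lambda>t. measure law {y \<in> space law. sgn_sum p J y > exp t})"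
  have "(\<lambda>t. (1 / d) * (h t - d * gtail S a e t)) \<in> O(\<lambda>t. gtail S a e t * t powr (-1/2))"
    using H d by (simp add: h_def mult.assoc)
  hence hd: "(\<lambda>t. h t / d - gtail S a e t) \<in> O(\<lambda>t. gtail S a e t * t powr (-1/2))"
    using d by (simp add: right_diff_distrib)
  have scale: "(\<lambda>t. h (g t) - d * gtail S a e t) \<in> O(\<lambda>t. gtail S a e t * t powr (-1/2))"
    if "(\<lambda>t. h (g t) / d - gtail S a e t) \<in> O(\<lambda>t. gtail S a e t * t powr (-1/2))" for g
  proof -
    from that have "(\<lambda>t. d * (h (g t) / d - gtail S a e t)) \<in> O(\<lambda>t. gtail S a e t * t powr (-1/2))"
      by simp
    thus ?thesis using d by (simp add: right_diff_distrib)
  qed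
  note up = scale[OF gtail_perturb(1)[OF S(2) hd]] and lo = scale[OF gtail_perturb(2)[OF S(2) hd]]
  \<comment> \<open>The half-space constant is 0 here: with a single positive term in
    \<open>sgn_sum\<close> there is no loss of order ln m.\<close>
  obtain K C q where far: "q > 0"
    "\<And>F t. F \<in> sets law \<Longrightarrow> t \<ge> 0 \<Longrightarrow> (\<And>y. y \<in> F \<Longrightarrow> (\<Sum>i<n. u i * y i) \<ge> t * S - 0) \<Longrightarrow>
        (\<And>y. y \<in> F \<Longrightarrow> y \<notin> tube ys \<epsilon> t) \<Longrightarrow> measure law F \<le> K * exp (C * t - S * t\<^sup>2 / 2 - q * t\<^sup>2)"
    by (rule half_space_far[OF ys S(1) \<epsilon>(1), where ?C0.0 = 0]) blast+
  have sgm: "sgn_sum p J \<in> borel_measurable law"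
  proof -
    have "sgn_sum p J \<in> borel_measurable (lborel_PiM {..<n})"
      by (rule sgn_sum_measurable) (use J m in auto)
    thus ?thesis by (simp add: measurable_cong_sets[OF sets_law refl])
  qed
  have hs: "{y \<in> space law. sgn_sum p J y > exp t} \<in> sets law" for t
    using sgm by measurable
  have finJ: "finite J" "p \<notin> J" "insert p J \<subseteq> {..<n}" using J m finite_subset by auto
  \<comment> \<open>In the tube an inactive coordinate is at most
    \<open>t * (ys k + \<epsilon>)\<close>, and the gap of 2 \<epsilon> turns this into
    \<open>(1 - \<epsilon>) * t\<close>.\<close>
  have approx: "\<bar>Xm m n y - sgn_sum p J y\<bar> \<le> real n * exp ((1 - \<epsilon>) * t)" if y: "y \<in> tube ys \<epsilon> t" and t: "t \<ge> 0" for y t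
  proof -
    have s1: "(\<Sum>k<m. exp (y k)) = exp (y p) + (\<Sum>k\<in>{..<m} - {p}. exp (y k))"
      using m by (simp add: sum.remove)
    have s2: "(\<Sum>k\<in>{m..<n}. exp (y k)) = (\<Sum>k\<in>J. exp (y k)) + (\<Sum>k\<in>{m..<n} - J. exp (y k))"
      using J by (simp add: sum.subset_diff)
    have "Xm m n y - sgn_sum p J y = (\<Sum>k\<in>{..<m} - {p}. exp (y k)) - (\<Sum>k\<in>{m..<n} - J. exp (y k))"
      unfolding Xm_def sgn_sum_def s1 s2 by simp
    also have "\<bar>\<dots>\<bar> \<le> (\<Sum>k\<in>{..<m} - {p}. exp (y k)) + (\<Sum>k\<in>{m..<n} - J. exp (y k))"
      using sum_nonneg[of "{..<m} - {p}" "\<lambda>k. exp (y k)"] sum_nonneg[of "{m..<n} - J" "\<lambda>k. exp (y k)"] by simp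
    also have "\<dots> = (\<Sum>k\<in>({..<m} - {p}) \<union> ({m..<n} - J). exp (y k))"
      by (subst sum.union_disjoint) auto
    also have "\<dots> \<le> (\<Sum>k\<in>({..<m} - {p}) \<union> ({m..<n} - J). exp ((1 - \<epsilon>) * t))"
    proof (rule sum_mono)
      fix k assume k: "k \<in> ({..<m} - {p}) \<union> ({m..<n} - J)"
      hence kn: "k < n" "k \<notin> insert p J" using m J by auto
      have "y k \<le> t * ys k + \<epsilon> * t" using y kn by (auto simp: tube_def abs_less_iff intro!: less_imp_le)
      also have "\<dots> = t * (ys k + \<epsilon>)" by (simp add: algebra_simps)
      also have "\<dots> \<le> t * (1 - \<epsilon>)" using \<epsilon>(2)[OF kn] t by (intro mult_left_mono) auto
      finally show "exp (y k) \<le> exp ((1 - \<epsilon>) * t)" by (simp add: mult.commute)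
    qed
    also have "\<dots> \<le> real n * exp ((1 - \<epsilon>) * t)"
    proof -
      have "card (({..<m} - {p}) \<union> ({m..<n} - J)) \<le> card {..<n}" using m by (intro card_mono) auto
      thus ?thesis by (simp add: mult_right_mono)
    qed
    finally show ?thesis .
  qed
  show ?thesis
  proof (rule bigo_sandwich[OF lo up gauss_tail_negligible[OF far(1)]])
    show "\<forall>\<^sub>F t in at_top. measure law (exceed m t \<inter> tube ys \<epsilon> t) \<le> h (t - 1 / t\<^sup>2)"
      using exp_gap_eventually(1)[OF \<epsilon>(1), of "real n"] eventually_ge_at_top[of 0]
    proof eventually_elim
      case (elim t)
      show ?case unfolding h_def
      proof (rule finite_measure_mono[OF _ hs])
        show "exceed m t \<inter> tube ys \<epsilon> t \<subseteq> {y \<in> space law. exp (t - 1 / t\<^sup>2) < sgn_sum p J y}"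
        proof
          fix y assume y: "y \<in> exceed m t \<inter> tube ys \<epsilon> t"
          hence "Xm m n y \<ge> exp t" "y \<in> space law" by (auto simp: exceed_def)
          moreover have "\<bar>Xm m n y - sgn_sum p J y\<bar> \<le> real n * exp ((1 - \<epsilon>) * t)" using approx[of y t] y elim by auto
          ultimately show "y \<in> {y \<in> space law. exp (t - 1 / t\<^sup>2) < sgn_sum p J y}" using elim by auto
        qed
      qed
    qed
    show "\<forall>\<^sub>F t in at_top. h (t + 1 / t\<^sup>2) - K * exp (C * t - S * t\<^sup>2 / 2 - q * t\<^sup>2) \<le> measure law (exceed m t \<inter> tube ys \<epsilon> t)"
      using exp_gap_eventually(2)[OF \<epsilon>(1), of "real n"] eventually_ge_at_top[of 0]
    proof eventually_elim
      case (elim t)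
      let ?F = "{y \<in> space law. sgn_sum p J y > exp t} - tube ys \<epsilon> t"
      have F: "?F \<in> sets law" using hs tube_sets by (intro sets.Diff)
      have half: "(\<Sum>i<n. u i * y i) \<ge> t * S" if "sgn_sum p J y > exp t" for y
      proof -
        have "0 \<le> (\<Sum>j\<in>J. exp (y j))" by (intro sum_nonneg) auto
        hence yp: "exp t < exp (y p)" using that unfolding sgn_sum_def by linarith
        have yj: "y j \<le> y p" if j: "j \<in> J" for j
        proof -
          have "exp (y j) \<le> (\<Sum>j\<in>J. exp (y j))" using j finJ by (intro member_le_sum) auto
          also have "\<dots> \<le> exp (y p)" using that \<open>sgn_sum p J y > exp t\<close> exp_gt_zero[of t] unfolding sgn_sum_def by linarith
          finally show ?thesis by simp
        qed
        have "t * S \<le> y p * S" using yp S by (intro mult_right_mono) auto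
        also have "\<dots> = (\<Sum>i<n. u i * y p)" unfolding S(3) sum_distrib_left by (simp add: mult.commute)
        also have "\<dots> \<le> (\<Sum>i<n. u i * y i)"
        proof (rule sum_mono)
          fix i assume i: "i \<in> {..<n}"
          consider "i = p" | "i \<in> J" | "i \<notin> insert p J" by blast
          thus "u i * y p \<le> u i * y i"
          proof cases
            case 2 thus ?thesis using u(1) yj by (intro mult_left_mono_neg) auto
          qed (use u(2) i in auto)
        qed
        finally show ?thesis .
      qed
      have "h (t + 1 / t\<^sup>2) \<le> measure law ((exceed m t \<inter> tube ys \<epsilon> t) \<union> ?F)"
        unfolding h_def
      proof (rule finite_measure_mono)
        show "{y \<in> space law. exp (t + 1 / t\<^sup>2) < sgn_sum p J y} \<subseteq> (exceed m t \<inter> tube ys \<epsilon> t) \<union> ?F"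
        proof
          fix y assume y: "y \<in> {y \<in> space law. exp (t + 1 / t\<^sup>2) < sgn_sum p J y}"
          have "exp t \<le> exp (t + 1 / t\<^sup>2)" by simp
          also have "\<dots> < sgn_sum p J y" using y by simp
          finally have 1: "exp t < sgn_sum p J y" .
          show "y \<in> (exceed m t \<inter> tube ys \<epsilon> t) \<union> ?F"
          proof (cases "y \<in> tube ys \<epsilon> t")
            case True
            hence "Xm m n y \<ge> exp t" using approx[of y t] y elim by auto
            thus ?thesis using True y by (auto simp: exceed_def)
          next
            case False thus ?thesis using 1 y by auto
          qed
        qed
        show "(exceed m t \<inter> tube ys \<epsilon> t) \<union> ?F \<in> sets law"
          by (intro sets.Un sets.Int F exceed_sets[OF m(1)] tube_sets)
      qed
      also have "\<dots> \<le> measure law (exceed m t \<inter> tube ys \<epsilon> t) + measure law ?F"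
        using F exceed_sets[OF m(1)] by (intro measure_Un_le) auto
      also have "measure law ?F \<le> K * exp (C * t - S * t\<^sup>2 / 2 - q * t\<^sup>2)"
        using half elim by (intro far(2) F) auto
      finally show ?case by simp
    qed
  qed
qed

text \<open>The event splits into disjoint tube parts, one for each index with minimal S, and a
  remainder covered by half-space estimates. Tube parts of indices outside \<open>Q2\<close> go into
  the error, having a smaller linear exponent or a power of t smaller by at least 1/2.\<close>

lemma exceedance_asymp:
  fixes u ys :: "nat \<Rightarrow> nat \<Rightarrow> real" and S a e d :: "nat \<Rightarrow> real"
  assumes m: "m \<le> n" "1 \<le> m"
    and ys: "\<And>p i. p < m \<Longrightarrow> i < n \<Longrightarrow> ys p i = (\<Sum>j<n. b i j * u p j)"
    and S: "\<And>p. p < m \<Longrightarrow> S p = (\<Sum>i<n. u p i * ys p i)" "\<And>p. p < m \<Longrightarrow> S p > 0" "\<And>p. p < m \<Longrightarrow> S p = (\<Sum>i<n. u p i)"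
    and u: "\<And>p i. p < m \<Longrightarrow> i < m \<Longrightarrow> i \<noteq> p \<Longrightarrow> u p i = 0" "\<And>p i. p < m \<Longrightarrow> m \<le> i \<Longrightarrow> i < n \<Longrightarrow> u p i \<le> 0"
    and d: "\<And>p. p < m \<Longrightarrow> d p > 0"
    and Q4: "Q4 = {p. p < m \<and> S p = S0}" "\<And>p. p < m \<Longrightarrow> S0 \<le> S p"
    and ysp: "\<And>p. p \<in> Q4 \<Longrightarrow> ys p p = 1"
    and ysq: "\<And>p i. p \<in> Q4 \<Longrightarrow> i < n \<Longrightarrow> i \<noteq> p \<Longrightarrow> u p i = 0 \<Longrightarrow> ys p i < 1"
    and H: "\<And>p. p \<in> Q4 \<Longrightarrow> (\<lambda>t. measure law {y \<in> space law. sgn_sum p {i \<in> {m..<n}. u p i \<noteq> 0} y > exp t}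
        - d p * gtail (S p) (a p) (e p) t) \<in> O(\<lambda>t. d p * gtail (S p) (a p) (e p) t * t powr (-1/2))"
    and Q2: "Q2 \<subseteq> Q4" "\<And>p. p \<in> Q2 \<Longrightarrow> a p = a0 \<and> e p = e0"
      "\<And>p. p \<in> Q4 - Q2 \<Longrightarrow> e p < e0 \<or> e p = e0 \<and> a p \<le> a0 - 1/2"
  shows "(\<lambda>t. measure law (exceed m t) - (\<Sum>p\<in>Q2. d p) * gtail S0 a0 e0 t) \<in> O(\<lambda>t. gtail S0 a0 e0 t * t powr (-1/2))"
proof -
  interpret prob_space law by (rule prob_space_law)
  let ?B = "\<lambda>t. gtail S0 a0 e0 t * t powr (-1/2)"
  have fin: "finite Q4" unfolding Q4 by simp
  have Q4m: "p < m" "p < n" "S p = S0" if "p \<in> Q4" for p using that m by (auto simp: Q4)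
  define X where "X = {1 - ys p i |p i. p \<in> Q4 \<and> i < n \<and> i \<noteq> p \<and> u p i = 0}"
  \<comment> \<open>Half of the smallest gap below 1 over all relevant inactive coordinates. The
    inserted 1 provides a value when there are none.\<close>
  define \<epsilon> where "\<epsilon> = Min (insert 1 X) / 2"
  have "X \<subseteq> (\<lambda>(p, i). 1 - ys p i) ` (Q4 \<times> {..<n})" by (auto simp: X_def)
  hence Xf: "finite X" using fin finite_subset by blast
  have \<epsilon>: "\<epsilon> > 0" unfolding \<epsilon>_def using Xf ysq by (auto simp: X_def)
  have \<epsilon>ys: "ys p i + 2 * \<epsilon> \<le> 1" if "p \<in> Q4" "i < n" "i \<noteq> p" "u p i = 0" for p i
  proof -
    have "Min (insert 1 X) \<le> 1 - ys p i" using that Xf by (intro Min_le) (auto simp: X_def)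
    thus ?thesis by (simp add: \<epsilon>_def)
  qed
  have inJ: "i \<notin> insert p {i \<in> {m..<n}. u p i \<noteq> 0} \<Longrightarrow> i \<noteq> p \<and> u p i = 0" if "p < m" "i < n" for p i
    using u(1)[of p i] that by auto
  have loc: "(\<lambda>t. measure law (exceed m t \<inter> tube (ys p) \<epsilon> t) - d p * gtail S0 (a p) (e p) t) \<in> O(\<lambda>t. gtail S0 (a p) (e p) t * t powr (-1/2))"
    if p: "p \<in> Q4" for p
  proof -
    note pm = Q4m[OF p]
    have "(\<lambda>t. measure law (exceed m t \<inter> tube (ys p) \<epsilon> t) - d p * gtail (S p) (a p) (e p) t) \<in> O(\<lambda>t. gtail (S p) (a p) (e p) t * t powr (-1/2))"
    proof (rule tube_exceedance_asymp[where u = "u p" and J = "{i \<in> {m..<n}. u p i \<noteq> 0}"])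
      show "\<And>i. i < n \<Longrightarrow> i \<notin> insert p {i \<in> {m..<n}. u p i \<noteq> 0} \<Longrightarrow> ys p i + 2 * \<epsilon> \<le> 1"
        using inJ[OF pm(1)] \<epsilon>ys[OF p] by blast
      show "\<And>i. i < n \<Longrightarrow> i \<notin> insert p {i \<in> {m..<n}. u p i \<noteq> 0} \<Longrightarrow> u p i = 0"
        using inJ[OF pm(1)] by blast
    qed (use m pm ys[of p] S[of p] u[of p] \<epsilon> H[OF p] d[of p] in auto)
    thus ?thesis unfolding pm(3) .
  qed
  have cmp: "gtail S0 (a p) (e p) \<in> O(?B)" if p: "p \<in> Q4 - Q2" for p
  proof -
    have "(\<lambda>t. t powr a p * exp (e p * t)) \<in> O(\<lambda>t. t powr (a0 - 1/2) * exp (e0 * t))"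
    proof (cases "e p < e0")
      case True
      hence "(\<lambda>t. t powr a p * exp (- (e0 - e p) * t)) \<in> O(\<lambda>t. t powr (a0 - 1/2))"
        by real_asymp
      from landau_o.big.mult_right[OF this, of "\<lambda>t. exp (e0 * t)"] show ?thesis
        by (simp add: mult.assoc left_diff_distrib flip: exp_add)
    next
      case False
      hence "e p = e0" "a p \<le> a0 - 1/2" using Q2(3)[OF p] by auto
      moreover from this(2) have "(\<lambda>t::real. t powr a p) \<in> O(\<lambda>t. t powr (a0 - 1/2))"
        by (intro bigoI[of _ 1] eventually_mono[OF eventually_ge_at_top[of 1]]) (auto intro!: powr_mono)
      ultimately show ?thesis by (simp add: landau_o.big.mult_right)
    qed
    from landau_o.big.mult_right[OF this, of "\<lambda>t. exp (- S0 * t\<^sup>2 / 2)"]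
    have "(\<lambda>t. t powr a p * exp (e p * t) * exp (- S0 * t\<^sup>2 / 2)) \<in> O(\<lambda>t. t powr (a0 - 1/2) * exp (e0 * t) * exp (- S0 * t\<^sup>2 / 2))" .
    moreover have "(\<lambda>t. t powr a p * exp (e p * t) * exp (- S0 * t\<^sup>2 / 2)) = gtail S0 (a p) (e p)"
      by (auto simp: gtail_def mult.assoc simp flip: exp_add)
    moreover have "(\<lambda>t. t powr (a0 - 1/2) * exp (e0 * t) * exp (- S0 * t\<^sup>2 / 2)) = ?B"
    proof
      fix t :: real
      have "t powr (a0 - 1/2) = t powr a0 * t powr (-1/2)" by (simp flip: powr_add)
      moreover have "exp (e0 * t - S0 * t\<^sup>2 / 2) = exp (e0 * t) * exp (- S0 * t\<^sup>2 / 2)" by (simp flip: exp_add)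
      ultimately show "t powr (a0 - 1/2) * exp (e0 * t) * exp (- S0 * t\<^sup>2 / 2) = ?B t" by (simp add: gtail_def)
    qed
    ultimately show ?thesis by simp
  qed
  have decay: "(\<lambda>t::real. t powr (-1/2)) \<in> O(\<lambda>_. 1)" by real_asymp
  have loc': "(\<lambda>t. measure law (exceed m t \<inter> tube (ys p) \<epsilon> t) - (if p \<in> Q2 then d p * gtail S0 a0 e0 t else 0)) \<in> O(?B)"
    if p: "p \<in> Q4" for p
  proof (cases "p \<in> Q2")
    case True
    thus ?thesis using loc[OF p] Q2(2) by simp
  next
    case False
    hence c: "gtail S0 (a p) (e p) \<in> O(?B)" using cmp p by blast
    have "(\<lambda>t. gtail S0 (a p) (e p) t * t powr (-1/2)) \<in> O(\<lambda>t. ?B t * 1)"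
      by (rule landau_o.big.mult[OF c decay])
    hence "(\<lambda>t. measure law (exceed m t \<inter> tube (ys p) \<epsilon> t) - d p * gtail S0 (a p) (e p) t) \<in> O(?B)"
      using landau_o.big_trans[OF loc[OF p]] by simp
    moreover have "(\<lambda>t. d p * gtail S0 (a p) (e p) t) \<in> O(?B)"
      using c d[OF Q4m(1)[OF p]] by simp
    ultimately have "(\<lambda>t. (measure law (exceed m t \<inter> tube (ys p) \<epsilon> t) - d p * gtail S0 (a p) (e p) t) + d p * gtail S0 (a p) (e p) t) \<in> O(?B)"
      by (rule sum_in_bigo(1))
    thus ?thesis using False by simp
  qed
  \<comment> \<open>Exceedances for which p is a largest positive coordinate. Ties make these sets
    overlap, which is harmless: they only enter a union bound for the remainder.\<close>
  define G where "G = (\<lambda>p t. {y \<in> exceed m t. \<forall>i<m. y i \<le> y p})"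
  have Gs: "G p t \<in> sets law" if "p < m" for p t
  proof -
    have "G p t = exceed m t \<inter> (\<Inter>i\<in>{..<m}. {y \<in> space law. y i \<le> y p})"
      using m by (auto simp: G_def exceed_def)
    moreover have "{y \<in> space law. y i \<le> y p} \<in> sets law" if "i < m" for i
    proof -
      have [measurable]: "(\<lambda>y. y i) \<in> borel_measurable law" "(\<lambda>y. y p) \<in> borel_measurable law"
        using component_measurable_law \<open>p < m\<close> that m by auto
      show ?thesis by measurable
    qed
    ultimately show ?thesis using m exceed_sets[OF m(1)]
      by (auto intro!: sets.Int sets.finite_INT simp: lessThan_empty_iff)
  qed
  have Ghalf: "(\<Sum>i<n. u p i * y i) \<ge> t * S p - (S p + (\<Sum>i<n. \<bar>u p i\<bar>)) * ln (real m)" if "p < m" "y \<in> G p t" for p t y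
    by (rule dominating_half_space[OF m(1) that(1)]) (use that u S in \<open>auto simp: G_def exceed_def\<close>)
  have far: "\<exists>r. r \<in> O(?B) \<and> (\<forall>t\<ge>0. measure law (G p t - tube (ys p) \<epsilon> t) \<le> r t)" if p: "p \<in> Q4" for p
  proof -
    note pm = Q4m[OF p]
    obtain K C q where f: "q > 0"
      "\<And>F t. F \<in> sets law \<Longrightarrow> t \<ge> 0 \<Longrightarrow> (\<And>y. y \<in> F \<Longrightarrow> (\<Sum>i<n. u p i * y i) \<ge> t * S p - (S p + (\<Sum>i<n. \<bar>u p i\<bar>)) * ln (real m)) \<Longrightarrow>
        (\<And>y. y \<in> F \<Longrightarrow> y \<notin> tube (ys p) \<epsilon> t) \<Longrightarrow> measure law F \<le> K * exp (C * t - S p * t\<^sup>2 / 2 - q * t\<^sup>2)"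
      by (rule half_space_far[of "ys p" "u p" "S p" \<epsilon> "(S p + (\<Sum>i<n. \<bar>u p i\<bar>)) * ln (real m)"])
         (use ys S pm \<epsilon> in blast)+
    have "measure law (G p t - tube (ys p) \<epsilon> t) \<le> K * exp (C * t - S0 * t\<^sup>2 / 2 - q * t\<^sup>2)" if "t \<ge> 0" for t
      unfolding pm(3)[symmetric] using Ghalf[OF pm(1)] that by (intro f(2) sets.Diff Gs[OF pm(1)] tube_sets) auto
    thus ?thesis using gauss_tail_negligible[OF f(1), of K C S0 a0 e0] by blast
  qed
  have off: "\<exists>r. r \<in> O(?B) \<and> (\<forall>t\<ge>0. measure law (G p t) \<le> r t)" if p: "p \<in> {..<m} - Q4" for p
  proof -
    have pm: "p < m" "S p > S0" using p Q4 by (auto simp: order_less_le)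
    define C where "C = (S p + (\<Sum>i<n. \<bar>u p i\<bar>)) * ln (real m) + (\<Sum>i<n. u p i * \<mu> i)"
    \<comment> \<open>The excess of \<open>S p\<close> over the minimum is rewritten as the
      quadratic loss expected by \<open>gauss_tail_negligible\<close>.\<close>
    have "measure law (G p t) \<le> 1 * exp (C * t - S0 * t\<^sup>2 / 2 - (S p - S0) / 2 * t\<^sup>2)" if t: "t \<ge> 0" for t
    proof -
      have "measure law (G p t) \<le> exp (C * t - S p * t\<^sup>2 / 2)"
        unfolding C_def by (rule half_space_bound[OF ys[OF pm(1)] S(1)[OF pm(1)] Gs[OF pm(1)] t Ghalf[OF pm(1)]])
      also have "C * t - S p * t\<^sup>2 / 2 = C * t - S0 * t\<^sup>2 / 2 - (S p - S0) / 2 * t\<^sup>2"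
        by (simp add: field_simps)
      finally show ?thesis by simp
    qed
    moreover have "(S p - S0) / 2 > 0" using pm by simp
    ultimately show ?thesis using gauss_tail_negligible[of "(S p - S0) / 2" 1 C S0 a0 e0] by blast
  qed
  have "\<exists>r. \<forall>p\<in>Q4. r p \<in> O(?B) \<and> (\<forall>t\<ge>0. measure law (G p t - tube (ys p) \<epsilon> t) \<le> r p t)"
    by (rule bchoice, rule ballI, rule far)
  then obtain rf where rf0: "\<forall>p\<in>Q4. rf p \<in> O(?B) \<and> (\<forall>t\<ge>0. measure law (G p t - tube (ys p) \<epsilon> t) \<le> rf p t)" ..
  have rf: "rf p \<in> O(?B)" "\<And>t. t \<ge> 0 \<Longrightarrow> measure law (G p t - tube (ys p) \<epsilon> t) \<le> rf p t" if "p \<in> Q4" for p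
    using bspec[OF rf0 that] by simp_all
  have "\<exists>r. \<forall>p\<in>{..<m} - Q4. r p \<in> O(?B) \<and> (\<forall>t\<ge>0. measure law (G p t) \<le> r p t)"
    by (rule bchoice, rule ballI, rule off)
  then obtain ro where ro0: "\<forall>p\<in>{..<m} - Q4. ro p \<in> O(?B) \<and> (\<forall>t\<ge>0. measure law (G p t) \<le> ro p t)" ..
  have ro: "ro p \<in> O(?B)" "\<And>t. t \<ge> 0 \<Longrightarrow> measure law (G p t) \<le> ro p t" if "p \<in> {..<m} - Q4" for p
    using bspec[OF ro0 that] by simp_all
  define R where "R = (\<lambda>t. measure law (exceed m t - (\<Union>p\<in>Q4. tube (ys p) \<epsilon> t)))"
  have Us: "(\<Union>p\<in>Q4. tube (ys p) \<epsilon> t) \<in> sets law" for t using fin by (intro sets.finite_UN) auto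
  have R: "R \<in> O(?B)"
  proof (rule landau_o.big_trans)
    show "(\<lambda>t. (\<Sum>p\<in>Q4. rf p t) + (\<Sum>p\<in>{..<m} - Q4. ro p t)) \<in> O(?B)"
      using rf(1) ro(1) by (intro sum_in_bigo big_sum_in_bigo) auto
    show "R \<in> O(\<lambda>t. (\<Sum>p\<in>Q4. rf p t) + (\<Sum>p\<in>{..<m} - Q4. ro p t))"
    proof (rule bigoI[of _ 1], use eventually_ge_at_top[of 0] in eventually_elim)
      case (elim t)
      let ?U1 = "\<Union>p\<in>Q4. G p t - tube (ys p) \<epsilon> t" and ?U2 = "\<Union>p\<in>{..<m} - Q4. G p t"
      have s1: "G p t - tube (ys p) \<epsilon> t \<in> sets law" if "p \<in> Q4" for p
        using Gs[OF Q4m(1)[OF that]] by auto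
      have s2: "?U1 \<in> sets law" "?U2 \<in> sets law" using fin s1 Gs by (auto intro!: sets.finite_UN)
      have "R t \<le> measure law (?U1 \<union> ?U2)"
        unfolding R_def
      proof (rule finite_measure_mono[OF _ sets.Un[OF s2]])
        show "exceed m t - (\<Union>p\<in>Q4. tube (ys p) \<epsilon> t) \<subseteq> ?U1 \<union> ?U2"
        proof
          fix y assume y: "y \<in> exceed m t - (\<Union>p\<in>Q4. tube (ys p) \<epsilon> t)"
          have "finite (y ` {..<m})" "y ` {..<m} \<noteq> {}" using m by (auto simp: lessThan_empty_iff)
          from Max_in[OF this] obtain p where "p < m" "y p = Max (y ` {..<m})" by auto
          hence p: "p < m" "y \<in> G p t" using y by (auto simp: G_def)
          show "y \<in> ?U1 \<union> ?U2" using p y by (cases "p \<in> Q4") auto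
        qed
      qed
      also have "\<dots> \<le> measure law ?U1 + measure law ?U2" by (rule measure_Un_le[OF s2])
      also have "\<dots> \<le> (\<Sum>p\<in>Q4. measure law (G p t - tube (ys p) \<epsilon> t)) + (\<Sum>p\<in>{..<m} - Q4. measure law (G p t))"
        using fin s1 Gs by (intro add_mono measure_UNION_le) auto
      also have "\<dots> \<le> (\<Sum>p\<in>Q4. rf p t) + (\<Sum>p\<in>{..<m} - Q4. ro p t)"
        using rf(2) ro(2) elim by (intro add_mono sum_mono) auto
      finally show ?case by (simp add: R_def)
    qed
  qed
  have split: "measure law (exceed m t) = (\<Sum>p\<in>Q4. measure law (exceed m t \<inter> tube (ys p) \<epsilon> t)) + R t" for t
  proof -
    \<comment> \<open>In the tube of q the coordinate q exceeds (1 - \<epsilon>) t; in the tube of p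
      it stays below that value, by the gap of \<open>ys p\<close> at q.\<close>
    have dj: "disjoint_family_on (\<lambda>p. exceed m t \<inter> tube (ys p) \<epsilon> t) Q4"
      unfolding disjoint_family_on_def
    proof (intro ballI impI equals0I)
      fix p q y assume pq: "p \<in> Q4" "q \<in> Q4" "p \<noteq> q" and y: "y \<in> (exceed m t \<inter> tube (ys p) \<epsilon> t) \<inter> (exceed m t \<inter> tube (ys q) \<epsilon> t)"
      have q: "q < n" "q < m" "p < m" using Q4m pq by auto
      have "\<bar>y q - t * ys p q\<bar> < \<epsilon> * t" "\<bar>y q - t * ys q q\<bar> < \<epsilon> * t" using y q by (auto simp: tube_def)
      moreover from this have "\<epsilon> * t > 0" by linarith
      hence "t > 0" using \<epsilon> by (simp add: zero_less_mult_iff)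
      hence "t * (ys p q + 2 * \<epsilon>) \<le> t * 1" using \<epsilon>ys[OF pq(1) q(1)] pq(3) u(1)[OF q(3,2)] by (intro mult_left_mono) auto
      ultimately show False using ysp[OF pq(2)] by (simp add: algebra_simps abs_less_iff)
    qed
    have "measure law (exceed m t) = measure law (exceed m t \<inter> (\<Union>p\<in>Q4. tube (ys p) \<epsilon> t)) + R t"
      unfolding R_def using Us exceed_sets[OF m(1)]
      by (subst finite_measure_Union[symmetric]) (auto simp: Int_Diff_Un)
    also have "exceed m t \<inter> (\<Union>p\<in>Q4. tube (ys p) \<epsilon> t) = (\<Union>p\<in>Q4. exceed m t \<inter> tube (ys p) \<epsilon> t)" by blast
    also have "measure law \<dots> = (\<Sum>p\<in>Q4. measure law (exceed m t \<inter> tube (ys p) \<epsilon> t))"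
      using fin dj exceed_sets[OF m(1)] by (intro finite_measure_finite_Union) auto
    finally show ?thesis .
  qed
  have sumP: "(\<Sum>p\<in>Q4. if p \<in> Q2 then d p * gtail S0 a0 e0 t else 0) = (\<Sum>p\<in>Q2. d p) * gtail S0 a0 e0 t" for t
  proof -
    have "(\<Sum>p\<in>Q4. if p \<in> Q2 then d p * gtail S0 a0 e0 t else 0) = (\<Sum>p\<in>Q4 \<inter> Q2. d p * gtail S0 a0 e0 t)"
      using fin by (simp add: sum.inter_restrict)
    also have "Q4 \<inter> Q2 = Q2" using Q2(1) by blast
    finally show ?thesis by (simp add: sum_distrib_right)
  qed
  have "(\<lambda>t. (\<Sum>p\<in>Q4. measure law (exceed m t \<inter> tube (ys p) \<epsilon> t) - (if p \<in> Q2 then d p * gtail S0 a0 e0 t else 0)) + R t) \<in> O(?B)"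
    using loc' R by (intro sum_in_bigo(1) big_sum_in_bigo) auto
  thus ?thesis unfolding sum_subtractf sumP split by (simp add: algebra_simps)
qed

end

section \<open>The quadratic minimization problem\<close>

lemma qform_scale: "qform I g (\<lambda>i. s * x i) = s\<^sup>2 * qform I g x"
  by (simp add: qform_def sum_distrib_left power2_eq_square mult_ac)

text \<open>The constraint set \<open>Delta_mnp\<close> for index functions, the representation used
  for the Gaussian law.\<close>

definition feasible :: "nat \<Rightarrow> nat \<Rightarrow> nat \<Rightarrow> (nat \<Rightarrow> real) \<Rightarrow> bool" where
  "feasible n m p v \<longleftrightarrow> (\<forall>i<m. i \<noteq> p \<longrightarrow> v i = 0) \<and> v p \<ge> 0 \<and> (\<forall>i\<in>{m..<n}. v i \<le> 0) \<and> (\<Sum>i<n. v i) = 1"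

lemma feasible_convex:
  assumes "feasible n m p v" "feasible n m p w" "0 \<le> s" "s \<le> 1"
  shows "feasible n m p (\<lambda>i. s * (v i - w i) + w i)"
proof -
  have e: "s * (v i - w i) + w i = s * v i + (1 - s) * w i" for i by (simp add: algebra_simps)
  have "s * v i + (1 - s) * w i \<le> 0" if "i \<in> {m..<n}" for i
    using assms that by (intro add_nonpos_nonpos mult_nonneg_nonpos) (auto simp: feasible_def)
  thus ?thesis unfolding e feasible_def using assms
    by (auto simp: feasible_def sum.distrib simp flip: sum_distrib_left)
qed

lemma feasible_unit:
  assumes "p < m" "m \<le> n"
  shows "feasible n m p (\<lambda>i. if i = p then 1 else 0)"
  using assms by (auto simp: feasible_def)

context gaussian_law
begin

text \<open>The coercivity duality with the roles of \<open>b\<close> and \<open>P\<close>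
  exchanged.\<close>

lemma b_coercive:
  obtains d where "d > 0" "\<And>v. qform {..<n} b v \<ge> d * (\<Sum>i<n. (v i)\<^sup>2)"
proof -
  have "(\<Sum>j<n. P i j * b j k) = (if i = k then 1 else 0)" if "i < n" "k < n" for i k
  proof -
    have "(\<Sum>j<n. P i j * b j k) = (\<Sum>j<n. b k j * P j i)"
    proof (rule sum.cong[OF refl])
      fix j assume "j \<in> {..<n}"
      hence e: "P i j = P j i" "b j k = b k j" using that by (auto intro: P_sym b_sym)
      show "P i j * b j k = b k j * P j i" unfolding e by (rule mult.commute)
    qed
    thus ?thesis using inv[of k i] that by auto
  qed
  note inv' = this
  show ?thesis
  proof (rule qform_inverse_coercive[of "{..<n}" P b])
    show "pos_def_on {..<n} P" by (rule pos_def_on_inverse) (use inv in auto)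
    show "P i j = P j i" "b i j = b j i" if "i \<in> {..<n}" "j \<in> {..<n}" for i j
      using that by (auto intro: P_sym b_sym)
    show "(\<Sum>j\<in>{..<n}. P i j * b j k) = (if i = k then 1 else 0)" if "i \<in> {..<n}" "k \<in> {..<n}" for i k
      using inv' that by auto
    show thesis if "d > 0" "\<And>v. d * (\<Sum>i\<in>{..<n}. (v i)\<^sup>2) \<le> qform {..<n} b v" for d
      using \<open>\<And>d. d > 0 \<Longrightarrow> (\<And>v. d * (\<Sum>i<n. (v i)\<^sup>2) \<le> qform {..<n} b v) \<Longrightarrow> thesis\<close> that by blast
  qed simp
qed

lemma qform_b_nonneg: "qform {..<n} b v \<ge> 0"
proof (cases "\<exists>i\<in>{..<n}. v i \<noteq> 0")
  case True
  thus ?thesis using b_pd unfolding pos_def_on_def by (metis less_imp_le)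
next
  case False
  thus ?thesis by (simp add: qform_def)
qed

text \<open>The midpoint is written in the form produced by \<open>feasible_convex\<close>. The
  identity drives both existence and uniqueness of the minimizer.\<close>

lemma parallelogram:
  "qform {..<n} b (\<lambda>i. x i - y i) + 4 * qform {..<n} b (\<lambda>i. (1/2) * (x i - y i) + y i) = 2 * qform {..<n} b x + 2 * qform {..<n} b y"
proof -
  have s: "\<And>i j. i \<in> {..<n} \<Longrightarrow> j \<in> {..<n} \<Longrightarrow> b i j = b j i" using b_sym by auto
  have 1: "qform {..<n} b (\<lambda>i. x i - y i) = qform {..<n} b (\<lambda>i. (-1) * y i + x i)" by simp
  have "(\<lambda>i. (1/2) * (x i - y i) + y i) = (\<lambda>i. (1/2) * (1 * y i + x i))" by (auto simp: field_simps)
  hence 2: "4 * qform {..<n} b (\<lambda>i. (1/2) * (x i - y i) + y i) = qform {..<n} b (\<lambda>i. 1 * y i + x i)"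
    by (simp only: qform_scale) (simp add: power2_eq_square)
  show ?thesis unfolding 1 2 qform_add[OF s, simplified] by (subst (1 2) qform_add) (use s in auto)
qed

text \<open>Completeness takes the place of compactness, as the feasible set may be unbounded.
  Midpoints are feasible, so the parallelogram identity makes two nearly minimal points close in the
  form, and coercivity makes a minimizing sequence Cauchy in every coordinate.\<close>

lemma minimizer_exists:
  assumes pm: "p < m" "m \<le> n"
  shows "\<exists>w. feasible n m p w \<and> (\<forall>v. feasible n m p v \<longrightarrow> qform {..<n} b w \<le> qform {..<n} b v)"
proof -
  let ?Q = "qform {..<n} b"
  obtain d where d: "d > 0" "\<And>v. ?Q v \<ge> d * (\<Sum>i<n. (v i)\<^sup>2)" by (rule b_coercive) (rule that)
  note Q0 = qform_b_nonneg
  define F where "F = {v. feasible n m p v}"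
  define V where "V = Inf (?Q ` F)"
  have ne: "?Q ` F \<noteq> {}" using feasible_unit[OF pm] by (auto simp: F_def)
  have bb: "bdd_below (?Q ` F)" using Q0 by (auto intro!: bdd_belowI[of _ 0])
  have V: "V \<le> ?Q v" if "feasible n m p v" for v
    unfolding V_def using that bb by (intro cInf_lower) (auto simp: F_def)
  have "\<exists>x. feasible n m p x \<and> ?Q x < V + 1 / real (Suc k)" for k
  proof -
    have "Inf (?Q ` F) < V + 1 / real (Suc k)" by (simp add: V_def)
    thus ?thesis using cInf_less_iff[OF ne bb] by (auto simp: F_def)
  qed
  then obtain x where x: "\<And>k. feasible n m p (x k)" "\<And>k. ?Q (x k) < V + 1 / real (Suc k)" by metis
  have gap: "d * (x k i - x l i)\<^sup>2 \<le> 2 / real (Suc k) + 2 / real (Suc l)" if i: "i < n" for i k l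
  proof -
    have "d * (x k i - x l i)\<^sup>2 \<le> d * (\<Sum>i<n. (x k i - x l i)\<^sup>2)"
      using i d(1) by (intro mult_left_mono member_le_sum) auto
    also have "\<dots> \<le> ?Q (\<lambda>i. x k i - x l i)" by (rule d(2))
    also have "\<dots> = 2 * ?Q (x k) + 2 * ?Q (x l) - 4 * ?Q (\<lambda>i. (1/2) * (x k i - x l i) + x l i)"
      using parallelogram[of "x k" "x l"] by linarith
    also have "\<dots> \<le> 2 * (V + 1 / real (Suc k)) + 2 * (V + 1 / real (Suc l)) - 4 * V"
    proof -
      have "V \<le> ?Q (\<lambda>i. (1/2) * (x k i - x l i) + x l i)"
        by (intro V feasible_convex x) auto
      thus ?thesis using x(2)[of k] x(2)[of l]
        by (intro diff_mono add_mono mult_left_mono less_imp_le) auto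
    qed
    also have "\<dots> = 2 / real (Suc k) + 2 / real (Suc l)" by (simp add: algebra_simps)
    finally show ?thesis .
  qed
  have "convergent (\<lambda>k. x k i)" if i: "i < n" for i
  proof (rule Cauchy_convergent, rule metric_CauchyI)
    fix e :: real assume e: "e > 0"
    have "eventually (\<lambda>k. 4 / (d * real (Suc k)) < e\<^sup>2) sequentially"
      using d(1) e by real_asymp
    then obtain N where N: "4 / (d * real (Suc N)) < e\<^sup>2" by (auto simp: eventually_sequentially)
    show "\<exists>M. \<forall>k\<ge>M. \<forall>l\<ge>M. dist (x k i) (x l i) < e"
    proof (intro exI allI impI)
      fix k l assume kl: "N \<le> k" "N \<le> l"
      have "2 / real (Suc k) \<le> 2 / real (Suc N)" "2 / real (Suc l) \<le> 2 / real (Suc N)"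
        using kl by (auto intro!: divide_left_mono)
      hence "d * (x k i - x l i)\<^sup>2 \<le> 4 / real (Suc N)" using gap[OF i, of k l] by linarith
      hence "(x k i - x l i)\<^sup>2 \<le> 4 / real (Suc N) / d"
        using d(1) by (simp only: pos_le_divide_eq mult.commute)
      also have "\<dots> = 4 / (d * real (Suc N))" by (simp only: divide_divide_eq_left mult.commute)
      finally have "(x k i - x l i)\<^sup>2 \<le> 4 / (d * real (Suc N))" .
      hence "(x k i - x l i)\<^sup>2 < e\<^sup>2" using N by linarith
      hence "\<bar>x k i - x l i\<bar> < e" using e by (metis abs_of_pos power2_less_imp_less power2_abs less_imp_le)
      thus "dist (x k i) (x l i) < e" by (simp add: dist_real_def)
    qed
  qed
  then obtain w where w: "\<And>i. i < n \<Longrightarrow> (\<lambda>k. x k i) \<longlonglongrightarrow> w i"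
    unfolding convergent_def by metis
  have "feasible n m p w"
    unfolding feasible_def
  proof (intro conjI allI impI ballI)
    show "w i = 0" if "i < m" "i \<noteq> p" for i
    proof -
      have "(\<lambda>k. x k i) = (\<lambda>_. 0)" using x(1) that by (auto simp: feasible_def)
      thus ?thesis using w[of i] that pm by (simp add: LIMSEQ_const_iff)
    qed
    show "w p \<ge> 0"
      using w[of p] pm x(1) by (intro LIMSEQ_le_const[of "\<lambda>k. x k p"]) (auto simp: feasible_def)
    show "w i \<le> 0" if "i \<in> {m..<n}" for i
      using w[of i] that x(1) by (intro LIMSEQ_le_const2[of "\<lambda>k. x k i"]) (auto simp: feasible_def)
    have "(\<lambda>k. \<Sum>i<n. x k i) \<longlonglongrightarrow> (\<Sum>i<n. w i)" using w by (intro tendsto_sum) auto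
    moreover have "(\<lambda>k. \<Sum>i<n. x k i) = (\<lambda>_. 1)" using x(1) by (auto simp: feasible_def)
    ultimately show "(\<Sum>i<n. w i) = 1" by (simp add: LIMSEQ_const_iff)
  qed
  moreover have "?Q w \<le> V"
  proof (rule LIMSEQ_le)
    show "(\<lambda>k. ?Q (x k)) \<longlonglongrightarrow> ?Q w" unfolding qform_def using w by (intro tendsto_intros) auto
    show "(\<lambda>k. V + 1 / real (Suc k)) \<longlonglongrightarrow> V" by real_asymp
    show "\<exists>N. \<forall>k\<ge>N. ?Q (x k) \<le> V + 1 / real (Suc k)" using x(2) by (auto intro: less_imp_le)
  qed
  ultimately show ?thesis using V by (intro exI[of _ w]) (auto intro: order_trans)
qed

lemma qform_zero_imp:
  assumes "qform {..<n} b v \<le> 0" "i < n"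
  shows "v i = 0"
  using b_pd assms unfolding pos_def_on_def by (meson lessThan_iff not_le)

lemma minimizer_unique:
  assumes "feasible n m p w" "\<And>v. feasible n m p v \<Longrightarrow> qform {..<n} b w \<le> qform {..<n} b v"
    and "feasible n m p w'" "\<And>v. feasible n m p v \<Longrightarrow> qform {..<n} b w' \<le> qform {..<n} b v"
    and i: "i < n"
  shows "w i = w' i"
proof -
  have "feasible n m p (\<lambda>i. (1/2) * (w i - w' i) + w' i)"
    using assms by (intro feasible_convex) auto
  hence "qform {..<n} b w \<le> qform {..<n} b (\<lambda>i. (1/2) * (w i - w' i) + w' i)"
    "qform {..<n} b w' \<le> qform {..<n} b (\<lambda>i. (1/2) * (w i - w' i) + w' i)"
    using assms(2,4) by auto
  hence "qform {..<n} b (\<lambda>i. w i - w' i) \<le> 0" using parallelogram[of w w'] by linarith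
  thus ?thesis using qform_zero_imp[of "\<lambda>i. w i - w' i" i] i by simp
qed

lemma bform_b: "bform {..<n} b x y = (\<Sum>i<n. (\<Sum>j<n. b i j * x j) * y i)"
  by (rule bform_eq_inner) (use b_sym in auto)

lemma qform_b: "qform {..<n} b x = (\<Sum>i<n. (\<Sum>j<n. b i j * x j) * x i)"
  using bform_b[of x x] by (simp add: qform_def bform_def)

text \<open>Minimality over a convex set gives the variational inequality \<open>vi\<close>. Testing
  it on transfers of mass between p and a negative index yields the inequality for g; where
  \<open>w j\<close> is nonzero, transfers in both directions are feasible and give equality. The
  multiplier is the minimal value because the weights sum to 1.\<close>

lemma minimizer_kkt:
  assumes pm: "p < m" "m \<le> n" and w: "feasible n m p w"
    and min: "\<And>v. feasible n m p v \<Longrightarrow> qform {..<n} b w \<le> qform {..<n} b v"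
  defines "g \<equiv> \<lambda>i. \<Sum>j<n. b i j * w j" and "\<tau> \<equiv> qform {..<n} b w"
  shows "w p > 0" "\<tau> > 0" "g p = \<tau>"
    "\<And>j. j \<in> {m..<n} \<Longrightarrow> g j \<le> \<tau>" "\<And>j. j \<in> {m..<n} \<Longrightarrow> w j \<noteq> 0 \<Longrightarrow> g j = \<tau>"
proof -
  have wz: "w i = 0" if "i < m" "i \<noteq> p" for i using w that by (auto simp: feasible_def)
  have wn: "w i \<le> 0" if "i \<in> {m..<n}" for i using w that by (auto simp: feasible_def)
  have w1: "(\<Sum>i<n. w i) = 1" using w by (simp add: feasible_def)
  have dec: "(\<Sum>i<n. f i * w i) = f p * w p + (\<Sum>i\<in>{m..<n}. f i * w i)" for f
  proof -
    have "(\<Sum>i<n. f i * w i) = (\<Sum>i\<in>insert p {m..<n}. f i * w i)"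
      using pm wz by (intro sum.mono_neutral_right) (auto simp: not_le)
    thus ?thesis using pm by simp
  qed
  have wp1: "w p = 1 - (\<Sum>i\<in>{m..<n}. w i)" using dec[of "\<lambda>_. 1"] w1 by simp
  moreover have "(\<Sum>i\<in>{m..<n}. w i) \<le> 0" using wn by (intro sum_nonpos)
  ultimately show wp: "w p > 0" by simp
  have pn: "p < n" using pm by simp
  have "\<exists>i\<in>{..<n}. w i \<noteq> 0" using wp pn by (intro bexI[of _ p]) auto
  thus \<tau>: "\<tau> > 0" using b_pd unfolding \<tau>_def pos_def_on_def by blast
  have vi: "(\<Sum>i<n. g i * v i) \<ge> \<tau>" if v: "feasible n m p v" for v
  proof -
    define X where "X = (\<Sum>i<n. g i * v i) - \<tau>"
    define q where "q = qform {..<n} b (\<lambda>i. v i - w i)"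
    have q0: "q \<ge> 0" unfolding q_def by (rule qform_b_nonneg)
    have "bform {..<n} b (\<lambda>i. v i - w i) w = bform {..<n} b w (\<lambda>i. v i - w i)"
      using b_sym by (intro bform_commute) auto
    also have "\<dots> = X"
      unfolding bform_b X_def \<tau>_def qform_b g_def by (simp add: right_diff_distrib sum_subtractf)
    finally have bX: "bform {..<n} b (\<lambda>i. v i - w i) w = X" .
    have le: "0 \<le> 2 * X + s * q" if s: "0 < s" "s \<le> 1" for s
    proof -
      have "\<tau> \<le> qform {..<n} b (\<lambda>i. s * (v i - w i) + w i)"
        unfolding \<tau>_def using s v w by (intro min feasible_convex) auto
      also have "\<dots> = s\<^sup>2 * q + 2 * s * X + \<tau>"
        unfolding q_def \<tau>_def bX[symmetric] using b_sym by (intro qform_add) auto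
      finally have "0 \<le> s * (2 * X + s * q)" by (simp add: power2_eq_square algebra_simps)
      thus ?thesis using s by (simp add: zero_le_mult_iff)
    qed
    have "X \<ge> 0"
    proof (rule ccontr)
      assume "\<not> X \<ge> 0"
      hence X: "X < 0" by simp
      \<comment> \<open>Small enough that \<open>s * q \<le> - X\<close>, which contradicts
        \<open>0 \<le> 2 * X + s * q\<close> for negative \<open>X\<close>.\<close>
      define s where "s = min 1 (- X / (q + 1))"
      have s: "0 < s" "s \<le> 1" using X q0 by (auto simp: s_def intro!: divide_neg_pos)
      have "s * q \<le> - X / (q + 1) * q" unfolding s_def using q0 by (intro mult_right_mono) auto
      also have "\<dots> \<le> - X" using X q0 by (simp add: field_simps)
      finally show False using le[OF s] X by linarith
    qed
    thus ?thesis by (simp add: X_def)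
  qed
  have gp1: "g p \<ge> \<tau>"
    using vi[OF feasible_unit[OF pm]] pn by (simp add: if_distrib[of "\<lambda>x. _ * x"] cong: if_cong)
  have move: "s * (g p - g j) \<ge> 0" if j: "j \<in> {m..<n}" and s: "w p + s \<ge> 0" "w j - s \<le> 0" for j s
  proof -
    \<comment> \<open>Mass \<open>s\<close> is moved from j to p, so the total stays 1.\<close>
    define v where "v = (\<lambda>i. w i + s * (if i = p then 1 else 0) - s * (if i = j then 1 else 0))"
    have "feasible n m p v"
      using w s j pm pn unfolding feasible_def v_def
      by (auto simp: sum.distrib sum_subtractf simp flip: sum_distrib_left)
    from vi[OF this] have "\<tau> \<le> (\<Sum>i<n. g i * v i)" .
    also have "\<dots> = (\<Sum>i<n. g i * w i) + s * (\<Sum>i<n. if i = p then g i else 0) - s * (\<Sum>i<n. if i = j then g i else 0)"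
      unfolding sum_distrib_left sum.distrib[symmetric] sum_subtractf[symmetric] v_def
      by (intro sum.cong refl) (auto simp: algebra_simps)
    also have "(\<Sum>i<n. g i * w i) = \<tau>" unfolding \<tau>_def qform_b g_def ..
    finally show ?thesis using j pn by (simp add: algebra_simps)
  qed
  have gj1: "g j \<le> g p" if j: "j \<in> {m..<n}" for j
    using move[OF j, of 1] wp wn[OF j] by simp
  have gj2: "g j = g p" if j: "j \<in> {m..<n}" "w j \<noteq> 0" for j
  proof -
    have wj: "w j < 0" using wn[OF j(1)] j(2) by simp
    have "(\<Sum>i\<in>{m..<n}. w i) \<le> w j"
      using sum.remove[of "{m..<n}" j w] j(1) sum_nonpos[of "{m..<n} - {j}" w] wn by fastforce
    \<comment> \<open>The transfer by the negative amount \<open>w j\<close> empties coordinate j;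
      coordinate p stays nonnegative since \<open>w p + w j\<close> is at least 1.\<close>
    hence "w j * (g p - g j) \<ge> 0" using move[OF j(1), of "w j"] wp1 by simp
    hence "g p - g j \<le> 0" using wj by (simp add: zero_le_mult_iff)
    thus ?thesis using gj1[OF j(1)] by simp
  qed
  have "\<tau> = (\<Sum>i<n. g i * w i)" unfolding \<tau>_def qform_b g_def ..
  also have "\<dots> = g p * w p + (\<Sum>i\<in>{m..<n}. g i * w i)" by (rule dec)
  also have "(\<Sum>i\<in>{m..<n}. g i * w i) = (\<Sum>i\<in>{m..<n}. g p * w i)" using gj2 by (intro sum.cong refl) (metis mult_zero_right)
  also have "g p * w p + \<dots> = g p" unfolding wp1 by (simp add: algebra_simps sum_distrib_left)
  finally show gp: "g p = \<tau>" ..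
  show "\<And>j. j \<in> {m..<n} \<Longrightarrow> g j \<le> \<tau>" "\<And>j. j \<in> {m..<n} \<Longrightarrow> w j \<noteq> 0 \<Longrightarrow> g j = \<tau>"
    using gj1 gj2 gp by auto
qed

text \<open>If the conclusion failed, the two minimizers would coincide on \<open>{..<n}\<close>, although only the first
  one charges \<open>p\<close>.\<close>

lemma minimizer_separation:
  assumes pm: "p < m" "q < m" "p \<noteq> q" "m \<le> n"
    and w: "feasible n m p w" "\<And>v. feasible n m p v \<Longrightarrow> qform {..<n} b w \<le> qform {..<n} b v"
    and w': "feasible n m q w'" "\<And>v. feasible n m q v \<Longrightarrow> qform {..<n} b w' \<le> qform {..<n} b v"
    and le: "qform {..<n} b w' \<le> qform {..<n} b w"
  shows "(\<Sum>j<n. b q j * w j) < qform {..<n} b w"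
proof (rule ccontr)
  define g where "g = (\<lambda>i. \<Sum>j<n. b i j * w j)"
  define \<tau> where "\<tau> = qform {..<n} b w"
  assume "\<not> (\<Sum>j<n. b q j * w j) < qform {..<n} b w"
  hence gq: "g q \<ge> \<tau>" by (simp add: g_def \<tau>_def)
  have k: "w p > 0" "\<And>j. j \<in> {m..<n} \<Longrightarrow> g j \<le> \<tau>"
    unfolding g_def \<tau>_def using minimizer_kkt(1,4)[OF pm(1,4) w] by auto
  \<comment> \<open>The gradient \<open>g\<close> at w is tested against w'. With g q \<ge> \<tau>
    this makes the mixed form at least \<tau>; as the value at w' is at most \<tau>, the form at w'
    - w cannot be positive.\<close>
  have "\<tau> = (\<Sum>i<n. \<tau> * w' i)" using w'(1) by (simp add: feasible_def flip: sum_distrib_left)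
  also have "\<dots> \<le> (\<Sum>i<n. g i * w' i)"
  proof (rule sum_mono)
    fix i assume i: "i \<in> {..<n}"
    consider "i < m" "i \<noteq> q" | "i = q" | "i \<in> {m..<n}" using i by fastforce
    thus "\<tau> * w' i \<le> g i * w' i"
    proof cases
      case 1 thus ?thesis using w'(1) by (simp add: feasible_def)
    next
      case 2 thus ?thesis using w'(1) gq by (intro mult_right_mono) (auto simp: feasible_def)
    next
      case 3 thus ?thesis using w'(1) k(2)[of i] by (intro mult_right_mono_neg) (auto simp: feasible_def)
    qed
  qed
  also have "\<dots> = bform {..<n} b w w'" unfolding bform_b g_def ..
  finally have 1: "\<tau> \<le> bform {..<n} b w w'" .
  have "qform {..<n} b (\<lambda>i. (-1) * w i + w' i) = (-1)\<^sup>2 * \<tau> + 2 * (-1) * bform {..<n} b w w' + qform {..<n} b w'"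
    unfolding \<tau>_def using b_sym by (intro qform_add) auto
  hence "qform {..<n} b (\<lambda>i. (-1) * w i + w' i) \<le> 0" using 1 le by (simp add: \<tau>_def)
  from qform_zero_imp[OF this, of p] have "w' p = w p" using pm by simp
  moreover have "w' p = 0" using w'(1) pm by (simp add: feasible_def)
  ultimately show False using k(1) by simp
qed

end

section \<open>The constants of the asymptotic formula\<close>

lemma scalar_prod_mult_mat_vec:
  fixes A :: "real mat"
  assumes "A \<in> carrier_mat n n" "v \<in> carrier_vec n" "w \<in> carrier_vec n"
  shows "v \<bullet> (A *\<^sub>v w) = (\<Sum>i<n. \<Sum>j<n. A $$ (i, j) * v $ i * w $ j)"
proof -
  have "v \<bullet> (A *\<^sub>v w) = (\<Sum>i<n. v $ i * (\<Sum>j<n. A $$ (i, j) * w $ j))"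
    using assms by (auto simp: scalar_prod_def lessThan_atLeast0 row_def intro!: sum.cong)
  thus ?thesis by (simp add: sum_distrib_left mult_ac)
qed

lemma mat_inverse_right:
  fixes A :: "real mat"
  assumes A: "A \<in> carrier_mat n n" and d: "det A \<noteq> 0"
  shows "the (mat_inverse A) \<in> carrier_mat n n" "A * the (mat_inverse A) = 1\<^sub>m n" "the (mat_inverse A) * A = 1\<^sub>m n"
    "det (the (mat_inverse A)) = 1 / det A"
    "\<And>i k. i < n \<Longrightarrow> k < n \<Longrightarrow> (\<Sum>j<n. A $$ (i, j) * the (mat_inverse A) $$ (j, k)) = (if i = k then 1 else 0)"
proof -
  have "mat_inverse A \<noteq> None"
    using mat_inverse(1)[OF A, where b = "()"] det_non_zero_imp_unit[OF A d, where b = "()"] by blast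
  then obtain X where X: "mat_inverse A = Some X" by blast
  from mat_inverse(2)[OF A X]
  show 1: "the (mat_inverse A) \<in> carrier_mat n n" "A * the (mat_inverse A) = 1\<^sub>m n" "the (mat_inverse A) * A = 1\<^sub>m n"
    by (auto simp: X)
  have "det A * det (the (mat_inverse A)) = 1" using det_mult[OF A 1(1)] 1(2) by simp
  thus "det (the (mat_inverse A)) = 1 / det A" using d by (simp add: field_simps)
  fix i k assume ik: "i < n" "k < n"
  have "(A * the (mat_inverse A)) $$ (i, k) = (\<Sum>j<n. A $$ (i, j) * the (mat_inverse A) $$ (j, k))"
    using A 1(1) ik by (auto simp: scalar_prod_def lessThan_atLeast0 intro!: sum.cong)
  thus "(\<Sum>j<n. A $$ (i, j) * the (mat_inverse A) $$ (j, k)) = (if i = k then 1 else 0)"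
    unfolding 1(2) using ik by simp
qed

lemma bij_betw_pick:
  assumes "finite I" shows "bij_betw (pick I) {..<card I} I"
proof -
  have inj: "inj_on (pick I) {..<card I}"
  proof (rule linorder_inj_onI)
    fix x y assume "x < y" "x \<in> {..<card I}" "y \<in> {..<card I}"
    thus "pick I x \<noteq> pick I y" using pick_mono_le[of y I x] by auto
  qed auto
  moreover have "pick I ` {..<card I} \<subseteq> I" using pick_in_set_le[of _ I] by auto
  ultimately show ?thesis
    unfolding bij_betw_def using assms card_subset_eq[of I "pick I ` {..<card I}"] card_image[OF inj] by auto
qed

lemma Delta_feasible:
  assumes "p < m" "m \<le> n"
  shows "v \<in> Delta_mnp m n p \<Longrightarrow> feasible n m p (\<lambda>i. v $ i)"
    and "feasible n m p f \<Longrightarrow> vec n f \<in> Delta_mnp m n p"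
  using assms unfolding feasible_def Delta_mnp_def by auto

context gaussian_law
begin

text \<open>The definite description in \<open>wbar\<close> can be resolved once existence and
  uniqueness, known for feasible functions, have been transported to vectors.\<close>

lemma wbar_minimizer:
  assumes B: "B \<in> carrier_mat n n" and bB: "\<And>i j. b i j = B $$ (i, j)" and pm: "p < m" "m \<le> n"
  shows "feasible n m p (\<lambda>i. wbar B m n p $ i)"
    and "\<And>v. feasible n m p v \<Longrightarrow> qform {..<n} b (\<lambda>i. wbar B m n p $ i) \<le> qform {..<n} b v"
    and "wbar B m n p \<in> carrier_vec n"
proof -
  have q: "v \<bullet> (B *\<^sub>v v) = qform {..<n} b (\<lambda>i. v $ i)" if "v \<in> carrier_vec n" for v
    using scalar_prod_mult_mat_vec[OF B that that] by (simp add: qform_def bB)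
  have car: "v \<in> carrier_vec n" if "v \<in> Delta_mnp m n p" for v using that by (simp add: Delta_mnp_def)
  let ?M = "\<lambda>w. w \<in> Delta_mnp m n p \<and> (\<forall>v\<in>Delta_mnp m n p. w \<bullet> (B *\<^sub>v w) \<le> v \<bullet> (B *\<^sub>v v))"
  have M: "feasible n m p (\<lambda>i. w $ i) \<and> (\<forall>v. feasible n m p v \<longrightarrow> qform {..<n} b (\<lambda>i. w $ i) \<le> qform {..<n} b v)" if "?M w" for w
  proof (intro conjI allI impI)
    show "feasible n m p (\<lambda>i. w $ i)" using that Delta_feasible(1)[OF pm] by blast
    fix v assume "feasible n m p v"
    hence "vec n v \<in> Delta_mnp m n p" by (rule Delta_feasible(2)[OF pm])
    hence "w \<bullet> (B *\<^sub>v w) \<le> vec n v \<bullet> (B *\<^sub>v vec n v)" using that by blast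
    also have "\<dots> = qform {..<n} b (\<lambda>i. vec n v $ i)" by (rule q) simp
    also have "\<dots> = qform {..<n} b v" by (intro qform_cong) simp
    finally show "qform {..<n} b (\<lambda>i. w $ i) \<le> qform {..<n} b v" using q[of w] car that by simp
  qed
  have "\<exists>!w. ?M w"
  proof (rule ex_ex1I)
    obtain f where f: "feasible n m p f" "\<And>v. feasible n m p v \<Longrightarrow> qform {..<n} b f \<le> qform {..<n} b v"
      using minimizer_exists[OF pm] by blast
    have "?M (vec n f)"
    proof (intro conjI ballI)
      show "vec n f \<in> Delta_mnp m n p" by (rule Delta_feasible(2)[OF pm f(1)])
      fix v assume v: "v \<in> Delta_mnp m n p"
      have "vec n f \<bullet> (B *\<^sub>v vec n f) = qform {..<n} b (\<lambda>i. vec n f $ i)" by (rule q) simp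
      also have "\<dots> = qform {..<n} b f" by (intro qform_cong) simp
      also have "\<dots> \<le> qform {..<n} b (\<lambda>i. v $ i)" using f(2) Delta_feasible(1)[OF pm v] by blast
      finally show "vec n f \<bullet> (B *\<^sub>v vec n f) \<le> v \<bullet> (B *\<^sub>v v)" using q[OF car[OF v]] by simp
    qed
    thus "\<exists>w. ?M w" by blast
  next
    fix w w' assume w: "?M w" "?M w'"
    show "w = w'"
    proof (rule eq_vecI)
      fix i assume "i < dim_vec w'"
      hence "i < n" using car[OF conjunct1[OF w(2)]] by simp
      thus "w $ i = w' $ i" using M[OF w(1)] M[OF w(2)] by (intro minimizer_unique) auto
    qed (use car[OF conjunct1[OF w(1)]] car[OF conjunct1[OF w(2)]] in simp)
  qed
  from theI'[OF this] have "?M (wbar B m n p)" unfolding wbar_def .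
  from M[OF this] car this show "feasible n m p (\<lambda>i. wbar B m n p $ i)"
    "\<And>v. feasible n m p v \<Longrightarrow> qform {..<n} b (\<lambda>i. wbar B m n p $ i) \<le> qform {..<n} b v"
    "wbar B m n p \<in> carrier_vec n" by blast+
qed

text \<open>\<open>\<alpha>\<close> is the inverse of the submatrix carried back along
  \<open>h\<close> to the original indices in \<open>I\<close>, so that it fits sums over
  \<open>I\<close>; renumbering it again recovers the inverse matrix and its determinant.\<close>

lemma submatrix_inverse:
  assumes I: "I \<subseteq> {..<n}" and h: "bij_betw h {..<N} I"
  defines "Bb \<equiv> mat N N (\<lambda>(r, s). b (h r) (h s))"
  defines "Ai \<equiv> the (mat_inverse Bb)"
  defines "\<alpha> \<equiv> \<lambda>i j. Ai $$ (the_inv_into {..<N} h i, the_inv_into {..<N} h j)"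
  shows "det Bb > 0" "\<And>r s. r < N \<Longrightarrow> s < N \<Longrightarrow> \<alpha> (h r) (h s) = Ai $$ (r, s)"
    "det (mat N N (\<lambda>(r, s). \<alpha> (h r) (h s))) = 1 / det Bb"
    "\<And>i k. i \<in> I \<Longrightarrow> k \<in> I \<Longrightarrow> (\<Sum>j\<in>I. b i j * \<alpha> j k) = (if i = k then 1 else 0)"
proof -
  define g where "g = the_inv_into {..<N} h"
  have gh: "g (h r) = r" if "r < N" for r
    using that h by (simp add: g_def the_inv_into_f_f bij_betw_def)
  have hI: "h r \<in> I" if "r < N" for r using h that by (auto simp: bij_betw_def)
  have hn: "h r < n" if "r < N" for r using hI[OF that] I by auto
  have "pos_def_on {..<N} (\<lambda>r s. b (h r) (h s))"
    unfolding pos_def_on_def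
  proof (intro allI impI)
    fix v :: "nat \<Rightarrow> real" assume "\<exists>i\<in>{..<N}. v i \<noteq> 0"
    then obtain r where r: "r < N" "v r \<noteq> 0" by auto
    define w where "w = (\<lambda>i. if i \<in> I then v (g i) else 0)"
    have wh: "w (h r) = v r" if "r < N" for r using that by (simp add: w_def hI gh)
    have "\<exists>i\<in>{..<n}. w i \<noteq> 0" using r wh[OF r(1)] hn[OF r(1)] by (intro bexI[of _ "h r"]) auto
    hence "qform {..<n} b w > 0" using b_pd by (simp add: pos_def_on_def)
    also have "qform {..<n} b w = qform I b w"
    proof -
      have "(\<Sum>j<n. b i j * w i * w j) = (\<Sum>j\<in>I. b i j * w i * w j)" for i
        using I by (intro sum.mono_neutral_right) (auto simp: w_def)
      moreover have "(\<Sum>i<n. \<Sum>j\<in>I. b i j * w i * w j) = (\<Sum>i\<in>I. \<Sum>j\<in>I. b i j * w i * w j)"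
        using I by (intro sum.mono_neutral_right) (auto simp: w_def)
      ultimately show ?thesis by (simp add: qform_def)
    qed
    also have "qform I b w = qform {..<N} (\<lambda>r s. b (h r) (h s)) (\<lambda>r. w (h r))"
      unfolding qform_def by (simp add: sum.reindex_bij_betw[OF h, symmetric])
    also have "\<dots> = qform {..<N} (\<lambda>r s. b (h r) (h s)) v" using wh by (intro qform_cong) auto
    finally show "qform {..<N} (\<lambda>r s. b (h r) (h s)) v > 0" .
  qed
  thus dp: "det Bb > 0"
    unfolding Bb_def using nn_integral_gaussian_det[of N "\<lambda>r s. b (h r) (h s)"] b_sym hn by blast
  have Bbc: "Bb \<in> carrier_mat N N" by (simp add: Bb_def)
  note mi = mat_inverse_right[OF Bbc, folded Ai_def]
  show \<alpha>h: "\<alpha> (h r) (h s) = Ai $$ (r, s)" if "r < N" "s < N" for r s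
    using gh that by (simp add: \<alpha>_def g_def)
  have Ac: "Ai \<in> carrier_mat N N" using mi(1) dp by simp
  have "mat N N (\<lambda>(r, s). \<alpha> (h r) (h s)) = Ai"
    using Ac \<alpha>h by (intro eq_matI) auto
  thus "det (mat N N (\<lambda>(r, s). \<alpha> (h r) (h s))) = 1 / det Bb" using mi(4) dp by simp
  fix i k assume ik: "i \<in> I" "k \<in> I"
  then obtain r q where rq: "r < N" "q < N" "i = h r" "k = h q" using h by (auto simp: bij_betw_def)
  have "(\<Sum>j\<in>I. b i j * \<alpha> j k) = (\<Sum>s<N. b (h r) (h s) * \<alpha> (h s) (h q))"
    unfolding rq by (rule sum.reindex_bij_betw[OF h, symmetric])
  also have "\<dots> = (\<Sum>s<N. Bb $$ (r, s) * Ai $$ (s, q))"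
    using rq \<alpha>h by (intro sum.cong) (auto simp: Bb_def)
  also have "\<dots> = (if r = q then 1 else 0)" using mi(5)[OF _ rq(1,2)] dp by simp
  also have "\<dots> = (if i = k then 1 else 0)" using gh[OF rq(1)] gh[OF rq(2)] rq by auto
  finally show "(\<Sum>j\<in>I. b i j * \<alpha> j k) = (if i = k then 1 else 0)" .
qed

text \<open>By stationarity b w is constantly \<tau> on the active set. So u = w / \<tau> solves b u
  = 1 there and is the vector of row sums of the inverse submatrix, that is, of the values
  \<open>Abar\<close>; summing gives \<open>Sbar\<close> = 1 / \<tau>.\<close>

lemma wbar_asymp:
  assumes B: "B \<in> carrier_mat n n" and bB: "\<And>i j. b i j = B $$ (i, j)" and mu: "mvec \<in> carrier_vec n" "\<And>i. \<mu> i = mvec $ i"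
    and pm: "p < m" "m \<le> n"
  defines "w \<equiv> \<lambda>i. wbar B m n p $ i"
  defines "\<tau> \<equiv> qform {..<n} b w"
  shows "delta4p B m n p = \<tau>" "delta1p mvec B m n p > 0"
    "(\<lambda>t. measure law {y \<in> space law. sgn_sum p {i \<in> {m..<n}. w i \<noteq> 0} y > exp t}
        - delta1p mvec B m n p * gtail (1 / \<tau>) (delta2p B m n p) (delta3p mvec B m n p) t)
      \<in> O(\<lambda>t. delta1p mvec B m n p * gtail (1 / \<tau>) (delta2p B m n p) (delta3p mvec B m n p) t * t powr (-1/2))"
proof -
  note wm = wbar_minimizer[OF B bB pm, folded w_def]
  define g where "g = (\<lambda>i. \<Sum>j<n. b i j * w j)"
  have k: "w p > 0" "\<tau> > 0" "g p = \<tau>" "\<And>j. j \<in> {m..<n} \<Longrightarrow> g j \<le> \<tau>" "\<And>j. j \<in> {m..<n} \<Longrightarrow> w j \<noteq> 0 \<Longrightarrow> g j = \<tau>"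
    unfolding g_def \<tau>_def using minimizer_kkt[OF pm wm(1,2)] by auto
  have wz: "w i = 0" if "i < m" "i \<noteq> p" for i using wm(1) that by (auto simp: feasible_def)
  have wn: "w i \<le> 0" if "i \<in> {m..<n}" for i using wm(1) that by (auto simp: feasible_def)
  have w1: "(\<Sum>i<n. w i) = 1" using wm(1) by (simp add: feasible_def)
  define I where "I = Ibar B m n p"
  have I: "I = insert p {i \<in> {m..<n}. w i \<noteq> 0}"
    unfolding I_def Ibar_def w_def[symmetric] using wz k(1) pm by (auto simp: w_def not_le) (metis not_le)
  have In: "I \<subseteq> {..<n}" using pm by (auto simp: I)
  have fin: "finite I" using In finite_subset by blast
  define N where "N = nbar B m n p"
  have N: "N = card I" by (simp add: N_def nbar_def I_def)
  define h where "h = pick I"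
  have h: "bij_betw h {..<N} I" unfolding h_def N by (rule bij_betw_pick[OF fin])
  define Bb where "Bb = mat N N (\<lambda>(r, s). b (h r) (h s))"
  have Bbar: "Bbar B m n p = Bb"
  proof -
    have "{i. i < n \<and> i \<in> I} = I" using In by auto
    thus ?thesis unfolding Bbar_def I_def[symmetric] submatrix_def Bb_def h_def N using B by (simp add: bB)
  qed
  define Ai where "Ai = the (mat_inverse Bb)"
  have abar: "abar B m n p = Ai" by (simp add: abar_def Bbar Ai_def)
  define \<alpha> where "\<alpha> = (\<lambda>i j. Ai $$ (the_inv_into {..<N} h i, the_inv_into {..<N} h j))"
  have si: "det Bb > 0" "\<And>r s. r < N \<Longrightarrow> s < N \<Longrightarrow> \<alpha> (h r) (h s) = Ai $$ (r, s)"
    "det (mat N N (\<lambda>(r, s). \<alpha> (h r) (h s))) = 1 / det Bb"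
    "\<And>i k. i \<in> I \<Longrightarrow> k \<in> I \<Longrightarrow> (\<Sum>j\<in>I. b i j * \<alpha> j k) = (if i = k then 1 else 0)"
    unfolding \<alpha>_def Ai_def Bb_def by (rule submatrix_inverse[OF In h]; assumption)+
  have \<alpha>s: "\<alpha> i j = \<alpha> j i" if "i \<in> I" "j \<in> I" for i j
    by (rule right_inverse_sym[of I b]) (use fin b_sym In si(4) that in auto)
  define u where "u = (\<lambda>i. w i / \<tau>)"
  have gI: "g i = \<tau>" if "i \<in> I" for i using that k I by auto
  have wI: "w i = 0" if "i < n" "i \<notin> I" for i using that wz[of i] by (auto simp: I not_le)
  have bu: "(\<Sum>j\<in>I. b i j * u j) = 1" if "i \<in> I" for i
  proof -
    have "g i = (\<Sum>j\<in>I. b i j * w j)"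
      unfolding g_def using In wI by (intro sum.mono_neutral_right) auto
    hence "(\<Sum>j\<in>I. b i j * w j) / \<tau> = 1" using gI[OF that] k by simp
    thus ?thesis by (simp add: u_def sum_divide_distrib)
  qed
  have \<alpha>1: "u i = (\<Sum>j\<in>I. \<alpha> i j)" if i: "i \<in> I" for i
  proof -
    have "(\<Sum>j\<in>I. \<alpha> i j) = (\<Sum>j\<in>I. \<alpha> i j * (\<Sum>l\<in>I. b j l * u l))" using bu by simp
    also have "\<dots> = (\<Sum>l\<in>I. \<Sum>j\<in>I. \<alpha> i j * (b j l * u l))"
      unfolding sum_distrib_left by (rule sum.swap)
    also have "\<dots> = (\<Sum>l\<in>I. (\<Sum>j\<in>I. b l j * \<alpha> j i) * u l)"
      unfolding sum_distrib_right
    proof (intro sum.cong refl)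
      fix l j assume "l \<in> I" "j \<in> I"
      hence "j < n" "l < n" using In by auto
      have e: "\<alpha> i j = \<alpha> j i" "b j l = b l j"
        using \<open>j \<in> I\<close> \<open>j < n\<close> \<open>l < n\<close> by (auto intro: \<alpha>s i b_sym)
      show "\<alpha> i j * (b j l * u l) = b l j * \<alpha> j i * u l" unfolding e by simp
    qed
    also have "\<dots> = (\<Sum>l\<in>I. if l = i then u l else 0)" using si(4) i by (intro sum.cong) auto
    also have "\<dots> = u i" using i fin by simp
    finally show ?thesis ..
  qed
  have Abar: "Abar B m n p r = u (h r)" if r: "r < N" for r
  proof -
    have "h r \<in> I" using h r by (auto simp: bij_betw_def)
    hence "u (h r) = (\<Sum>s<N. \<alpha> (h r) (h s))" using \<alpha>1 by (simp add: sum.reindex_bij_betw[OF h])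
    also have "\<dots> = Abar B m n p r" unfolding Abar_def abar N_def[symmetric] using si(2) r by (intro sum.cong) auto
    finally show ?thesis ..
  qed
  define S where "S = 1 / \<tau>"
  have S0: "S > 0" using k by (simp add: S_def)
  have Su: "S = (\<Sum>i\<in>I. u i)"
  proof -
    have "(\<Sum>i\<in>I. w i) = (\<Sum>i<n. w i)" using In wI by (intro sum.mono_neutral_left) auto
    thus ?thesis using w1 by (simp add: u_def S_def flip: sum_divide_distrib)
  qed
  have Sbar: "Sbar B m n p = S"
    unfolding Sbar_def N_def[symmetric] Su using Abar by (simp add: sum.reindex_bij_betw[OF h, symmetric])
  show "delta4p B m n p = \<tau>" by (simp add: delta4p_def Sbar S_def)
  have mub: "mubar mvec B m n p $ r = \<mu> (h r)" if "r < N" for r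
    using that by (simp add: mubar_def N_def[symmetric] h_def I_def mu)
  have Lb: "Lbar mvec B m n p r = ln (S / \<bar>u (h r)\<bar>) + \<mu> (h r)" if "r < N" for r
    unfolding Lbar_def Sbar using Abar mub that by simp
  have d3: "delta3p mvec B m n p = (\<Sum>i\<in>I. u i * (ln (S / \<bar>u i\<bar>) + \<mu> i))"
    unfolding delta3p_def N_def[symmetric] sum.reindex_bij_betw[OF h, symmetric]
    using Lb Abar by (intro sum.cong) auto
  have q: "(\<Sum>i<N. \<Sum>l<N. abar B m n p $$ (i, l) * Lbar mvec B m n p i * Lbar mvec B m n p l)
      = qform I \<alpha> (\<lambda>i. ln (S / \<bar>u i\<bar>) + \<mu> i)"
    unfolding qform_def sum.reindex_bij_betw[OF h, symmetric] abar
    using Lb si(2) by (intro sum.cong) auto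
  have pr: "(\<Prod>i<N. \<bar>Abar B m n p i\<bar>) = (\<Prod>i\<in>I. \<bar>u i\<bar>)"
    unfolding prod.reindex_bij_betw[OF h, symmetric] using Abar by (intro prod.cong) auto
  have unz: "\<bar>u i\<bar> > 0" if "i \<in> I" for i using that k I by (auto simp: u_def)
  have prpos: "(\<Prod>i\<in>I. \<bar>u i\<bar>) > 0" using unz by (intro prod_pos)
  have d1: "delta1p mvec B m n p = sqrt (1 / det Bb) / sqrt (2 * pi) / sqrt (S * (\<Prod>i\<in>I. \<bar>u i\<bar>)) *
       exp (- qform I \<alpha> (\<lambda>i. ln (S / \<bar>u i\<bar>) + \<mu> i) / 2)"
  proof -
    \<comment> \<open>Dividing \<open>Cp\<close> by S turns its square root into the prefactor that
      Stirling's formula produces.\<close>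
    have 1: "sqrt (S / (\<Prod>i\<in>I. \<bar>u i\<bar>)) / S = 1 / sqrt (S * (\<Prod>i\<in>I. \<bar>u i\<bar>))"
      using S0 prpos by (simp add: real_sqrt_divide real_sqrt_mult field_simps)
    have 2: "1 / sqrt (2 * pi * det Bb) = sqrt (1 / det Bb) / sqrt (2 * pi)"
      using si(1) by (simp add: real_sqrt_divide real_sqrt_mult)
    have 3: "r * s * X / S = r * (s / S) * X" for r s X :: real by simp
    have "1 / sqrt (2 * pi * det Bb) * sqrt (S / (\<Prod>i\<in>I. \<bar>u i\<bar>)) * X / S =
      sqrt (1 / det Bb) / sqrt (2 * pi) / sqrt (S * (\<Prod>i\<in>I. \<bar>u i\<bar>)) * X" for X
      unfolding 3 1 2 by simp
    thus ?thesis unfolding delta1p_def Cp_def Sbar Bbar N_def[symmetric] q pr by simp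
  qed
  show "delta1p mvec B m n p > 0"
    unfolding d1 using si(1) S0 prpos by simp
  have J: "{i \<in> {m..<n}. w i \<noteq> 0} = I - {p}" using pm by (auto simp: I)
  have pI: "p \<in> I" by (simp add: I)
  have neg: "u j < 0" if "j \<in> I - {p}" for j
  proof -
    have "w j \<le> 0" "w j \<noteq> 0" using that wn[of j] unfolding J[symmetric] by auto
    thus ?thesis using k(2) by (simp add: u_def divide_neg_pos)
  qed
  show "(\<lambda>t. measure law {y \<in> space law. sgn_sum p {i \<in> {m..<n}. w i \<noteq> 0} y > exp t}
        - delta1p mvec B m n p * gtail (1 / \<tau>) (delta2p B m n p) (delta3p mvec B m n p) t)
      \<in> O(\<lambda>t. delta1p mvec B m n p * gtail (1 / \<tau>) (delta2p B m n p) (delta3p mvec B m n p) t * t powr (-1/2))"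
    using law_sgn_sum_asymp[OF In pI refl si(4) \<alpha>1 neg S0 Su h si(3)[symmetric]]
    unfolding d1 d3 gtail_def delta2p_def N_def[symmetric] S_def[symmetric] J
    by (simp add: mult.assoc)
qed

end

section \<open>From the law of Y to the asymptotics in x\<close>

theorem theorem3:
  fixes M :: "'a measure" and Y :: "'a \<Rightarrow> nat \<Rightarrow> real"
    and \<mu> :: "real vec" and B :: "real mat" and m n :: nat
  assumes "prob_space M"
    and "\<mu> \<in> carrier_vec n"
    and "B \<in> carrier_mat n n"
    and "transpose_mat B = B"
    and "\<forall>v\<in>carrier_vec n. v \<noteq> 0\<^sub>v n \<longrightarrow> v \<bullet> (B *\<^sub>v v) > 0"
    and "det B > 0"
    and "1 \<le> m" and "m \<le> n"
    and "distributed M (Pi\<^sub>M {..<n} (\<lambda>_. lborel)) Y (gauss_density n \<mu> B)"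
    and "\<forall>p<m. assumption_A1 B m n p"
  shows "(\<lambda>x. measure M {\<omega> \<in> space M. Xm m n (Y \<omega>) \<ge> x}
              - delta1 \<mu> B m n * ln x powr delta2 \<mu> B m n * x powr delta3 \<mu> B m n
                * exp (- (ln x)\<^sup>2 / (2 * delta4 B m n)))
         \<in> O[at_top](\<lambda>x. delta1 \<mu> B m n * ln x powr delta2 \<mu> B m n * x powr delta3 \<mu> B m n
                * exp (- (ln x)\<^sup>2 / (2 * delta4 B m n)) * ln x powr (-1/2))"
proof -
  note BC = assms(3)
  define b where "b = (\<lambda>i j. B $$ (i, j))"
  define P where "P = (\<lambda>i j. the (mat_inverse B) $$ (i, j))"
  define c where "c = 1 / sqrt ((2 * pi) ^ n * det B)"
  define mu where "mu = (\<lambda>i. \<mu> $ i)"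
  have mi: "the (mat_inverse B) \<in> carrier_mat n n"
    "\<And>i k. i < n \<Longrightarrow> k < n \<Longrightarrow> (\<Sum>j<n. b i j * P j k) = (if i = k then 1 else 0)"
    using mat_inverse_right[OF BC] assms(6) by (auto simp: b_def P_def)
  have bs: "b i j = b j i" if "i < n" "j < n" for i j
  proof -
    have "transpose_mat B $$ (i, j) = B $$ (j, i)" using that BC by simp
    thus ?thesis unfolding assms(4) b_def .
  qed
  have Ps: "P i j = P j i" if "i < n" "j < n" for i j
    by (rule right_inverse_sym[of "{..<n}" b]) (use bs mi(2) that in auto)
  have pd: "pos_def_on {..<n} b"
    unfolding pos_def_on_def
  proof (intro allI impI)
    fix v :: "nat \<Rightarrow> real" assume "\<exists>i\<in>{..<n}. v i \<noteq> 0"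
    then obtain i where "i < n" "v i \<noteq> 0" by auto
    hence "vec n v $ i \<noteq> (0\<^sub>v n :: real vec) $ i" by simp
    hence "vec n v \<noteq> 0\<^sub>v n" by metis
    hence "vec n v \<bullet> (B *\<^sub>v vec n v) > 0" using assms(5) by simp
    also have "vec n v \<bullet> (B *\<^sub>v vec n v) = qform {..<n} b (\<lambda>i. vec n v $ i)"
      using scalar_prod_mult_mat_vec[OF BC] by (simp add: qform_def b_def)
    also have "\<dots> = qform {..<n} b v" by (intro qform_cong) simp
    finally show "qform {..<n} b v > 0" .
  qed
  have dens: "gauss_density n \<mu> B y = ennreal (c * exp (- qform {..<n} P (\<lambda>i. y i - mu i) / 2))" for y
  proof -
    have "(vec n y - \<mu>) \<bullet> (the (mat_inverse B) *\<^sub>v (vec n y - \<mu>)) = qform {..<n} P (\<lambda>i. (vec n y - \<mu>) $ i)"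
      using scalar_prod_mult_mat_vec[OF mi(1), of "vec n y - \<mu>" "vec n y - \<mu>"] assms(2)
      by (simp add: qform_def P_def minus_carrier_vec)
    also have "\<dots> = qform {..<n} P (\<lambda>i. y i - mu i)"
      using assms(2) by (intro qform_cong) (simp add: mu_def)
    finally show ?thesis by (simp add: gauss_density_def c_def)
  qed
  interpret M: prob_space M by (rule assms(1))
  have dist: "distr M (lborel_PiM {..<n}) Y = density (lborel_PiM {..<n}) (gauss_density n \<mu> B)"
    and Ym [measurable]: "Y \<in> M \<rightarrow>\<^sub>M lborel_PiM {..<n}"
    using assms(9) by (auto simp: distributed_def)
  have dm: "gauss_density n \<mu> B \<in> borel_measurable (lborel_PiM {..<n})"
    using assms(9) by (auto simp: distributed_def)
  have tot: "(\<integral>\<^sup>+y. ennreal (c * exp (- qform {..<n} P (\<lambda>i. y i - mu i) / 2)) \<partial>lborel_PiM {..<n}) = 1"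
  proof -
    have "prob_space (density (lborel_PiM {..<n}) (gauss_density n \<mu> B))"
      unfolding dist[symmetric] by (rule M.prob_space_distr[OF Ym])
    from prob_space.emeasure_space_1[OF this] show ?thesis
      using dm by (simp add: emeasure_density dens)
  qed
  have c: "c > 0" using assms(6) by (simp add: c_def)
  interpret L: gaussian_law n b P mu c
    by standard (use bs Ps mi(2) pd c tot in auto)
  have law: "L.law = distr M (lborel_PiM {..<n}) Y"
  proof -
    have "gauss_density n \<mu> B = (\<lambda>y. ennreal (L.law_density y))" by (rule ext) (simp add: dens L.law_density_def)
    thus ?thesis unfolding dist L.law_def by simp
  qed
  have bB: "\<And>i j. b i j = B $$ (i, j)" by (simp add: b_def)
  have muv: "\<And>i. mu i = \<mu> $ i" by (simp add: mu_def)
  define w where "w = (\<lambda>p i. wbar B m n p $ i)"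
  define \<tau> where "\<tau> = (\<lambda>p. qform {..<n} b (w p))"
  \<comment> \<open>Scaled so that the dominating point \<open>ys p\<close> has coordinate 1 at p;
    the total of \<open>u p\<close> and its pairing with \<open>ys p\<close> are then both 1 /
    \<tau>.\<close>
  define u where "u = (\<lambda>p i. w p i / \<tau> p)"
  define ys where "ys = (\<lambda>p i. \<Sum>j<n. b i j * u p j)"
  have feas: "feasible n m p (w p)" "\<And>v. feasible n m p v \<Longrightarrow> qform {..<n} b (w p) \<le> qform {..<n} b v" if "p < m" for p
    unfolding w_def using L.wbar_minimizer[OF BC bB that assms(8)] by auto
  have kkt: "w p p > 0" "\<tau> p > 0" "(\<Sum>j<n. b p j * w p j) = \<tau> p"
    "\<And>j. j \<in> {m..<n} \<Longrightarrow> (\<Sum>i<n. b j i * w p i) \<le> \<tau> p" if "p < m" for p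
    unfolding \<tau>_def using L.minimizer_kkt[OF that assms(8) feas[OF that]] by auto
  have ysw: "ys p i = (\<Sum>j<n. b i j * w p j) / \<tau> p" for p i
    by (simp add: ys_def u_def sum_divide_distrib)
  have lc: "delta4p B m n p = \<tau> p" "delta1p \<mu> B m n p > 0"
    "(\<lambda>t. measure L.law {y \<in> space L.law. sgn_sum p {i \<in> {m..<n}. w p i \<noteq> 0} y > exp t}
        - delta1p \<mu> B m n p * gtail (1 / \<tau> p) (delta2p B m n p) (delta3p \<mu> B m n p) t)
      \<in> O(\<lambda>t. delta1p \<mu> B m n p * gtail (1 / \<tau> p) (delta2p B m n p) (delta3p \<mu> B m n p) t * t powr (-1/2))" if "p < m" for p
    using L.wbar_asymp[OF BC bB assms(2) muv that assms(8)] unfolding w_def \<tau>_def by auto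
  define d4 where "d4 = delta4 B m n"
  have ne: "{..<m} \<noteq> {}" using assms(7) by (auto simp: lessThan_empty_iff)
  have d4max: "\<tau> p \<le> d4" if "p < m" for p
    unfolding d4_def delta4_def lc(1)[OF that, symmetric] using that by (intro Max_ge) auto
  have P4: "P4 B m n = {p. p < m \<and> \<tau> p = d4}" unfolding P4_def d4_def using lc(1) by auto
  have "d4 \<in> (\<lambda>p. delta4p B m n p) ` {..<m}" unfolding d4_def delta4_def using ne by (intro Max_in) auto
  hence P4ne: "P4 B m n \<noteq> {}" unfolding P4 using lc(1) by auto
  have P4fin: "finite (P4 B m n)" unfolding P4 by simp
  have d40: "d4 > 0" using P4ne kkt(2) unfolding P4 by auto
  have P3ne: "P3 \<mu> B m n \<noteq> {}"
    using Max_in[of "(\<lambda>p. delta3p \<mu> B m n p) ` P4 B m n"] P4fin P4ne unfolding P3_def delta3_def by fastforce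
  have P3fin: "finite (P3 \<mu> B m n)" using P4fin by (simp add: P3_def)
  have P2ne: "P2 \<mu> B m n \<noteq> {}"
    using Max_in[of "(\<lambda>p. delta2p B m n p) ` P3 \<mu> B m n"] P3fin P3ne unfolding P2_def delta2_def by fastforce
  have P2P4: "P2 \<mu> B m n \<subseteq> P4 B m n" by (auto simp: P2_def P3_def)
  \<comment> \<open>Positivity allows the factor \<open>delta1\<close> inside the error term, so
    that the error is relative to the main term.\<close>
  have d1pos: "delta1 \<mu> B m n > 0"
    unfolding delta1_def using P2ne P2P4 finite_subset[OF P2P4 P4fin] lc(2) by (intro sum_pos) (auto simp: P4)
  have inv_le: "1 / d4 \<le> 1 / \<tau> p" if "p < m" for p
    using d4max[OF that] kkt(2)[OF that] by (simp add: frac_le)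
  have inv_eq: "1 / \<tau> p = 1 / d4 \<longleftrightarrow> \<tau> p = d4" for p by simp
  \<comment> \<open>At a positive index strictness comes from comparing the minimizers for p and i.
    At a negative index stationarity gives only a weak inequality, and \<open>assumption_A1\<close>
    excludes equality.\<close>
  have a1: "ys p i < 1" if p: "p \<in> P4 B m n" and i: "i < n" "i \<noteq> p" "u p i = 0" for p i
  proof -
    have pm: "p < m" "\<tau> p = d4" using p by (auto simp: P4)
    have "(\<Sum>j<n. b i j * w p j) < \<tau> p"
    proof (cases "i < m")
      case True
      show ?thesis unfolding \<tau>_def
        by (rule L.minimizer_separation[OF pm(1) True _ assms(8) feas[OF pm(1)] feas[OF True]])
           (use i d4max[OF True] pm in \<open>auto simp: \<tau>_def\<close>)
    next
      case False
      have "w p i = 0" using i(3) kkt(2)[OF pm(1)] by (simp add: u_def)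
      hence "i \<in> {m..<n} - Ibar B m n p" using False i by (auto simp: Ibar_def w_def)
      hence "(unit_vec n i - wbar B m n p) \<bullet> (B *\<^sub>v wbar B m n p) \<noteq> 0"
        using assms(10) pm(1) unfolding assumption_A1_def by blast
      moreover have "(unit_vec n i - wbar B m n p) \<bullet> (B *\<^sub>v wbar B m n p) = (\<Sum>j<n. b i j * w p j) - \<tau> p"
      proof -
        have wc: "wbar B m n p \<in> carrier_vec n" using L.wbar_minimizer(3)[OF BC bB pm(1) assms(8)] .
        have "(unit_vec n i - wbar B m n p) \<bullet> (B *\<^sub>v wbar B m n p) =
            unit_vec n i \<bullet> (B *\<^sub>v wbar B m n p) - wbar B m n p \<bullet> (B *\<^sub>v wbar B m n p)"
          using wc BC by (intro minus_scalar_prod_distrib) auto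
        also have "unit_vec n i \<bullet> (B *\<^sub>v wbar B m n p) = (B *\<^sub>v wbar B m n p) $ i"
          using mult_mat_vec_carrier[OF BC wc] i by (intro scalar_prod_left_unit)
        also have "\<dots> = (\<Sum>j<n. b i j * w p j)"
          using BC wc i by (auto simp: scalar_prod_def lessThan_atLeast0 b_def w_def intro!: sum.cong)
        also have "wbar B m n p \<bullet> (B *\<^sub>v wbar B m n p) = \<tau> p"
          using scalar_prod_mult_mat_vec[OF BC wc wc] by (simp add: \<tau>_def qform_def b_def w_def)
        finally show ?thesis .
      qed
      moreover have "(\<Sum>j<n. b i j * w p j) \<le> \<tau> p" using kkt(4)[OF pm(1)] False i by simp
      ultimately show ?thesis by simp
    qed
    thus ?thesis using kkt(2)[OF pm(1)] by (simp add: ysw)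
  qed
  have tot_asymp: "(\<lambda>t. measure L.law (L.exceed m t) - (\<Sum>p\<in>P2 \<mu> B m n. delta1p \<mu> B m n p) * gtail (1 / d4) (delta2 \<mu> B m n) (delta3 \<mu> B m n) t)
      \<in> O(\<lambda>t. gtail (1 / d4) (delta2 \<mu> B m n) (delta3 \<mu> B m n) t * t powr (-1/2))"
  proof (rule L.exceedance_asymp[where u = u and ys = ys and S = "\<lambda>p. 1 / \<tau> p" and ?Q4.0 = "P4 B m n"
        and a = "\<lambda>p. delta2p B m n p" and e = "\<lambda>p. delta3p \<mu> B m n p"])
    show "m \<le> n" "1 \<le> m" by (fact assms(8), fact assms(7))
    show "ys p i = (\<Sum>j<n. b i j * u p j)" for p i by (simp add: ys_def)
    show "1 / \<tau> p = (\<Sum>i<n. u p i * ys p i)" if "p < m" for p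
    proof -
      have "(\<Sum>i<n. u p i * ys p i) = (\<Sum>i<n. (\<Sum>j<n. b i j * w p j) * w p i) / \<tau> p / \<tau> p"
      proof -
        have "(\<Sum>i<n. w p i / \<tau> p * (G i / \<tau> p)) = (\<Sum>i<n. G i * w p i) / \<tau> p / \<tau> p" for G
          by (simp add: sum_divide_distrib mult.commute)
        thus ?thesis unfolding ysw u_def .
      qed
      also have "(\<Sum>i<n. (\<Sum>j<n. b i j * w p j) * w p i) = \<tau> p" unfolding \<tau>_def L.qform_b ..
      finally show ?thesis using kkt(2)[OF that] by simp
    qed
    show "1 / \<tau> p > 0" if "p < m" for p using kkt(2)[OF that] by simp
    show "1 / \<tau> p = (\<Sum>i<n. u p i)" if "p < m" for p
      using feas(1)[OF that] by (simp add: u_def feasible_def flip: sum_divide_distrib)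
    show "u p i = 0" if "p < m" "i < m" "i \<noteq> p" for p i
      using feas(1)[OF that(1)] that by (simp add: u_def feasible_def)
    show "u p i \<le> 0" if "p < m" "m \<le> i" "i < n" for p i
      using feas(1)[OF that(1)] kkt(2)[OF that(1)] that by (simp add: u_def feasible_def divide_nonpos_pos)
    show "delta1p \<mu> B m n p > 0" if "p < m" for p by (rule lc(2)[OF that])
    show "P4 B m n = {p. p < m \<and> 1 / \<tau> p = 1 / d4}" unfolding P4 inv_eq ..
    show "1 / d4 \<le> 1 / \<tau> p" if "p < m" for p by (rule inv_le[OF that])
    show "ys p p = 1" if "p \<in> P4 B m n" for p
      using kkt(2,3)[of p] that by (simp add: P4 ysw)
    show "ys p i < 1" if "p \<in> P4 B m n" "i < n" "i \<noteq> p" "u p i = 0" for p i by (rule a1[OF that])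
    show "(\<lambda>t. measure L.law {y \<in> space L.law. sgn_sum p {i \<in> {m..<n}. u p i \<noteq> 0} y > exp t}
        - delta1p \<mu> B m n p * gtail (1 / \<tau> p) (delta2p B m n p) (delta3p \<mu> B m n p) t)
      \<in> O(\<lambda>t. delta1p \<mu> B m n p * gtail (1 / \<tau> p) (delta2p B m n p) (delta3p \<mu> B m n p) t * t powr (-1/2))"
      if "p \<in> P4 B m n" for p
    proof -
      have p: "p < m" using that by (simp add: P4)
      have "{i \<in> {m..<n}. u p i \<noteq> 0} = {i \<in> {m..<n}. w p i \<noteq> 0}"
        using kkt(2)[OF p] by (auto simp: u_def)
      thus ?thesis using lc(3)[OF p] by simp
    qed
    show "P2 \<mu> B m n \<subseteq> P4 B m n" by (rule P2P4)
    show "delta2p B m n p = delta2 \<mu> B m n \<and> delta3p \<mu> B m n p = delta3 \<mu> B m n" if "p \<in> P2 \<mu> B m n" for p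
      using that by (auto simp: P2_def P3_def)
    show "delta3p \<mu> B m n p < delta3 \<mu> B m n \<or>
        delta3p \<mu> B m n p = delta3 \<mu> B m n \<and> delta2p B m n p \<le> delta2 \<mu> B m n - 1/2"
      if p: "p \<in> P4 B m n - P2 \<mu> B m n" for p
    proof (cases "p \<in> P3 \<mu> B m n")
      case True
      hence "delta2p B m n p \<noteq> delta2 \<mu> B m n" using p by (auto simp: P2_def)
      moreover have "delta2p B m n p \<le> delta2 \<mu> B m n"
        unfolding delta2_def using True P3fin by (intro Max_ge) auto
      ultimately have lt: "delta2p B m n p < delta2 \<mu> B m n" by simp
      from P2ne obtain q where "q \<in> P2 \<mu> B m n" by blast
      hence q: "delta2 \<mu> B m n = delta2p B m n q" by (simp add: P2_def)
      \<comment> \<open>Sizes of active sets are integers, so a strict difference is at least 1 and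
        separates the powers of t by at least 1/2.\<close>
      have "nbar B m n q + 1 \<le> nbar B m n p" using lt unfolding q delta2p_def by simp
      hence "real (nbar B m n q + 1) \<le> real (nbar B m n p)" by (rule of_nat_mono)
      hence "delta2p B m n p \<le> delta2 \<mu> B m n - 1/2" unfolding q delta2p_def by (simp add: field_simps)
      thus ?thesis using True by (simp add: P3_def)
    next
      case False
      hence "delta3p \<mu> B m n p \<noteq> delta3 \<mu> B m n" using p by (auto simp: P3_def)
      moreover have "delta3p \<mu> B m n p \<le> delta3 \<mu> B m n"
        unfolding delta3_def using p P4fin by (intro Max_ge) auto
      ultimately show ?thesis by simp
    qed
  qed
  define D where "D = (\<lambda>x. delta1 \<mu> B m n * ln x powr delta2 \<mu> B m n * x powr delta3 \<mu> B m n
                * exp (- (ln x)\<^sup>2 / (2 * delta4 B m n)))"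
  have "(\<lambda>x. measure L.law (L.exceed m (ln x)) - delta1 \<mu> B m n * gtail (1 / d4) (delta2 \<mu> B m n) (delta3 \<mu> B m n) (ln x))
      \<in> O(\<lambda>x. gtail (1 / d4) (delta2 \<mu> B m n) (delta3 \<mu> B m n) (ln x) * ln x powr (-1/2))"
    using landau_o.big.compose[OF tot_asymp ln_at_top] unfolding delta1_def .
  hence "(\<lambda>x. measure L.law (L.exceed m (ln x)) - delta1 \<mu> B m n * gtail (1 / d4) (delta2 \<mu> B m n) (delta3 \<mu> B m n) (ln x))
      \<in> O(\<lambda>x. delta1 \<mu> B m n * (gtail (1 / d4) (delta2 \<mu> B m n) (delta3 \<mu> B m n) (ln x) * ln x powr (-1/2)))"
    using d1pos by simp
  \<comment> \<open>The two sides agree for positive x, where exp (ln x) = x; eventual equality is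
    all that the Landau symbol needs.\<close>
  also have "?this \<longleftrightarrow> (\<lambda>x. measure M {\<omega> \<in> space M. Xm m n (Y \<omega>) \<ge> x} - D x) \<in> O(\<lambda>x. D x * ln x powr (-1/2))"
  proof (rule landau_o.big.cong_ex)
    have DG: "D x = delta1 \<mu> B m n * gtail (1 / d4) (delta2 \<mu> B m n) (delta3 \<mu> B m n) (ln x)" if "x > 0" for x
    proof -
      have "x powr delta3 \<mu> B m n * exp (- (ln x)\<^sup>2 / (2 * d4)) = exp (delta3 \<mu> B m n * ln x - 1 / d4 * (ln x)\<^sup>2 / 2)"
        using that by (simp add: powr_def flip: exp_add)
      thus ?thesis unfolding D_def gtail_def d4_def[symmetric] by (simp add: mult.assoc)
    qed
    show "\<forall>\<^sub>F x in at_top. measure L.law (L.exceed m (ln x)) - delta1 \<mu> B m n * gtail (1 / d4) (delta2 \<mu> B m n) (delta3 \<mu> B m n) (ln x)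
        = measure M {\<omega> \<in> space M. Xm m n (Y \<omega>) \<ge> x} - D x"
      using eventually_gt_at_top[of 0]
    proof eventually_elim
      case (elim x)
      have "L.exceed m (ln x) \<in> sets (lborel_PiM {..<n})" using L.exceed_sets[OF assms(8)] by simp
      hence "measure L.law (L.exceed m (ln x)) = measure M (Y -` L.exceed m (ln x) \<inter> space M)"
        unfolding law by (intro measure_distr Ym)
      also have "Y -` L.exceed m (ln x) \<inter> space M = {\<omega> \<in> space M. Xm m n (Y \<omega>) \<ge> x}"
        using elim measurable_space[OF Ym] by (auto simp: L.exceed_def)
      finally show ?case using DG[OF elim] by simp
    qed
    show "\<forall>\<^sub>F x in at_top. delta1 \<mu> B m n * (gtail (1 / d4) (delta2 \<mu> B m n) (delta3 \<mu> B m n) (ln x) * ln x powr (-1/2))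
        = D x * ln x powr (-1/2)"
      using eventually_gt_at_top[of 0] by eventually_elim (simp add: DG)
  qed
  finally show ?thesis unfolding D_def .
qed

end
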